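(* Let $\phi:(M^{n+1},g)\to(N^n,h)$ be a Riemannian submersion with an adapted frame $\{e_1,\dots,e_{n+1}\}$ ($e_{n+1}$ vertical) and integrability data $\{f^k_{ij},\kappa_i,\sigma_{ij}\}$. Then (on the domain of the frame) $\phi$ is biharmonic if and only if, for every $k=1,2,\dots,n$, $$\Delta\kappa_k+\sum_{i,j=1}^n\Big(2e_i(\kappa_j)P^k_{ij}+\kappa_j\Big[e_i(P^k_{ij})+\sum_{l=1}^nP^l_{ij}P^k_{il}-\kappa_iP^k_{ij}-\sum_{l=1}^nP^l_{ii}P^k_{lj}\Big]\Big)+\mathrm{Ricci}^N(\mathrm d\phi(\mu),\mathrm d\phi(e_k))=0,$$ where $P^k_{ij}=\frac12(-f^j_{ik}-f^i_{jk}+f^k_{ij})$ for all $i,j,k=1,\dots,n$, $\mu$ is the mean curvature vector field of the fibers, and $\Delta$ denotes the Laplacian of $(M^{n+1},g)$.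
   Context: A map $\phi:(M,g)\to(N,h)$ between Riemannian manifolds is biharmonic if its bitension field $\tau_2(\phi)=\mathrm{Trace}_g(\nabla^\phi\nabla^\phi-\nabla^\phi_{\nabla^M})\tau(\phi)-\mathrm{Trace}_gR^N(\mathrm d\phi,\tau(\phi))\mathrm d\phi$ vanishes, where $\tau(\phi)=\mathrm{Trace}_g\nabla\mathrm d\phi$ is the tension field, $\nabla^\phi$ is the pull-back connection on $\phi^{-1}TN$, and $R^N(X,Y)Z=[\nabla^N_X,\nabla^N_Y]Z-\nabla^N_{[X,Y]}Z$. Let $\phi:(M^{n+1},g)\to(N^n,h)$ be a Riemannian submersion. Vertical vectors are those in $\ker \mathrm d\phi$ and horizontal vectors those orthogonal to them. A local orthonormal frame $\{e_1,\dots,e_n,e_{n+1}\}$ on $M$ is adapted to $\phi$ if $e_{n+1}$ is vertical and $e_1,\dots,e_n$ are horizontal and basic, i.e. $\phi$-related to a local orthonormal frame $\varepsilon_1,\dots,\varepsilon_n$ of $N$. Write $[\varepsilon_i,\varepsilon_j]=\sum_{k=1}^n F^k_{ij}\varepsilon_k$ with $F^k_{ij}$ smooth functions on (the relevant open subset of) $N$, and $f^k_{ij}=F^k_{ij}\circ\phi$. Then there are smooth functions $\kappa_i,\sigma_{ij}$ on the domain of the frame with $[e_i,e_{n+1}]=\kappa_ie_{n+1}$ and $[e_i,e_j]=\sum_{k=1}^nf^k_{ij}e_k-2\sigma_{ij}e_{n+1}$ for $i,j=1,\dots,n$. The collection $\{f^k_{ij},\kappa_i,\sigma_{ij}\}$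 is called the integrability data of the adapted frame. The mean curvature vector field of the fibers is the horizontal part $\mu=(\nabla^M_{e_{n+1}}e_{n+1})^{\mathcal H}$. $\mathrm{Ricci}^N(\cdot,\cdot)$ is the Ricci tensor of $(N,h)$. The Laplacian is $\Delta u=\mathrm{Trace}_g\nabla\mathrm du$. *)

theory Defs
  imports "HOL-Analysis.Analysis"
begin

section \<open>Smooth manifolds\<close>

primrec C_k_on :: "nat \<Rightarrow> 'e::euclidean_space set \<Rightarrow> ('e \<Rightarrow> 'f::euclidean_space) \<Rightarrow> bool" where
  "C_k_on 0 S f \<longleftrightarrow> continuous_on S f"
| "C_k_on (Suc k) S f \<longleftrightarrow>
     (\<forall>x\<in>S. f differentiable (at x)) \<and> (\<forall>v. C_k_on k S (\<lambda>x. frechet_derivative f (at x) v))"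

definition C_inf_on :: "'e::euclidean_space set \<Rightarrow> ('e \<Rightarrow> 'f::euclidean_space) \<Rightarrow> bool" where
  "C_inf_on S f \<longleftrightarrow> (\<forall>k. C_k_on k S f)"

text \<open>A manifold is a whole (Hausdorff, second countable) topological type equipped with a smooth
  atlas. A chart is a pair of its open domain and its coordinate map; the values of the coordinate
  map outside the domain are irrelevant. The dimension of the manifold is the dimension of
  the model space \<open>'e\<close>. The atlas need not be maximal.\<close>

type_synonym ('a, 'e) atlas = "('a set \<times> ('a \<Rightarrow> 'e)) set"

definition smooth_atlas ::
  "('a::{t2_space,second_countable_topology}, 'e::euclidean_space) atlas \<Rightarrow> bool" where
  "smooth_atlas A \<longleftrightarrow>
     (\<Union>(U, x)\<in>A. U) = UNIV \<and>
     (\<forall>(U, x)\<in>A. open U \<and> open (x ` U) \<and> homeomorphism U (x ` U) x (inv_into U x)) \<and>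
     (\<forall>(U, x)\<in>A. \<forall>(V, y)\<in>A. C_inf_on (x ` (U \<inter> V)) (y \<circ> inv_into U x))"

text \<open>Used for open \<open>W\<close> only.\<close>

definition smooth_on ::
  "('a::{t2_space,second_countable_topology}, 'e::euclidean_space) atlas \<Rightarrow> 'a set \<Rightarrow> ('a \<Rightarrow> real) \<Rightarrow> bool"
where
  "smooth_on A W f \<longleftrightarrow> (\<forall>(U, x)\<in>A. C_inf_on (x ` (U \<inter> W)) (f \<circ> inv_into U x))"

definition smooth_near ::
  "('a::{t2_space,second_countable_topology}, 'e::euclidean_space) atlas \<Rightarrow> 'a \<Rightarrow> ('a \<Rightarrow> real) \<Rightarrow> bool"
where
  "smooth_near A p f \<longleftrightarrow> (\<exists>W. open W \<and> p \<in> W \<and> smooth_on A W f)"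

definition smooth_map ::
  "('a::{t2_space,second_countable_topology}, 'e::euclidean_space) atlas \<Rightarrow>
   ('b::{t2_space,second_countable_topology}, 'f::euclidean_space) atlas \<Rightarrow> ('a \<Rightarrow> 'b) \<Rightarrow> bool"
where
  "smooth_map A B \<phi> \<longleftrightarrow> continuous_on UNIV \<phi> \<and>
     (\<forall>(U, x)\<in>A. \<forall>(V, y)\<in>B. C_inf_on (x ` (U \<inter> \<phi> -` V)) (y \<circ> \<phi> \<circ> inv_into U x))"


section \<open>Tangent vectors and vector fields\<close>

text \<open>A tangent vector at \<open>p\<close> is a derivation of germs at \<open>p\<close> of smooth functions. It is represented
  as a functional on all functions that is \<open>0\<close> on those which are not smooth near \<open>p\<close>, so that
  equality of tangent vectors is equality of functionals.\<close>

type_synonym 'a tvec = "('a \<Rightarrow> real) \<Rightarrow> real"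

definition tangent_space ::
  "('a::{t2_space,second_countable_topology}, 'e::euclidean_space) atlas \<Rightarrow> 'a \<Rightarrow> 'a tvec set" where
  "tangent_space A p = {v.
     (\<forall>f g. smooth_near A p f \<and> smooth_near A p g \<longrightarrow>
        v (\<lambda>q. f q + g q) = v f + v g \<and>
        (\<forall>c. v (\<lambda>q. c * f q) = c * v f) \<and>
        v (\<lambda>q. f q * g q) = v f * g p + f p * v g) \<and>
     (\<forall>f g. (\<forall>\<^sub>F q in nhds p. f q = g q) \<longrightarrow> v f = v g) \<and>
     (\<forall>f. \<not> smooth_near A p f \<longrightarrow> v f = 0)}"

definition differential ::
  "('b::{t2_space,second_countable_topology}, 'f::euclidean_space) atlas \<Rightarrow> ('a \<Rightarrow> 'b) \<Rightarrow>
   'a \<Rightarrow> 'a tvec \<Rightarrow> 'b tvec" where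
  "differential B \<phi> p v = (\<lambda>F. if smooth_near B (\<phi> p) F then v (F \<circ> \<phi>) else 0)"

text \<open>Smooth sections over \<open>W\<close> of the pull-back bundle \<open>\<phi>\<^sup>-\<^sup>1TN\<close>. Values outside \<open>W\<close> are
  irrelevant.\<close>

definition sections_along ::
  "('a::{t2_space,second_countable_topology}, 'e::euclidean_space) atlas \<Rightarrow>
   ('b::{t2_space,second_countable_topology}, 'f::euclidean_space) atlas \<Rightarrow> ('a \<Rightarrow> 'b) \<Rightarrow>
   'a set \<Rightarrow> ('a \<Rightarrow> 'b tvec) set" where
  "sections_along A B \<phi> W = {V.
     (\<forall>p\<in>W. V p \<in> tangent_space B (\<phi> p)) \<and>
     (\<forall>U F. open U \<and> smooth_on B U F \<longrightarrow> smooth_on A (W \<inter> \<phi> -` U) (\<lambda>p. V p F))}"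

definition vector_fields ::
  "('a::{t2_space,second_countable_topology}, 'e::euclidean_space) atlas \<Rightarrow> 'a set \<Rightarrow>
   ('a \<Rightarrow> 'a tvec) set" where
  "vector_fields A W = sections_along A A (\<lambda>p. p) W"

definition lie_bracket ::
  "('a::{t2_space,second_countable_topology}, 'e::euclidean_space) atlas \<Rightarrow>
   ('a \<Rightarrow> 'a tvec) \<Rightarrow> ('a \<Rightarrow> 'a tvec) \<Rightarrow> 'a \<Rightarrow> 'a tvec" where
  "lie_bracket A X Y p =
     (\<lambda>f. if smooth_near A p f then X p (\<lambda>q. Y q f) - Y p (\<lambda>q. X q f) else 0)"


section \<open>Riemannian metrics, orthonormal bases and traces\<close>

type_synonym 'a metric = "'a \<Rightarrow> 'a tvec \<Rightarrow> 'a tvec \<Rightarrow> real"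

definition riemannian_metric ::
  "('a::{t2_space,second_countable_topology}, 'e::euclidean_space) atlas \<Rightarrow> 'a metric \<Rightarrow> bool" where
  "riemannian_metric A g \<longleftrightarrow>
     (\<forall>p. \<forall>u\<in>tangent_space A p. \<forall>v\<in>tangent_space A p.
        g p u v = g p v u \<and>
        (u \<noteq> (\<lambda>f. 0) \<longrightarrow> g p u u > 0) \<and>
        (\<forall>w\<in>tangent_space A p. \<forall>a b.
           g p (\<lambda>f. a * u f + b * v f) w = a * g p u w + b * g p v w)) \<and>
     (\<forall>W X Y. open W \<and> X \<in> vector_fields A W \<and> Y \<in> vector_fields A W \<longrightarrow>
        smooth_on A W (\<lambda>p. g p (X p) (Y p)))"

definition orthonormal_basis ::
  "('a::{t2_space,second_countable_topology}, 'e::euclidean_space) atlas \<Rightarrow> 'a metric \<Rightarrow> 'a \<Rightarrow>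
   (nat \<Rightarrow> 'a tvec) \<Rightarrow> bool" where
  "orthonormal_basis A g p b \<longleftrightarrow>
     (\<forall>i\<in>{1..DIM('e)}. b i \<in> tangent_space A p) \<and>
     (\<forall>i\<in>{1..DIM('e)}. \<forall>j\<in>{1..DIM('e)}. g p (b i) (b j) = (if i = j then 1 else 0)) \<and>
     (\<forall>v\<in>tangent_space A p. \<exists>c. v = (\<lambda>f. \<Sum>i=1..DIM('e). c i * b i f))"

definition orthonormal_frame ::
  "('a::{t2_space,second_countable_topology}, 'e::euclidean_space) atlas \<Rightarrow> 'a metric \<Rightarrow> 'a set \<Rightarrow>
   (nat \<Rightarrow> 'a \<Rightarrow> 'a tvec) \<Rightarrow> bool" where
  "orthonormal_frame A g W e \<longleftrightarrow> open W \<and>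
     (\<forall>i\<in>{1..DIM('e)}. e i \<in> vector_fields A W) \<and>
     (\<forall>p\<in>W. orthonormal_basis A g p (\<lambda>i. e i p))"

text \<open>Trace with respect to \<open>g\<close> of a bilinear form on the tangent space at \<open>p\<close>: the
  value of \<open>\<Sum>i. T (b i) (b i)\<close>, which is the same for every orthonormal basis \<open>b\<close>.\<close>

definition metric_trace ::
  "('a::{t2_space,second_countable_topology}, 'e::euclidean_space) atlas \<Rightarrow> 'a metric \<Rightarrow> 'a \<Rightarrow>
   ('a tvec \<Rightarrow> 'a tvec \<Rightarrow> real) \<Rightarrow> real" where
  "metric_trace A g p T =
     (THE c. \<exists>b. orthonormal_basis A g p b \<and> c = (\<Sum>i=1..DIM('e). T (b i) (b i)))"

text \<open>For a bilinear map with values in a tangent space of \<open>N\<close>; the linear structure there is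
  pointwise.\<close>

definition metric_trace_vec ::
  "('a::{t2_space,second_countable_topology}, 'e::euclidean_space) atlas \<Rightarrow> 'a metric \<Rightarrow> 'a \<Rightarrow>
   ('a tvec \<Rightarrow> 'a tvec \<Rightarrow> 'b tvec) \<Rightarrow> 'b tvec" where
  "metric_trace_vec A g p T = (\<lambda>F. metric_trace A g p (\<lambda>u v. T u v F))"


section \<open>Connections\<close>

text \<open>\<open>D p v V\<close> is the covariant derivative at \<open>p\<close> of the section \<open>V\<close> in the direction of the tangent
  vector \<open>v\<close>. A connection on \<open>\<phi>\<^sup>-\<^sup>1TN\<close> over the open set \<open>U\<close> acts on the sections over all
  open \<open>W \<subseteq> U\<close>.\<close>

type_synonym ('a, 'b) conn = "'a \<Rightarrow> 'a tvec \<Rightarrow> ('a \<Rightarrow> 'b tvec) \<Rightarrow> 'b tvec"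

definition connection_along ::
  "('a::{t2_space,second_countable_topology}, 'e::euclidean_space) atlas \<Rightarrow>
   ('b::{t2_space,second_countable_topology}, 'f::euclidean_space) atlas \<Rightarrow> ('a \<Rightarrow> 'b) \<Rightarrow>
   'a set \<Rightarrow> ('a, 'b) conn \<Rightarrow> bool" where
  "connection_along A B \<phi> U D \<longleftrightarrow> open U \<and>
     (\<forall>W V. open W \<and> W \<subseteq> U \<and> V \<in> sections_along A B \<phi> W \<longrightarrow>
        (\<forall>X\<in>vector_fields A W. (\<lambda>p. D p (X p) V) \<in> sections_along A B \<phi> W) \<and>
        (\<forall>p\<in>W. \<forall>v\<in>tangent_space A p.
           (\<forall>w\<in>tangent_space A p. \<forall>a b.
              D p (\<lambda>f. a * v f + b * w f) V = (\<lambda>F. a * D p v V F + b * D p w V F)) \<and>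
           (\<forall>V'\<in>sections_along A B \<phi> W.
              D p v (\<lambda>q F. V q F + V' q F) = (\<lambda>F. D p v V F + D p v V' F)) \<and>
           (\<forall>f. smooth_on A W f \<longrightarrow>
              D p v (\<lambda>q F. f q * V q F) = (\<lambda>F. v f * V p F + f p * D p v V F))))"

definition levi_civita_connection ::
  "('a::{t2_space,second_countable_topology}, 'e::euclidean_space) atlas \<Rightarrow> 'a metric \<Rightarrow>
   'a set \<Rightarrow> ('a, 'a) conn \<Rightarrow> bool" where
  "levi_civita_connection A g U D \<longleftrightarrow> connection_along A A (\<lambda>p. p) U D \<and>
     (\<forall>W X Y. open W \<and> W \<subseteq> U \<and> X \<in> vector_fields A W \<and> Y \<in> vector_fields A W \<longrightarrow>
        (\<forall>p\<in>W. (\<lambda>f. D p (X p) Y f - D p (Y p) X f) = lie_bracket A X Y p) \<and>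
        (\<forall>p\<in>W. \<forall>v\<in>tangent_space A p.
           v (\<lambda>q. g q (X q) (Y q)) = g p (D p v X) (Y p) + g p (X p) (D p v Y)))"

text \<open>The Levi-Civita connection exists and is unique on every open subset, and it is local; hence
  its value at \<open>p\<close> may be taken from any open neighbourhood \<open>U\<close> of \<open>p\<close>.\<close>

definition nabla ::
  "('a::{t2_space,second_countable_topology}, 'e::euclidean_space) atlas \<Rightarrow> 'a metric \<Rightarrow> ('a, 'a) conn"
where
  "nabla A g p v Y =
     (THE w. \<exists>U D. p \<in> U \<and> levi_civita_connection A g U D \<and> w = D p v Y)"

definition pullback_connection ::
  "('a::{t2_space,second_countable_topology}, 'e::euclidean_space) atlas \<Rightarrow>
   ('b::{t2_space,second_countable_topology}, 'f::euclidean_space) atlas \<Rightarrow> 'b metric \<Rightarrow>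
   ('a \<Rightarrow> 'b) \<Rightarrow> 'a set \<Rightarrow> ('a, 'b) conn \<Rightarrow> bool" where
  "pullback_connection A B h \<phi> U D \<longleftrightarrow> connection_along A B \<phi> U D \<and>
     (\<forall>p\<in>U. \<forall>v\<in>tangent_space A p. \<forall>V Y. open V \<and> \<phi> p \<in> V \<and> Y \<in> vector_fields B V \<longrightarrow>
        D p v (Y \<circ> \<phi>) = nabla B h (\<phi> p) (differential B \<phi> p v) Y)"

definition pullback_nabla ::
  "('a::{t2_space,second_countable_topology}, 'e::euclidean_space) atlas \<Rightarrow>
   ('b::{t2_space,second_countable_topology}, 'f::euclidean_space) atlas \<Rightarrow> 'b metric \<Rightarrow>
   ('a \<Rightarrow> 'b) \<Rightarrow> ('a, 'b) conn" where
  "pullback_nabla A B h \<phi> p v V =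
     (THE w. \<exists>U D. p \<in> U \<and> pullback_connection A B h \<phi> U D \<and> w = D p v V)"


section \<open>Curvature, tension field, bitension field\<close>

text \<open>In each of the following tensors, the value on tangent vectors at a point is the one computed
  from arbitrary local extensions of these vectors to vector fields.\<close>

definition curvature ::
  "('a::{t2_space,second_countable_topology}, 'e::euclidean_space) atlas \<Rightarrow> 'a metric \<Rightarrow> 'a \<Rightarrow>
   'a tvec \<Rightarrow> 'a tvec \<Rightarrow> 'a tvec \<Rightarrow> 'a tvec" where
  "curvature A g p u v w =
     (THE z. \<exists>W X Y Z. open W \<and> p \<in> W \<and>
        X \<in> vector_fields A W \<and> Y \<in> vector_fields A W \<and> Z \<in> vector_fields A W \<and>
        X p = u \<and> Y p = v \<and> Z p = w \<and>
        z = (\<lambda>f. nabla A g p (X p) (\<lambda>q. nabla A g q (Y q) Z) f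
               - nabla A g p (Y p) (\<lambda>q. nabla A g q (X q) Z) f
               - nabla A g p (lie_bracket A X Y p) Z f))"

definition ricci ::
  "('a::{t2_space,second_countable_topology}, 'e::euclidean_space) atlas \<Rightarrow> 'a metric \<Rightarrow> 'a \<Rightarrow>
   'a tvec \<Rightarrow> 'a tvec \<Rightarrow> real" where
  "ricci A g p u v = metric_trace A g p (\<lambda>a b. g p (curvature A g p a u v) b)"

text \<open>\<open>(\<nabla>du)(v, w)\<close> for a function \<open>u\<close>.\<close>

definition hessian ::
  "('a::{t2_space,second_countable_topology}, 'e::euclidean_space) atlas \<Rightarrow> 'a metric \<Rightarrow>
   ('a \<Rightarrow> real) \<Rightarrow> 'a \<Rightarrow> 'a tvec \<Rightarrow> 'a tvec \<Rightarrow> real" where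
  "hessian A g u p v w =
     (THE c. \<exists>W Y. open W \<and> p \<in> W \<and> Y \<in> vector_fields A W \<and> Y p = w \<and>
        c = v (\<lambda>q. Y q u) - nabla A g p v Y u)"

definition laplacian ::
  "('a::{t2_space,second_countable_topology}, 'e::euclidean_space) atlas \<Rightarrow> 'a metric \<Rightarrow>
   ('a \<Rightarrow> real) \<Rightarrow> 'a \<Rightarrow> real" where
  "laplacian A g u p = metric_trace A g p (hessian A g u p)"

text \<open>\<open>(\<nabla>d\<phi>)(v, w)\<close> for a map \<open>\<phi>\<close>.\<close>

definition second_fundamental_form ::
  "('a::{t2_space,second_countable_topology}, 'e::euclidean_space) atlas \<Rightarrow> 'a metric \<Rightarrow>
   ('b::{t2_space,second_countable_topology}, 'f::euclidean_space) atlas \<Rightarrow> 'b metric \<Rightarrow>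
   ('a \<Rightarrow> 'b) \<Rightarrow> 'a \<Rightarrow> 'a tvec \<Rightarrow> 'a tvec \<Rightarrow> 'b tvec" where
  "second_fundamental_form A g B h \<phi> p v w =
     (THE z. \<exists>W Y. open W \<and> p \<in> W \<and> Y \<in> vector_fields A W \<and> Y p = w \<and>
        z = (\<lambda>F. pullback_nabla A B h \<phi> p v (\<lambda>q. differential B \<phi> q (Y q)) F
               - differential B \<phi> p (nabla A g p v Y) F))"

definition tension_field ::
  "('a::{t2_space,second_countable_topology}, 'e::euclidean_space) atlas \<Rightarrow> 'a metric \<Rightarrow>
   ('b::{t2_space,second_countable_topology}, 'f::euclidean_space) atlas \<Rightarrow> 'b metric \<Rightarrow>
   ('a \<Rightarrow> 'b) \<Rightarrow> 'a \<Rightarrow> 'b tvec" where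
  "tension_field A g B h \<phi> p =
     metric_trace_vec A g p (second_fundamental_form A g B h \<phi> p)"

text \<open>\<open>(\<nabla>\<^sup>\<phi>\<nabla>\<^sup>\<phi> - \<nabla>\<^sup>\<phi>\<^bsub>\<nabla>M\<^esub>)(v, w)\<close> applied to a section \<open>V\<close> of \<open>\<phi>\<^sup>-\<^sup>1TN\<close>.\<close>

definition second_covariant_derivative ::
  "('a::{t2_space,second_countable_topology}, 'e::euclidean_space) atlas \<Rightarrow> 'a metric \<Rightarrow>
   ('b::{t2_space,second_countable_topology}, 'f::euclidean_space) atlas \<Rightarrow> 'b metric \<Rightarrow>
   ('a \<Rightarrow> 'b) \<Rightarrow> ('a \<Rightarrow> 'b tvec) \<Rightarrow> 'a \<Rightarrow> 'a tvec \<Rightarrow> 'a tvec \<Rightarrow> 'b tvec" where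
  "second_covariant_derivative A g B h \<phi> V p v w =
     (THE z. \<exists>W Y. open W \<and> p \<in> W \<and> Y \<in> vector_fields A W \<and> Y p = w \<and>
        z = (\<lambda>F. pullback_nabla A B h \<phi> p v (\<lambda>q. pullback_nabla A B h \<phi> q (Y q) V) F
               - pullback_nabla A B h \<phi> p (nabla A g p v Y) V F))"

definition bitension_field ::
  "('a::{t2_space,second_countable_topology}, 'e::euclidean_space) atlas \<Rightarrow> 'a metric \<Rightarrow>
   ('b::{t2_space,second_countable_topology}, 'f::euclidean_space) atlas \<Rightarrow> 'b metric \<Rightarrow>
   ('a \<Rightarrow> 'b) \<Rightarrow> 'a \<Rightarrow> 'b tvec" where
  "bitension_field A g B h \<phi> p =
     (let \<tau> = tension_field A g B h \<phi> in
      (\<lambda>F. metric_trace_vec A g p (second_covariant_derivative A g B h \<phi> \<tau> p) F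
        - metric_trace_vec A g p
            (\<lambda>u v. curvature B h (\<phi> p) (differential B \<phi> p u) (\<tau> p) (differential B \<phi> p v)) F))"

definition biharmonic_on ::
  "('a::{t2_space,second_countable_topology}, 'e::euclidean_space) atlas \<Rightarrow> 'a metric \<Rightarrow>
   ('b::{t2_space,second_countable_topology}, 'f::euclidean_space) atlas \<Rightarrow> 'b metric \<Rightarrow>
   'a set \<Rightarrow> ('a \<Rightarrow> 'b) \<Rightarrow> bool" where
  "biharmonic_on A g B h W \<phi> \<longleftrightarrow> (\<forall>p\<in>W. bitension_field A g B h \<phi> p = (\<lambda>F. 0))"


section \<open>Riemannian submersions and adapted frames\<close>

definition vertical_space ::
  "('a::{t2_space,second_countable_topology}, 'e::euclidean_space) atlas \<Rightarrow>
   ('b::{t2_space,second_countable_topology}, 'f::euclidean_space) atlas \<Rightarrow>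
   ('a \<Rightarrow> 'b) \<Rightarrow> 'a \<Rightarrow> 'a tvec set" where
  "vertical_space A B \<phi> p = {v \<in> tangent_space A p. differential B \<phi> p v = (\<lambda>F. 0)}"

definition horizontal_space ::
  "('a::{t2_space,second_countable_topology}, 'e::euclidean_space) atlas \<Rightarrow> 'a metric \<Rightarrow>
   ('b::{t2_space,second_countable_topology}, 'f::euclidean_space) atlas \<Rightarrow>
   ('a \<Rightarrow> 'b) \<Rightarrow> 'a \<Rightarrow> 'a tvec set" where
  "horizontal_space A g B \<phi> p =
     {v \<in> tangent_space A p. \<forall>w\<in>vertical_space A B \<phi> p. g p v w = 0}"

definition horizontal_part ::
  "('a::{t2_space,second_countable_topology}, 'e::euclidean_space) atlas \<Rightarrow> 'a metric \<Rightarrow>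
   ('b::{t2_space,second_countable_topology}, 'f::euclidean_space) atlas \<Rightarrow>
   ('a \<Rightarrow> 'b) \<Rightarrow> 'a \<Rightarrow> 'a tvec \<Rightarrow> 'a tvec" where
  "horizontal_part A g B \<phi> p v =
     (THE w. w \<in> horizontal_space A g B \<phi> p \<and> (\<lambda>f. v f - w f) \<in> vertical_space A B \<phi> p)"

definition riemannian_submersion ::
  "('a::{t2_space,second_countable_topology}, 'e::euclidean_space) atlas \<Rightarrow> 'a metric \<Rightarrow>
   ('b::{t2_space,second_countable_topology}, 'f::euclidean_space) atlas \<Rightarrow> 'b metric \<Rightarrow>
   ('a \<Rightarrow> 'b) \<Rightarrow> bool" where
  "riemannian_submersion A g B h \<phi> \<longleftrightarrow> smooth_map A B \<phi> \<and>
     (\<forall>p. differential B \<phi> p ` tangent_space A p = tangent_space B (\<phi> p)) \<and>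
     (\<forall>p. \<forall>u\<in>horizontal_space A g B \<phi> p. \<forall>v\<in>horizontal_space A g B \<phi> p.
        h (\<phi> p) (differential B \<phi> p u) (differential B \<phi> p v) = g p u v)"

text \<open>The frame \<open>e\<close> on \<open>W\<close> is related to the frame \<open>\<epsilon>\<close> on \<open>V \<supseteq> \<phi> ` W\<close>; with
  \<open>n = DIM('f) = DIM('e) - 1\<close> the horizontal fields are \<open>e 1, \<dots>, e n\<close>, the vertical one
  is \<open>e (n + 1)\<close>.\<close>

definition adapted_frame ::
  "('a::{t2_space,second_countable_topology}, 'e::euclidean_space) atlas \<Rightarrow> 'a metric \<Rightarrow>
   ('b::{t2_space,second_countable_topology}, 'f::euclidean_space) atlas \<Rightarrow> 'b metric \<Rightarrow>
   ('a \<Rightarrow> 'b) \<Rightarrow> 'a set \<Rightarrow> 'b set \<Rightarrow>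
   (nat \<Rightarrow> 'a \<Rightarrow> 'a tvec) \<Rightarrow> (nat \<Rightarrow> 'b \<Rightarrow> 'b tvec) \<Rightarrow> bool" where
  "adapted_frame A g B h \<phi> W V e \<epsilon> \<longleftrightarrow>
     orthonormal_frame A g W e \<and> orthonormal_frame B h V \<epsilon> \<and> \<phi> ` W \<subseteq> V \<and>
     (\<forall>p\<in>W. e (DIM('f) + 1) p \<in> vertical_space A B \<phi> p \<and>
        (\<forall>i\<in>{1..DIM('f)}. e i p \<in> horizontal_space A g B \<phi> p \<and>
           differential B \<phi> p (e i p) = \<epsilon> i (\<phi> p)))"

text \<open>\<open>f k i j\<close>, \<open>F k i j\<close>, \<open>\<sigma> i j\<close> stand for \<open>f\<^sup>k\<^sub>i\<^sub>j\<close>, \<open>F\<^sup>k\<^sub>i\<^sub>j\<close>, \<open>\<sigma>\<^sub>i\<^sub>j\<close>.\<close>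

definition integrability_data ::
  "('a::{t2_space,second_countable_topology}, 'e::euclidean_space) atlas \<Rightarrow>
   ('b::{t2_space,second_countable_topology}, 'f::euclidean_space) atlas \<Rightarrow>
   ('a \<Rightarrow> 'b) \<Rightarrow> 'a set \<Rightarrow> 'b set \<Rightarrow> (nat \<Rightarrow> 'a \<Rightarrow> 'a tvec) \<Rightarrow> (nat \<Rightarrow> 'b \<Rightarrow> 'b tvec) \<Rightarrow>
   (nat \<Rightarrow> nat \<Rightarrow> nat \<Rightarrow> 'a \<Rightarrow> real) \<Rightarrow> (nat \<Rightarrow> 'a \<Rightarrow> real) \<Rightarrow> (nat \<Rightarrow> nat \<Rightarrow> 'a \<Rightarrow> real) \<Rightarrow> bool" where
  "integrability_data A B \<phi> W V e \<epsilon> f \<kappa> \<sigma> \<longleftrightarrow>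
     (let n = DIM('f) in
      (\<exists>F. \<forall>i\<in>{1..n}. \<forall>j\<in>{1..n}.
         (\<forall>k\<in>{1..n}. smooth_on B V (F k i j) \<and> (\<forall>p\<in>W. f k i j p = F k i j (\<phi> p))) \<and>
         (\<forall>q\<in>V. lie_bracket B (\<epsilon> i) (\<epsilon> j) q = (\<lambda>u. \<Sum>k=1..n. F k i j q * \<epsilon> k q u))) \<and>
      (\<forall>i\<in>{1..n}. smooth_on A W (\<kappa> i) \<and>
         (\<forall>p\<in>W. lie_bracket A (e i) (e (n + 1)) p = (\<lambda>u. \<kappa> i p * e (n + 1) p u))) \<and>
      (\<forall>i\<in>{1..n}. \<forall>j\<in>{1..n}. smooth_on A W (\<sigma> i j) \<and>
         (\<forall>p\<in>W. lie_bracket A (e i) (e j) p =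
            (\<lambda>u. (\<Sum>k=1..n. f k i j p * e k p u) - 2 * \<sigma> i j p * e (n + 1) p u))))"

definition fiber_mean_curvature ::
  "('a::{t2_space,second_countable_topology}, 'e::euclidean_space) atlas \<Rightarrow> 'a metric \<Rightarrow>
   ('b::{t2_space,second_countable_topology}, 'f::euclidean_space) atlas \<Rightarrow>
   ('a \<Rightarrow> 'b) \<Rightarrow> (nat \<Rightarrow> 'a \<Rightarrow> 'a tvec) \<Rightarrow> 'a \<Rightarrow> 'a tvec" where
  "fiber_mean_curvature A g B \<phi> e p =
     (let E = e (DIM('f) + 1) in horizontal_part A g B \<phi> p (nabla A g p (E p) E))"

end

theory Submission
  imports Defs
begin

text \<open>Everything is computed in the two orthonormal frames. In a frame, the Koszul formula expresses
  the coefficients \<open>\<Gamma>\<close> of the Levi-Civita connection by the structure functions of the frame, which gives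
  both existence and uniqueness of that connection. Because the frames are \<open>\<phi>\<close>-related, the pull-back
  connection has the coefficients \<open>P k i j = \<Gamma> k i j \<circ> \<phi>\<close> in the horizontal directions and none in the
  vertical one. The horizontal coefficients of the two connections agree, and
  \<open>\<nabla>\<^bsub>e(n+1)\<^esub> e(n+1) = \<Sum>k. \<kappa> k * e k\<close>; so \<open>\<tau>(\<phi>) = - (\<Sum>k. \<kappa> k * (\<epsilon> k \<circ> \<phi>))\<close>. The rough Laplacian of this
  section has as its \<open>k\<close>-th coefficient minus the terms with \<open>\<Delta>\<close> and \<open>P\<close>, and the antisymmetry of
  \<open>R\<^sup>N\<close> in its last two arguments turns the curvature term into minus the Ricci term. Thus the
  coefficients of the bitension field are minus the left-hand sides of the equations.\<close>

section \<open>Calculus of smooth maps\<close>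

text \<open>Most operators of the statement are definite descriptions, over connections or over
  local extensions of tangent vectors, so a value may be used only once existence and independence
  of the choice are known. They are all treated alike: the expression is evaluated on arbitrary
  choices in frame coefficients, and the result is seen to contain nothing but values at the point.
  The obstacle is smoothness. A metric is assumed to be smooth on pairs of vector fields only, so
  the components of a section along \<open>\<phi>\<close> are not smooth by assumption. They become
  so by expanding the section in the coordinate vectors of a chart of the target, and that these
  span is a matter of counting dimensions against an orthonormal basis. Since a connection on a
  tangent bundle is a connection along the identity map, one construction from coefficients yields
  both the Levi-Civita and the pull-back connection.\<close>

lemma has_derivative_cong_open:
  assumes "open S" "x \<in> S" "\<And>y. y \<in> S \<Longrightarrow> f y = g y"
  shows "(f has_derivative D) (at x) \<longleftrightarrow> (g has_derivative D) (at x)"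
  using has_derivative_transform_within_open[of f D x UNIV S g]
    has_derivative_transform_within_open[of g D x UNIV S f] assms by auto

lemma frechet_derivative_cong_open:
  assumes "open S" "x \<in> S" "\<And>y. y \<in> S \<Longrightarrow> f y = g y"
  shows "frechet_derivative f (at x) = frechet_derivative g (at x)"
  using has_derivative_cong_open[OF assms] by (simp add: frechet_derivative_def)

lemma frechet_derivativeI:
  "(f has_derivative D) (at x) \<Longrightarrow> frechet_derivative f (at x) = D"
  using frechet_derivative_at by metis

lemma C_k_on_subset: "C_k_on k S f \<Longrightarrow> T \<subseteq> S \<Longrightarrow> C_k_on k T f"
proof (induction k arbitrary: f)
  case 0
  then show ?case using continuous_on_subset by auto
next
  case (Suc k)
  then show ?case unfolding C_k_on.simps(2) by (meson subsetD)
qed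

lemma C_k_on_cong:
  assumes "open S" "\<And>x. x \<in> S \<Longrightarrow> f x = g x"
  shows "C_k_on k S f \<longleftrightarrow> C_k_on k S g"
  using assms(2)
proof (induction k arbitrary: f g)
  case 0
  then show ?case using continuous_on_cong[of S S f g] by simp
next
  case (Suc k)
  have "(f differentiable (at x)) = (g differentiable (at x))" if "x \<in> S" for x
    using has_derivative_cong_open[OF assms(1) that Suc.prems] by (simp add: differentiable_def)
  moreover have "C_k_on k S (\<lambda>x. frechet_derivative f (at x) v)
      = C_k_on k S (\<lambda>x. frechet_derivative g (at x) v)" for v
    by (rule Suc.IH) (simp add: frechet_derivative_cong_open[OF assms(1) _ Suc.prems])
  ultimately show ?case unfolding C_k_on.simps(2) by meson
qed

lemma C_k_on_Suc_imp: "C_k_on (Suc k) S f \<Longrightarrow> C_k_on k S f"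
proof (induction k arbitrary: f)
  case 0
  then show ?case
    by (simp add: continuous_at_imp_continuous_on differentiable_imp_continuous_within)
next
  case (Suc k)
  have "C_k_on k S (\<lambda>x. frechet_derivative f (at x) v)" for v
    by (rule Suc.IH) (use iffD1[OF C_k_on.simps(2) Suc.prems] in blast)
  then show ?case using iffD1[OF C_k_on.simps(2) Suc.prems] unfolding C_k_on.simps(2) by blast
qed

text \<open>Accepts any formula for the derivative, so the closure properties below can be proved
  with the derivative supplied by the usual differentiation rules.\<close>

lemma C_k_on_SucI:
  assumes "open S" "\<And>x. x \<in> S \<Longrightarrow> (f has_derivative D x) (at x)" "\<And>v. C_k_on k S (\<lambda>x. D x v)"
  shows "C_k_on (Suc k) S f"
proof -
  have "C_k_on k S (\<lambda>x. frechet_derivative f (at x) v)" for v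
    by (rule iffD1[OF C_k_on_cong[OF assms(1)] assms(3)[of v]])
      (simp add: frechet_derivativeI[OF assms(2)])
  then show ?thesis
    unfolding C_k_on.simps(2) using differentiableI[OF assms(2)] by blast
qed

lemma C_k_on_Suc_has_derivative:
  "C_k_on (Suc k) S f \<Longrightarrow> x \<in> S \<Longrightarrow> (f has_derivative frechet_derivative f (at x)) (at x)"
  using frechet_derivative_works by auto

lemma C_k_on_const: "C_k_on k S (\<lambda>x. c)"
  by (induction k arbitrary: c) auto

lemma C_k_on_bounded_linear:
  assumes "open S" "bounded_linear L" "C_k_on k S f"
  shows "C_k_on k S (\<lambda>x. L (f x))"
  using assms(3)
proof (induction k arbitrary: f)
  case 0
  then show ?case using bounded_linear.continuous_on[OF assms(2)] by auto
next
  case (Suc k)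
  have d: "((\<lambda>x. L (f x)) has_derivative (\<lambda>v. L (frechet_derivative f (at x) v))) (at x)"
    if "x \<in> S" for x
    using C_k_on_Suc_has_derivative[OF Suc.prems that] by (rule bounded_linear.has_derivative[OF assms(2)])
  have c: "C_k_on k S (\<lambda>x. L (frechet_derivative f (at x) v))" for v
    by (rule Suc.IH) (use Suc.prems in auto)
  show ?case by (rule C_k_on_SucI[OF assms(1) d c])
qed

lemma C_k_on_add:
  assumes "open S" "C_k_on k S f" "C_k_on k S g"
  shows "C_k_on k S (\<lambda>x. f x + g x)"
  using assms(2,3)
proof (induction k arbitrary: f g)
  case 0
  then show ?case by (auto intro: continuous_on_add)
next
  case (Suc k)
  have d: "((\<lambda>x. f x + g x) has_derivative
      (\<lambda>v. frechet_derivative f (at x) v + frechet_derivative g (at x) v)) (at x)"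
    if "x \<in> S" for x
    by (intro has_derivative_add C_k_on_Suc_has_derivative[OF Suc.prems(1) that]
        C_k_on_Suc_has_derivative[OF Suc.prems(2) that])
  have c: "C_k_on k S (\<lambda>x. frechet_derivative f (at x) v + frechet_derivative g (at x) v)" for v
    by (rule Suc.IH) (use Suc.prems in auto)
  show ?case by (rule C_k_on_SucI[OF assms(1) d c])
qed

lemma C_k_on_scaleR:
  fixes r :: "'e::euclidean_space \<Rightarrow> real"
  assumes "open S" "C_k_on k S r" "C_k_on k S f"
  shows "C_k_on k S (\<lambda>x. r x *\<^sub>R f x)"
  using assms(2,3)
proof (induction k arbitrary: r f)
  case 0
  then show ?case by (auto intro: continuous_on_scaleR)
next
  case (Suc k)
  have d: "((\<lambda>x. r x *\<^sub>R f x) has_derivative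
      (\<lambda>v. r x *\<^sub>R frechet_derivative f (at x) v + frechet_derivative r (at x) v *\<^sub>R f x)) (at x)"
    if "x \<in> S" for x
    by (intro has_derivative_scaleR C_k_on_Suc_has_derivative[OF Suc.prems(1) that]
        C_k_on_Suc_has_derivative[OF Suc.prems(2) that])
  \<comment> \<open>Each summand pairs a derivative with an undifferentiated factor; the latter is
    of class \<open>Suc k\<close> and is first demoted to class \<open>k\<close>.\<close>
  have c: "C_k_on k S (\<lambda>x. r x *\<^sub>R frechet_derivative f (at x) v + frechet_derivative r (at x) v *\<^sub>R f x)" for v
    using Suc.prems
    by (intro C_k_on_add[OF assms(1)] Suc.IH C_k_on_Suc_imp[of k S r] C_k_on_Suc_imp[of k S f])
      simp_all
  show ?case by (rule C_k_on_SucI[OF assms(1) d c])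
qed

lemma C_k_on_sum:
  assumes "open S" "finite I" "\<And>i. i \<in> I \<Longrightarrow> C_k_on k S (f i)"
  shows "C_k_on k S (\<lambda>x. \<Sum>i\<in>I. f i x)"
  using assms(2,3)
proof (induction I)
  case (insert i I)
  then show ?case using C_k_on_add[OF assms(1), of k "f i" "\<lambda>x. \<Sum>i\<in>I. f i x"] by simp
qed (simp add: C_k_on_const)

lemma C_k_on_compose:
  fixes f :: "'e::euclidean_space \<Rightarrow> 'f::euclidean_space" and g :: "'f \<Rightarrow> 'g::euclidean_space"
  assumes "open S" "open T" "f ` S \<subseteq> T" "C_k_on k S f" "C_k_on k T g"
  shows "C_k_on k S (\<lambda>x. g (f x))"
  using assms(4,5)
proof (induction k arbitrary: g)
  case 0
  then show ?case using continuous_on_compose2[of T g S f] assms(3) by auto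
next
  case (Suc k)
  have d: "((\<lambda>x. g (f x)) has_derivative
      (\<lambda>v. frechet_derivative g (at (f x)) (frechet_derivative f (at x) v))) (at x)"
    if "x \<in> S" for x
    by (intro has_derivative_compose[of f _ x UNIV g] C_k_on_Suc_has_derivative[OF Suc.prems(1) that]
        C_k_on_Suc_has_derivative[OF Suc.prems(2)]) (use assms(3) that in auto)
  \<comment> \<open>The chain rule applies a varying linear map to a varying vector. Expanding the
    vector in the basis gives products of scalar functions with compositions of directional
    derivatives of \<open>g\<close>, to which the induction hypothesis applies.\<close>
  have basis: "frechet_derivative g (at (f x)) w
      = (\<Sum>b\<in>Basis. (w \<bullet> b) *\<^sub>R frechet_derivative g (at (f x)) b)" if "x \<in> S" for x w
  proof -
    interpret linear "frechet_derivative g (at (f x))"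
      by (rule linear_frechet_derivative) (use Suc.prems that assms(3) in auto)
    have "frechet_derivative g (at (f x)) w
        = frechet_derivative g (at (f x)) (\<Sum>b\<in>Basis. (w \<bullet> b) *\<^sub>R b)"
      by (simp add: euclidean_representation)
    then show ?thesis by (simp add: sum scaleR)
  qed
  have c: "C_k_on k S (\<lambda>x. \<Sum>b\<in>Basis. (frechet_derivative f (at x) v \<bullet> b) *\<^sub>R
      frechet_derivative g (at (f x)) b)" for v
    using Suc.prems
    by (intro C_k_on_sum[OF assms(1)] C_k_on_scaleR[OF assms(1)] Suc.IH
        C_k_on_bounded_linear[OF assms(1) bounded_linear_inner_left] C_k_on_Suc_imp[of k S f]) auto
  show ?case
  proof (rule C_k_on_SucI[OF assms(1) _ c])
    show "((\<lambda>x. g (f x)) has_derivative (\<lambda>v. \<Sum>b\<in>Basis. (frechet_derivative f (at x) v \<bullet> b) *\<^sub>R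
        frechet_derivative g (at (f x)) b)) (at x)" if "x \<in> S" for x
      by (rule has_derivative_eq_rhs[OF d[OF that]], rule ext, rule basis[OF that])
  qed
qed

text \<open>Openness enters at order 0, where continuity has to be glued; derivatives are taken in
  the whole space and glue pointwise.\<close>

lemma C_k_on_Union:
  assumes "\<And>T. T \<in> \<T> \<Longrightarrow> open T" "\<And>T. T \<in> \<T> \<Longrightarrow> C_k_on k T f"
  shows "C_k_on k (\<Union>\<T>) f"
  using assms(2)
proof (induction k arbitrary: f)
  case 0
  then show ?case using assms(1) by (auto intro!: continuous_on_open_Union)
next
  case (Suc k)
  then show ?case by auto
qed

lemma C_inf_onD_Suc:
  assumes "C_inf_on S f"
  shows "(\<forall>x\<in>S. f differentiable (at x)) \<and> (\<forall>v. C_k_on k S (\<lambda>x. frechet_derivative f (at x) v))"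
  using assms[unfolded C_inf_on_def, rule_format, of "Suc k"] by simp

lemma C_inf_on_frechet_derivative:
  "C_inf_on S f \<Longrightarrow> C_inf_on S (\<lambda>x. frechet_derivative f (at x) v)"
  using C_inf_onD_Suc[of S f] by (auto simp: C_inf_on_def[of S "\<lambda>x. frechet_derivative f (at x) v"])

lemma C_inf_on_differentiable: "C_inf_on S f \<Longrightarrow> x \<in> S \<Longrightarrow> f differentiable (at x)"
  using C_inf_onD_Suc[of S f] by blast

section \<open>Smooth functions and tangent vectors\<close>

lemma C_inf_on_subset: "C_inf_on S f \<Longrightarrow> T \<subseteq> S \<Longrightarrow> C_inf_on T f"
  by (auto simp: C_inf_on_def intro: C_k_on_subset)

lemma C_inf_on_cong:
  "open S \<Longrightarrow> (\<And>x. x \<in> S \<Longrightarrow> f x = g x) \<Longrightarrow> C_inf_on S f \<longleftrightarrow> C_inf_on S g"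
  unfolding C_inf_on_def using C_k_on_cong by metis

lemma C_inf_on_compose:
  "open S \<Longrightarrow> open T \<Longrightarrow> f ` S \<subseteq> T \<Longrightarrow> C_inf_on S f \<Longrightarrow> C_inf_on T g \<Longrightarrow>
    C_inf_on S (\<lambda>x. g (f x))"
  unfolding C_inf_on_def using C_k_on_compose by blast

section \<open>Charts and smooth functions on a manifold\<close>

locale manifold =
  fixes A :: "('a::{t2_space,second_countable_topology}, 'e::euclidean_space) atlas"
  assumes atlas: "smooth_atlas A"
begin

lemma chart:
  assumes "(U, x) \<in> A"
  shows "open U" "open (x ` U)" "homeomorphism U (x ` U) x (inv_into U x)"
  using assms atlas unfolding smooth_atlas_def by auto

lemma chart_cover: obtains U x where "(U, x) \<in> A" "p \<in> U"
  using atlas unfolding smooth_atlas_def by (metis (no_types, lifting) UNIV_I UN_E case_prod_conv surj_pair)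

lemma chart_inv: "(U, x) \<in> A \<Longrightarrow> q \<in> U \<Longrightarrow> inv_into U x (x q) = q"
  using chart(3) by (auto simp: homeomorphism_def)

lemma chart_open_image:
  assumes "(U, x) \<in> A" "open W"
  shows "open (x ` (U \<inter> W))"
proof -
  have "openin (top_of_set (x ` U)) (x ` (U \<inter> W))"
    using chart[OF assms(1)] assms(2)
    by (intro homeomorphism_imp_open_map[of U "x ` U" x "inv_into U x"]) auto
  then show ?thesis using chart(2)[OF assms(1)] openin_open_eq by blast
qed

lemma chart_transition:
  assumes "(U, x) \<in> A" "(V, y) \<in> A"
  shows "C_inf_on (x ` (U \<inter> V)) (y \<circ> inv_into U x)"
  using atlas assms unfolding smooth_atlas_def by auto

lemma smooth_onI:
  "(\<And>U x. (U, x) \<in> A \<Longrightarrow> C_inf_on (x ` (U \<inter> W)) (f \<circ> inv_into U x)) \<Longrightarrow> smooth_on A W f"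
  by (auto simp: smooth_on_def)

lemma smooth_onD:
  "smooth_on A W f \<Longrightarrow> (U, x) \<in> A \<Longrightarrow> C_inf_on (x ` (U \<inter> W)) (f \<circ> inv_into U x)"
  by (auto simp: smooth_on_def)

lemma smooth_on_subset: "smooth_on A W f \<Longrightarrow> W' \<subseteq> W \<Longrightarrow> smooth_on A W' f"
  unfolding smooth_on_def by (force intro: C_inf_on_subset)

lemma smooth_on_cong:
  assumes "open W" "\<And>q. q \<in> W \<Longrightarrow> f q = g q"
  shows "smooth_on A W f \<longleftrightarrow> smooth_on A W g"
proof -
  have "C_inf_on (x ` (U \<inter> W)) (f \<circ> inv_into U x) = C_inf_on (x ` (U \<inter> W)) (g \<circ> inv_into U x)"
    if "(U, x) \<in> A" for U x
    by (rule C_inf_on_cong[OF chart_open_image[OF that assms(1)]])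
      (auto simp: chart_inv[OF that] assms(2))
  then show ?thesis by (auto simp: smooth_on_def)
qed

lemma smooth_on_transform:
  assumes "smooth_on A W g" "open W" "\<And>q. q \<in> W \<Longrightarrow> f q = g q"
  shows "smooth_on A W f"
  using smooth_on_cong[OF assms(2), of f g] assms(1,3) by simp

lemma smooth_on_Union:
  assumes "\<And>T. T \<in> \<T> \<Longrightarrow> open T" "\<And>T. T \<in> \<T> \<Longrightarrow> smooth_on A T f"
  shows "smooth_on A (\<Union>\<T>) f"
proof (rule smooth_onI)
  fix U x assume U: "(U, x) \<in> A"
  have eq: "x ` (U \<inter> \<Union>\<T>) = \<Union>((\<lambda>T. x ` (U \<inter> T)) ` \<T>)" by auto
  show "C_inf_on (x ` (U \<inter> \<Union>\<T>)) (f \<circ> inv_into U x)"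
    unfolding eq C_inf_on_def using chart_open_image[OF U assms(1)] smooth_onD[OF assms(2) U]
    by (auto intro!: C_k_on_Union simp: C_inf_on_def)
qed

text \<open>Allows smoothness to be proved on a neighbourhood of each point, hence inside one chart
  at a time.\<close>

lemma smooth_on_local:
  assumes "\<And>p. p \<in> W \<Longrightarrow> \<exists>T. open T \<and> p \<in> T \<and> T \<subseteq> W \<and> smooth_on A T f"
  shows "smooth_on A W f"
proof -
  define \<T> where "\<T> = {T. open T \<and> T \<subseteq> W \<and> smooth_on A T f}"
  have "W \<subseteq> \<Union>\<T>"
  proof
    fix p assume "p \<in> W"
    then show "p \<in> \<Union>\<T>" using assms[of p] unfolding \<T>_def by auto
  qed
  moreover have "smooth_on A (\<Union>\<T>) f"
    by (rule smooth_on_Union) (simp_all add: \<T>_def)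
  ultimately show ?thesis by (metis smooth_on_subset)
qed

lemma smooth_on_const [simp]: "smooth_on A W (\<lambda>q. c)"
  unfolding smooth_on_def C_inf_on_def comp_def by (auto intro: C_k_on_const)

lemma smooth_on_add:
  assumes "open W" "smooth_on A W f" "smooth_on A W g"
  shows "smooth_on A W (\<lambda>q. f q + g q)"
  using assms(2,3) chart_open_image[OF _ assms(1)]
  unfolding smooth_on_def C_inf_on_def comp_def by (auto intro!: C_k_on_add)

lemma smooth_on_mult:
  assumes "open W" "smooth_on A W f" "smooth_on A W g"
  shows "smooth_on A W (\<lambda>q. f q * g q)"
proof (rule smooth_onI)
  fix U x assume U: "(U, x) \<in> A"
  show "C_inf_on (x ` (U \<inter> W)) ((\<lambda>q. f q * g q) \<circ> inv_into U x)"
    using C_k_on_scaleR[OF chart_open_image[OF U assms(1)], of _ "f \<circ> inv_into U x" "g \<circ> inv_into U x"]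
      smooth_onD[OF assms(2) U] smooth_onD[OF assms(3) U]
    by (auto simp: C_inf_on_def comp_def)
qed

lemma smooth_on_sum:
  assumes "open W" "\<And>i. i \<in> I \<Longrightarrow> smooth_on A W (f i)"
  shows "smooth_on A W (\<lambda>q. \<Sum>i\<in>I. f i q)"
  using assms(2)
  by (induction I rule: infinite_finite_induct) (auto intro: smooth_on_add[OF assms(1)])

lemma smooth_on_minus:
  assumes "open W" "smooth_on A W f"
  shows "smooth_on A W (\<lambda>q. - f q)"
  using smooth_on_mult[OF assms(1) smooth_on_const[of W "-1"] assms(2)] by simp

lemma smooth_on_diff:
  assumes "open W" "smooth_on A W f" "smooth_on A W g"
  shows "smooth_on A W (\<lambda>q. f q - g q)"
  using smooth_on_add[OF assms(1,2) smooth_on_minus[OF assms(1,3)]] by simp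

lemma smooth_nearI: "open W \<Longrightarrow> p \<in> W \<Longrightarrow> smooth_on A W f \<Longrightarrow> smooth_near A p f"
  by (auto simp: smooth_near_def)

lemma smooth_near_common:
  assumes "smooth_near A p f" "smooth_near A p g" "open W" "p \<in> W"
  obtains T where "open T" "p \<in> T" "T \<subseteq> W" "smooth_on A T f" "smooth_on A T g"
proof -
  obtain T1 T2 where "open T1" "p \<in> T1" "smooth_on A T1 f" "open T2" "p \<in> T2" "smooth_on A T2 g"
    using assms by (auto simp: smooth_near_def)
  then show ?thesis using assms(3,4)
    by (intro that[of "T1 \<inter> T2 \<inter> W"]) (auto intro: smooth_on_subset)
qed

lemma smooth_near_cong:
  assumes "\<forall>\<^sub>F q in nhds p. f q = g q"
  shows "smooth_near A p f \<longleftrightarrow> smooth_near A p g"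
proof -
  obtain T where T: "open T" "p \<in> T" "\<And>q. q \<in> T \<Longrightarrow> f q = g q"
    using assms by (auto simp: eventually_nhds)
  have "smooth_near A p k'" if k: "smooth_near A p k" "\<And>q. q \<in> T \<Longrightarrow> k' q = k q" for k k'
  proof -
    obtain T' where T': "open T'" "p \<in> T'" "T' \<subseteq> T" "smooth_on A T' k"
      using smooth_near_common[OF k(1) k(1) T(1,2)] by metis
    then have "smooth_on A T' k'" by (intro smooth_on_transform[OF T'(4,1)] k(2)) auto
    then show ?thesis using T' by (auto intro: smooth_nearI)
  qed
  from this[of f g] this[of g f] show ?thesis using T(3) by auto
qed

lemma smooth_near_const [simp]: "smooth_near A p (\<lambda>q. c)"
  by (rule smooth_nearI[of UNIV]) auto

lemma smooth_near_add: "smooth_near A p f \<Longrightarrow> smooth_near A p g \<Longrightarrow> smooth_near A p (\<lambda>q. f q + g q)"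
  using smooth_near_common[of p f g UNIV] smooth_on_add smooth_nearI
  by (metis UNIV_I open_UNIV)

lemma smooth_near_mult: "smooth_near A p f \<Longrightarrow> smooth_near A p g \<Longrightarrow> smooth_near A p (\<lambda>q. f q * g q)"
  using smooth_near_common[of p f g UNIV] smooth_on_mult smooth_nearI
  by (metis UNIV_I open_UNIV)

lemma smooth_near_sum:
  "(\<And>i. i \<in> I \<Longrightarrow> smooth_near A p (f i)) \<Longrightarrow> smooth_near A p (\<lambda>q. \<Sum>i\<in>I. f i q)"
  by (induction I rule: infinite_finite_induct) (auto intro: smooth_near_add)

section \<open>Tangent vectors as derivations of germs\<close>

lemma tangentD:
  assumes "v \<in> tangent_space A p"
  shows tangent_add: "\<lbrakk>smooth_near A p f; smooth_near A p g\<rbrakk> \<Longrightarrow> v (\<lambda>q. f q + g q) = v f + v g"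
    and tangent_scale: "smooth_near A p f \<Longrightarrow> v (\<lambda>q. c * f q) = c * v f"
    and tangent_mult: "\<lbrakk>smooth_near A p f; smooth_near A p g\<rbrakk> \<Longrightarrow>
      v (\<lambda>q. f q * g q) = v f * g p + f p * v g"
    and tangent_eventually: "(\<forall>\<^sub>F q in nhds p. f q = g q) \<Longrightarrow> v f = v g"
    and tangent_not_smooth: "\<not> smooth_near A p f \<Longrightarrow> v f = 0"
  using assms by (auto simp: tangent_space_def)

lemma tangent_cong:
  assumes "v \<in> tangent_space A p" "open W" "p \<in> W" "\<And>q. q \<in> W \<Longrightarrow> f q = g q"
  shows "v f = v g"
  by (rule tangent_eventually[OF assms(1)]) (auto simp: eventually_nhds intro: exI[of _ W] assms)

lemma tangent_const:
  assumes "v \<in> tangent_space A p"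
  shows "v (\<lambda>q. c) = 0"
proof -
  \<comment> \<open>The Leibniz rule for 1 * 1 doubles the value at 1.\<close>
  have "v (\<lambda>q. 1) = 0" using tangent_mult[OF assms, of "\<lambda>q. 1" "\<lambda>q. 1"] by simp
  then show ?thesis using tangent_scale[OF assms, of "\<lambda>q. 1" c] by simp
qed

lemma tangent_sum:
  assumes "v \<in> tangent_space A p" "\<And>i. i \<in> I \<Longrightarrow> smooth_near A p (f i)"
  shows "v (\<lambda>q. \<Sum>i\<in>I. f i q) = (\<Sum>i\<in>I. v (f i))"
  using assms(2)
  by (induction I rule: infinite_finite_induct)
    (auto simp: tangent_const[OF assms(1)] tangent_add[OF assms(1)] smooth_near_sum)

lemma tangent_minus:
  assumes "v \<in> tangent_space A p" "smooth_near A p f"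
  shows "v (\<lambda>q. - f q) = - v f"
  using tangent_scale[OF assms, of "-1"] by simp

lemma tangent_sum_mult:
  assumes "v \<in> tangent_space A p" "\<And>i. i \<in> I \<Longrightarrow> smooth_near A p (a i)"
    "\<And>i. i \<in> I \<Longrightarrow> smooth_near A p (b i)"
  shows "v (\<lambda>q. \<Sum>i\<in>I. a i q * b i q) = (\<Sum>i\<in>I. v (a i) * b i p + a i p * v (b i))"
  using assms(2,3) by (simp add: tangent_sum[OF assms(1)] smooth_near_mult tangent_mult[OF assms(1)])

lemma tangent_zero [simp]: "(\<lambda>f. 0) \<in> tangent_space A p"
  by (auto simp: tangent_space_def)

lemma tangent_lincomb:
  assumes "u \<in> tangent_space A p" "v \<in> tangent_space A p"
  shows "(\<lambda>f. a * u f + b * v f) \<in> tangent_space A p"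
  unfolding tangent_space_def mem_Collect_eq
proof (intro conjI allI impI, goal_cases)
  \<comment> \<open>Goal 4 is the dependence on the germ only.\<close>
  case 4 then show ?case by (metis tangent_eventually assms)
qed (auto simp: tangent_add[OF assms(1)] tangent_add[OF assms(2)] tangent_scale[OF assms(1)]
    tangent_scale[OF assms(2)] tangent_mult[OF assms(1)] tangent_mult[OF assms(2)]
    tangent_not_smooth[OF assms(1)] tangent_not_smooth[OF assms(2)] algebra_simps)

lemma tangent_lincomb_sum:
  assumes "\<And>i. i \<in> I \<Longrightarrow> u i \<in> tangent_space A p"
  shows "(\<lambda>f. \<Sum>i\<in>I. c i * u i f) \<in> tangent_space A p"
  using assms
proof (induction I rule: infinite_finite_induct)
  case (insert i I)
  then show ?case using tangent_lincomb[of "u i" p "\<lambda>f. \<Sum>i\<in>I. c i * u i f" "c i" 1] by simp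
qed auto

section \<open>Vector fields and their brackets\<close>

lemma vector_fieldD:
  assumes "X \<in> vector_fields A W"
  shows vector_field_tangent: "p \<in> W \<Longrightarrow> X p \<in> tangent_space A p"
    and vector_field_smooth: "\<lbrakk>open U; smooth_on A U F\<rbrakk> \<Longrightarrow> smooth_on A (W \<inter> U) (\<lambda>p. X p F)"
  using assms by (auto simp: vector_fields_def sections_along_def)

lemma vector_field_smooth_on:
  "X \<in> vector_fields A W \<Longrightarrow> W' \<subseteq> W \<Longrightarrow> open U \<Longrightarrow> smooth_on A U F \<Longrightarrow> W' \<subseteq> U \<Longrightarrow>
    smooth_on A W' (\<lambda>p. X p F)"
  using vector_field_smooth[of X W U F] by (auto intro: smooth_on_subset)

lemma vector_fieldI:
  assumes "\<And>p. p \<in> W \<Longrightarrow> X p \<in> tangent_space A p"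
    "\<And>U F. open U \<Longrightarrow> smooth_on A U F \<Longrightarrow> smooth_on A (W \<inter> U) (\<lambda>p. X p F)"
  shows "X \<in> vector_fields A W"
  using assms by (auto simp: vector_fields_def sections_along_def)

lemma vector_field_subset: "X \<in> vector_fields A W \<Longrightarrow> W' \<subseteq> W \<Longrightarrow> X \<in> vector_fields A W'"
  by (rule vector_fieldI) (auto intro: vector_field_tangent vector_field_smooth_on)

lemma lie_bracket_vector_field:
  assumes "open W" "X \<in> vector_fields A W" "Y \<in> vector_fields A W"
  shows "lie_bracket A X Y \<in> vector_fields A W"
proof (rule vector_fieldI)
  fix U F assume U: "open U" "smooth_on A U F"
  have o: "open (W \<inter> U)" using assms(1) U(1) by auto
  have "smooth_on A (W \<inter> (W \<inter> U)) (\<lambda>p. X p (\<lambda>q. Y q F) - Y p (\<lambda>q. X q F))"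
    using assms(1) o by (intro smooth_on_diff vector_field_smooth[OF assms(2) o vector_field_smooth[OF assms(3) U]]
        vector_field_smooth[OF assms(3) o vector_field_smooth[OF assms(2) U]]) auto
  then have "smooth_on A (W \<inter> U) (\<lambda>p. X p (\<lambda>q. Y q F) - Y p (\<lambda>q. X q F))" by simp
  moreover have "lie_bracket A X Y p F = X p (\<lambda>q. Y q F) - Y p (\<lambda>q. X q F)" if "p \<in> W \<inter> U" for p
    using that U by (auto simp: lie_bracket_def intro: smooth_nearI)
  ultimately show "smooth_on A (W \<inter> U) (\<lambda>p. lie_bracket A X Y p F)"
    using smooth_on_cong[OF o, of "\<lambda>p. lie_bracket A X Y p F" "\<lambda>p. X p (\<lambda>q. Y q F) - Y p (\<lambda>q. X q F)"]
    by blast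
next
  fix p assume p: "p \<in> W"
  have Xp: "X p \<in> tangent_space A p" and Yp: "Y p \<in> tangent_space A p"
    using assms p by (auto intro: vector_field_tangent)
  have sm: "smooth_near A p (\<lambda>q. Z q f)" if Z: "Z \<in> vector_fields A W" and f: "smooth_near A p f" for Z f
  proof -
    obtain T where "open T" "p \<in> T" "smooth_on A T f" using f by (auto simp: smooth_near_def)
    then show ?thesis using vector_field_smooth[OF Z] assms(1) p by (auto intro!: smooth_nearI[of "W \<inter> T"])
  qed
  \<comment> \<open>In the product rule for an iterated derivative the mixed terms are symmetric in
    the two fields, so they cancel in the bracket; this makes the commutator a derivation
    again.\<close>
  have add: "V (\<lambda>q. Z q (\<lambda>r. f r + f' r)) = V (\<lambda>q. Z q f) + V (\<lambda>q. Z q f')"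
    "V (\<lambda>q. Z q (\<lambda>r. c * f r)) = c * V (\<lambda>q. Z q f)"
    "V (\<lambda>q. Z q (\<lambda>r. f r * f' r)) = V (\<lambda>q. Z q f) * f' p + Z p f * V f' + V f * Z p f' + f p * V (\<lambda>q. Z q f')"
    if V: "V \<in> tangent_space A p" and Z: "Z \<in> vector_fields A W"
      and f: "smooth_near A p f" "smooth_near A p f'" for V Z f f' c
  proof -
    obtain T where T: "open T" "p \<in> T" "T \<subseteq> W" "smooth_on A T f" "smooth_on A T f'"
      using smooth_near_common[OF f assms(1) p] by metis
    have Zt: "Z q \<in> tangent_space A q" "smooth_near A q f" "smooth_near A q f'" if "q \<in> T" for q
      using that T Z by (auto intro: vector_field_tangent smooth_nearI)
    have "V (\<lambda>q. Z q (\<lambda>r. f r + f' r)) = V (\<lambda>q. Z q f + Z q f')"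
      by (rule tangent_cong[OF V T(1,2)]) (simp add: Zt tangent_add[OF Zt(1)])
    then show "V (\<lambda>q. Z q (\<lambda>r. f r + f' r)) = V (\<lambda>q. Z q f) + V (\<lambda>q. Z q f')"
      using tangent_add[OF V sm[OF Z f(1)] sm[OF Z f(2)]] by simp
    have "V (\<lambda>q. Z q (\<lambda>r. c * f r)) = V (\<lambda>q. c * Z q f)"
      by (rule tangent_cong[OF V T(1,2)]) (simp add: Zt tangent_scale[OF Zt(1)])
    then show "V (\<lambda>q. Z q (\<lambda>r. c * f r)) = c * V (\<lambda>q. Z q f)"
      using tangent_scale[OF V sm[OF Z f(1)]] by simp
    have "V (\<lambda>q. Z q (\<lambda>r. f r * f' r)) = V (\<lambda>q. Z q f * f' q + f q * Z q f')"
      by (rule tangent_cong[OF V T(1,2)]) (simp add: Zt tangent_mult[OF Zt(1)])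
    also have "\<dots> = V (\<lambda>q. Z q f) * f' p + Z p f * V f' + V f * Z p f' + f p * V (\<lambda>q. Z q f')"
      by (simp add: tangent_add[OF V] tangent_mult[OF V] smooth_near_mult sm[OF Z] f)
    finally show "V (\<lambda>q. Z q (\<lambda>r. f r * f' r)) = V (\<lambda>q. Z q f) * f' p + Z p f * V f' + V f * Z p f' + f p * V (\<lambda>q. Z q f')" .
  qed
  have const: "V (\<lambda>q. Z q (\<lambda>r. c)) = 0"
    if V: "V \<in> tangent_space A p" and Z: "Z \<in> vector_fields A W" for V Z c
    using tangent_cong[OF V assms(1) p, of "\<lambda>q. Z q (\<lambda>r. c)" "\<lambda>q. 0"] tangent_const[OF V]
      tangent_const[OF vector_field_tangent[OF Z]] by simp
  have ev: "smooth_near A p f = smooth_near A p f' \<and> V (\<lambda>q. Z q f) = V (\<lambda>q. Z q f')"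
    if V: "V \<in> tangent_space A p" and Z: "Z \<in> vector_fields A W" and f: "\<forall>\<^sub>F q in nhds p. f q = f' q"
    for V Z f f'
  proof -
    obtain T where T: "open T" "p \<in> T" "\<And>q. q \<in> T \<Longrightarrow> f q = f' q"
      using f by (auto simp: eventually_nhds)
    have "V (\<lambda>q. Z q f) = V (\<lambda>q. Z q f')"
    proof (rule tangent_cong[OF V, of "T \<inter> W"])
      fix q assume q: "q \<in> T \<inter> W"
      show "Z q f = Z q f'"
        by (rule tangent_cong[of _ q T]) (use q T Z in \<open>auto intro: vector_field_tangent\<close>)
    qed (use T assms(1) p in auto)
    then show ?thesis using smooth_near_cong[OF f] by simp
  qed
  show "lie_bracket A X Y p \<in> tangent_space A p"
    unfolding tangent_space_def mem_Collect_eq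
  proof (intro conjI allI impI, goal_cases)
    case 4 then show ?case
      using ev[OF Xp assms(3)] ev[OF Yp assms(2)] by (auto simp: lie_bracket_def)
  qed (auto simp: lie_bracket_def smooth_near_add smooth_near_mult add[OF Xp assms(3)]
      add[OF Yp assms(2)] const[OF Xp assms(3)] const[OF Yp assms(2)]
      tangent_const[OF Xp] tangent_const[OF Yp] algebra_simps)
qed

end

section \<open>Riemannian metrics and orthonormal frames\<close>

text \<open>Relative to a set of functionals, because a metric is constrained on tangent vectors
  only.\<close>

definition bilinear_on :: "('v \<Rightarrow> real) set \<Rightarrow> (('v \<Rightarrow> real) \<Rightarrow> ('v \<Rightarrow> real) \<Rightarrow> real) \<Rightarrow> bool" where
  "bilinear_on S T \<longleftrightarrow> (\<forall>u\<in>S. \<forall>v\<in>S. \<forall>w\<in>S. \<forall>a b.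
     T (\<lambda>f. a * u f + b * v f) w = a * T u w + b * T v w \<and>
     T w (\<lambda>f. a * u f + b * v f) = a * T w u + b * T w v)"

locale riemannian = manifold A
  for A :: "('a::{t2_space,second_countable_topology}, 'e::euclidean_space) atlas" +
  fixes g :: "'a metric"
  assumes metric: "riemannian_metric A g"
begin

lemma metric_sym: "u \<in> tangent_space A p \<Longrightarrow> v \<in> tangent_space A p \<Longrightarrow> g p u v = g p v u"
  using metric unfolding riemannian_metric_def by blast

lemma metric_pos: "u \<in> tangent_space A p \<Longrightarrow> u \<noteq> (\<lambda>f. 0) \<Longrightarrow> g p u u > 0"
  using metric unfolding riemannian_metric_def by blast

lemma metric_bilinear: "bilinear_on (tangent_space A p) (g p)"
  unfolding bilinear_on_def
proof (intro ballI allI)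
  fix u v w a b
  assume t: "u \<in> tangent_space A p" "v \<in> tangent_space A p" "w \<in> tangent_space A p"
  have l: "g p (\<lambda>f. a * u f + b * v f) w = a * g p u w + b * g p v w"
    using metric t unfolding riemannian_metric_def by blast
  then show "g p (\<lambda>f. a * u f + b * v f) w = a * g p u w + b * g p v w \<and>
     g p w (\<lambda>f. a * u f + b * v f) = a * g p w u + b * g p w v"
    using metric_sym[OF tangent_lincomb[OF t(1,2)] t(3)] metric_sym[OF t(1,3)] metric_sym[OF t(2,3)]
    by simp
qed

lemma metric_smooth:
  "open W \<Longrightarrow> X \<in> vector_fields A W \<Longrightarrow> Y \<in> vector_fields A W \<Longrightarrow>
    smooth_on A W (\<lambda>p. g p (X p) (Y p))"
  using metric unfolding riemannian_metric_def by blast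

lemma bilinear_sum:
  assumes T: "bilinear_on (tangent_space A p) T"
    and u: "\<And>i. i \<in> I \<Longrightarrow> u i \<in> tangent_space A p" and w: "w \<in> tangent_space A p"
  shows "T (\<lambda>f. \<Sum>i\<in>I. c i * u i f) w = (\<Sum>i\<in>I. c i * T (u i) w)"
    and "T w (\<lambda>f. \<Sum>i\<in>I. c i * u i f) = (\<Sum>i\<in>I. c i * T w (u i))"
proof -
  note D = T[unfolded bilinear_on_def, rule_format]
  have z: "T (\<lambda>f. 0) w = 0" "T w (\<lambda>f. 0) = 0"
    using D[OF w w w, of 0 0] by simp_all
  have "T (\<lambda>f. \<Sum>i\<in>I. c i * u i f) w = (\<Sum>i\<in>I. c i * T (u i) w) \<and>
    T w (\<lambda>f. \<Sum>i\<in>I. c i * u i f) = (\<Sum>i\<in>I. c i * T w (u i))"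
    using u
  proof (induction I rule: infinite_finite_induct)
    case (insert i I)
    then show ?case
      using D[OF insert.prems[of i] tangent_lincomb_sum[of I u p c] w, of "c i" 1] by simp
  qed (simp_all add: z)
  then show "T (\<lambda>f. \<Sum>i\<in>I. c i * u i f) w = (\<Sum>i\<in>I. c i * T (u i) w)"
    "T w (\<lambda>f. \<Sum>i\<in>I. c i * u i f) = (\<Sum>i\<in>I. c i * T w (u i))" by auto
qed

context
  fixes p b assumes b: "orthonormal_basis A g p b"
begin

lemma onb_tangent: "i \<in> {1..DIM('e)} \<Longrightarrow> b i \<in> tangent_space A p"
  using b unfolding orthonormal_basis_def by blast

lemma onb_ortho:
  "i \<in> {1..DIM('e)} \<Longrightarrow> j \<in> {1..DIM('e)} \<Longrightarrow> g p (b i) (b j) = (if i = j then 1 else 0)"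
  using b unfolding orthonormal_basis_def by blast

lemma onb_coefficient:
  assumes "j \<in> {1..DIM('e)}"
  shows "g p (\<lambda>f. \<Sum>i=1..DIM('e). c i * b i f) (b j) = c j"
proof -
  have "g p (\<lambda>f. \<Sum>i=1..DIM('e). c i * b i f) (b j) = (\<Sum>i=1..DIM('e). c i * g p (b i) (b j))"
    using onb_tangent assms by (intro bilinear_sum[OF metric_bilinear]) auto
  also have "\<dots> = (\<Sum>i=1..DIM('e). if j = i then c i else 0)"
    using onb_ortho assms by (intro sum.cong) auto
  finally show ?thesis using assms by (simp add: sum.delta')
qed

lemma onb_expand:
  assumes "v \<in> tangent_space A p"
  shows "v = (\<lambda>f. \<Sum>i=1..DIM('e). g p v (b i) * b i f)"
proof -
  obtain c where c: "v = (\<lambda>f. \<Sum>i=1..DIM('e). c i * b i f)"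
    using b assms unfolding orthonormal_basis_def by blast
  have "g p v (b j) = c j" if "j \<in> {1..DIM('e)}" for j
    using onb_coefficient[OF that, of c] c by simp
  then show ?thesis using c by simp
qed

lemma onb_bilinear_expand:
  assumes "bilinear_on (tangent_space A p) T" "u \<in> tangent_space A p" "v \<in> tangent_space A p"
  shows "T u v = (\<Sum>i=1..DIM('e). \<Sum>j=1..DIM('e). g p u (b i) * g p v (b j) * T (b i) (b j))"
proof -
  have "T u v = T (\<lambda>f. \<Sum>i=1..DIM('e). g p u (b i) * b i f) v"
    using onb_expand[OF assms(2)] by simp
  also have "\<dots> = (\<Sum>i=1..DIM('e). g p u (b i) * T (b i) v)"
    by (rule bilinear_sum[OF assms(1)]) (use onb_tangent assms in auto)
  also have "\<dots> = (\<Sum>i=1..DIM('e). g p u (b i) * (\<Sum>j=1..DIM('e). g p v (b j) * T (b i) (b j)))"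
  proof (intro sum.cong refl)
    fix i assume i: "i \<in> {1..DIM('e)}"
    have "T (b i) v = T (b i) (\<lambda>f. \<Sum>j=1..DIM('e). g p v (b j) * b j f)"
      using onb_expand[OF assms(3)] by simp
    also have "\<dots> = (\<Sum>j=1..DIM('e). g p v (b j) * T (b i) (b j))"
      by (rule bilinear_sum[OF assms(1)]) (use onb_tangent i in auto)
    finally show "g p u (b i) * T (b i) v = g p u (b i) * (\<Sum>j=1..DIM('e). g p v (b j) * T (b i) (b j))"
      by simp
  qed
  finally show ?thesis by (simp add: sum_distrib_left mult.assoc)
qed

lemma onb_parseval:
  assumes "u \<in> tangent_space A p" "v \<in> tangent_space A p"
  shows "g p u v = (\<Sum>i=1..DIM('e). g p u (b i) * g p v (b i))"
proof -
  have "g p u v = (\<Sum>i=1..DIM('e). \<Sum>j=1..DIM('e). g p u (b i) * g p v (b j) * g p (b i) (b j))"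
    by (rule onb_bilinear_expand[OF metric_bilinear assms])
  also have "\<dots> = (\<Sum>i=1..DIM('e). \<Sum>j=1..DIM('e). if i = j then g p u (b i) * g p v (b j) else 0)"
    by (intro sum.cong) (auto simp: onb_ortho)
  finally show ?thesis by (simp add: sum.delta)
qed

end

text \<open>Expanding the members of another orthonormal basis \<open>c\<close> in \<open>b\<close>
  leaves the sums of \<open>g p (c i) (b j) * g p (c i) (b k)\<close> over \<open>i\<close>, which
  the Parseval identity for \<open>c\<close> collapses to \<open>g p (b j) (b k)\<close>. So the
  description defining the trace has a unique solution.\<close>

lemma metric_trace_eq:
  assumes b: "orthonormal_basis A g p b" and T: "bilinear_on (tangent_space A p) T"
  shows "metric_trace A g p T = (\<Sum>i=1..DIM('e). T (b i) (b i))"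
proof -
  have "(\<Sum>i=1..DIM('e). T (c i) (c i)) = (\<Sum>i=1..DIM('e). T (b i) (b i))"
    if c: "orthonormal_basis A g p c" for c
  proof -
    let ?m = "DIM('e)"
    have "(\<Sum>i=1..?m. T (c i) (c i))
      = (\<Sum>i=1..?m. \<Sum>j=1..?m. \<Sum>k=1..?m. g p (c i) (b j) * g p (c i) (b k) * T (b j) (b k))"
      by (intro sum.cong refl onb_bilinear_expand[OF b T] onb_tangent[OF c])
    also have "\<dots> = (\<Sum>j=1..?m. \<Sum>k=1..?m. \<Sum>i=1..?m. g p (c i) (b j) * g p (c i) (b k) * T (b j) (b k))"
      by (rule trans[OF sum.swap sum.cong[OF refl sum.swap]])
    also have "\<dots> = (\<Sum>j=1..?m. \<Sum>k=1..?m. (if j = k then T (b j) (b k) else 0))"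
    proof (intro sum.cong refl)
      fix j k assume jk: "j \<in> {1..?m}" "k \<in> {1..?m}"
      have "(\<Sum>i=1..?m. g p (c i) (b j) * g p (c i) (b k)) = g p (b j) (b k)"
        unfolding onb_parseval[OF c onb_tangent[OF b jk(1)] onb_tangent[OF b jk(2)]]
        by (intro sum.cong refl arg_cong2[of _ _ _ _ "(*)"] metric_sym onb_tangent[OF b] onb_tangent[OF c] jk)
      then show "(\<Sum>i=1..?m. g p (c i) (b j) * g p (c i) (b k) * T (b j) (b k))
          = (if j = k then T (b j) (b k) else 0)"
        using onb_ortho[OF b jk] by (simp add: sum_distrib_right[symmetric])
    qed
    finally show ?thesis by (simp add: sum.delta)
  qed
  then have indep: "x = (\<Sum>i=1..DIM('e). T (b i) (b i))"
    if "orthonormal_basis A g p c" "x = (\<Sum>i=1..DIM('e). T (c i) (c i))" for x c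
    using that by simp
  show ?thesis
    unfolding metric_trace_def by (rule the_equality) (use b indep in blast)+
qed

end

locale framed = riemannian A g
  for A :: "('a::{t2_space,second_countable_topology}, 'e::euclidean_space) atlas" and g :: "'a metric" +
  fixes W :: "'a set" and e :: "nat \<Rightarrow> 'a \<Rightarrow> 'a tvec"
  assumes frame: "orthonormal_frame A g W e"
begin

lemma open_domain [simp]: "open W"
  using frame by (simp add: orthonormal_frame_def)

lemma frame_vector_field: "i \<in> {1..DIM('e)} \<Longrightarrow> W' \<subseteq> W \<Longrightarrow> e i \<in> vector_fields A W'"
  using frame vector_field_subset[of "e i" W W'] unfolding orthonormal_frame_def by blast

lemma frame_basis: "p \<in> W \<Longrightarrow> orthonormal_basis A g p (\<lambda>i. e i p)"
  using frame unfolding orthonormal_frame_def by blast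

lemmas frame_tangent = onb_tangent[OF frame_basis]
lemmas frame_ortho = onb_ortho[OF frame_basis]
lemmas frame_coefficient = onb_coefficient[OF frame_basis]
lemmas frame_expand = onb_expand[OF frame_basis]
lemmas frame_parseval = onb_parseval[OF frame_basis]
lemmas frame_metric_trace = metric_trace_eq[OF frame_basis]

lemma frame_lincomb_tangent: "p \<in> W \<Longrightarrow> (\<lambda>f. \<Sum>i=1..DIM('e). c i * e i p f) \<in> tangent_space A p"
  by (intro tangent_lincomb_sum frame_tangent)

lemma frame_coefficients_unique:
  assumes "p \<in> W" "\<And>f. (\<Sum>i=1..DIM('e). c i * e i p f) = (\<Sum>i=1..DIM('e). d i * e i p f)"
    "j \<in> {1..DIM('e)}"
  shows "c j = d j"
  using frame_coefficient[OF assms(1,3), of c] frame_coefficient[OF assms(1,3), of d] assms(2) by simp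

lemma tangent_eqI:
  assumes "p \<in> W" "u \<in> tangent_space A p" "v \<in> tangent_space A p"
    "\<And>i. i \<in> {1..DIM('e)} \<Longrightarrow> g p u (e i p) = g p v (e i p)"
  shows "u = v"
proof -
  have "(\<lambda>f. \<Sum>i=1..DIM('e). g p u (e i p) * e i p f) = (\<lambda>f. \<Sum>i=1..DIM('e). g p v (e i p) * e i p f)"
    by (intro ext sum.cong refl) (simp only: assms(4))
  then show ?thesis
    using frame_expand[OF assms(1,2)] frame_expand[OF assms(1,3)] by metis
qed

lemma component_smooth:
  "open W' \<Longrightarrow> W' \<subseteq> W \<Longrightarrow> X \<in> vector_fields A W' \<Longrightarrow> i \<in> {1..DIM('e)} \<Longrightarrow>
    smooth_on A W' (\<lambda>p. g p (X p) (e i p))"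
  by (intro metric_smooth frame_vector_field)

end

section \<open>Coordinate vector fields of a chart\<close>

definition coordinate_vector ::
  "('a::{t2_space,second_countable_topology}, 'e::euclidean_space) atlas \<Rightarrow> 'a set \<Rightarrow> ('a \<Rightarrow> 'e) \<Rightarrow>
    'e \<Rightarrow> 'a \<Rightarrow> 'a tvec" where
  "coordinate_vector A U x c q =
     (\<lambda>F. if smooth_near A q F then frechet_derivative (F \<circ> inv_into U x) (at (x q)) c else 0)"

context manifold begin

lemma smooth_near_derivative:
  assumes U: "(U, x) \<in> A" "q \<in> U" and F: "smooth_near A q F"
  shows "(F \<circ> inv_into U x has_derivative frechet_derivative (F \<circ> inv_into U x) (at (x q))) (at (x q))"
proof -
  obtain T where T: "open T" "q \<in> T" "smooth_on A T F" using F by (auto simp: smooth_near_def)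
  show ?thesis
    unfolding frechet_derivative_works[symmetric]
    by (rule C_inf_on_differentiable[OF smooth_onD[OF T(3) U(1)]]) (use T U in auto)
qed

text \<open>The value 0 on functions not smooth near \<open>q\<close> is the normalisation that the
  tangent space demands; the rest is differentiation at the coordinate point.\<close>

lemma coordinate_vector_tangent:
  assumes U: "(U, x) \<in> A" "q \<in> U"
  shows "coordinate_vector A U x c q \<in> tangent_space A q"
proof -
  let ?D = "\<lambda>F. frechet_derivative (F \<circ> inv_into U x) (at (x q))"
  note d = smooth_near_derivative[OF U]
  have ev: "smooth_near A q F = smooth_near A q G \<and> ?D F = ?D G"
    if FG: "\<forall>\<^sub>F r in nhds q. F r = G r" for F G
  proof -
    obtain T where T: "open T" "q \<in> T" "\<And>r. r \<in> T \<Longrightarrow> F r = G r"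
      using FG by (auto simp: eventually_nhds)
    have "?D F = ?D G"
      by (rule frechet_derivative_cong_open[OF chart_open_image[OF U(1) T(1)]])
        (use U T chart_inv[OF U(1)] in auto)
    then show ?thesis using smooth_near_cong[OF FG] by simp
  qed
  have add: "?D (\<lambda>r. F r + G r) c = ?D F c + ?D G c"
    if "smooth_near A q F" "smooth_near A q G" for F G
    using frechet_derivativeI[OF has_derivative_add[OF d[OF that(1)] d[OF that(2)]]] by (simp add: comp_def)
  have mult: "?D (\<lambda>r. F r * G r) c = ?D F c * G q + F q * ?D G c"
    if "smooth_near A q F" "smooth_near A q G" for F G
    using frechet_derivativeI[OF has_derivative_mult[OF d[OF that(1)] d[OF that(2)]]] chart_inv[OF U]
    by (simp add: comp_def)
  have scale: "?D (\<lambda>r. k * F r) c = k * ?D F c" if "smooth_near A q F" for F k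
    using mult[OF smooth_near_const that, of k] by (simp add: comp_def)
  show ?thesis
    unfolding tangent_space_def coordinate_vector_def mem_Collect_eq
  proof (intro conjI allI impI, goal_cases)
    case 4 then show ?case using ev by metis
  qed (simp_all add: add mult scale smooth_near_add smooth_near_mult)
qed

lemma coordinate_vector_field:
  assumes U: "(U, x) \<in> A"
  shows "coordinate_vector A U x c \<in> vector_fields A U"
proof (rule vector_fieldI)
  fix T F assume T: "open T" "smooth_on A T F"
  note oU = chart(1)[OF U]
  show "smooth_on A (U \<inter> T) (\<lambda>q. coordinate_vector A U x c q F)"
  proof (rule smooth_onI)
    fix V y assume V: "(V, y) \<in> A"
    let ?S = "y ` (V \<inter> (U \<inter> T))"
    have oS: "open ?S" using chart_open_image[OF V] oU T by auto
    \<comment> \<open>Read in a second chart \<open>y\<close>, the function is a directional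
      derivative in the chart \<open>x\<close> composed with the transition map.\<close>
    have "C_inf_on ?S (\<lambda>w. frechet_derivative (F \<circ> inv_into U x) (at ((x \<circ> inv_into V y) w)) c)"
    proof (rule C_inf_on_compose[OF oS chart_open_image[OF U T(1)]])
      show "(x \<circ> inv_into V y) ` ?S \<subseteq> x ` (U \<inter> T)" using chart_inv[OF V] by auto
      show "C_inf_on ?S (x \<circ> inv_into V y)"
        by (rule C_inf_on_subset[OF chart_transition[OF V U]]) auto
      show "C_inf_on (x ` (U \<inter> T)) (\<lambda>w. frechet_derivative (F \<circ> inv_into U x) (at w) c)"
        by (intro C_inf_on_frechet_derivative smooth_onD[OF T(2) U])
    qed
    then show "C_inf_on ?S ((\<lambda>q. coordinate_vector A U x c q F) \<circ> inv_into V y)"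
    proof (rule iffD1[OF C_inf_on_cong[OF oS], rotated])
      fix w assume "w \<in> ?S"
      then have "inv_into V y w \<in> T" using chart_inv[OF V] by auto
      then show "frechet_derivative (F \<circ> inv_into U x) (at ((x \<circ> inv_into V y) w)) c
          = ((\<lambda>q. coordinate_vector A U x c q F) \<circ> inv_into V y) w"
        using smooth_nearI[OF T(1) _ T(2)] by (simp add: coordinate_vector_def)
    qed
  qed
qed (rule coordinate_vector_tangent[OF U])

lemma coordinate_smooth:
  assumes "(U, x) \<in> A"
  shows "smooth_on A U (\<lambda>q. x q \<bullet> b)"
proof (rule smooth_onI)
  fix V y assume V: "(V, y) \<in> A"
  have "open (y ` (V \<inter> U))" using chart_open_image[OF V] chart(1)[OF assms] by auto
  then show "C_inf_on (y ` (V \<inter> U)) ((\<lambda>q. x q \<bullet> b) \<circ> inv_into V y)"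
    using chart_transition[OF V assms] C_k_on_bounded_linear[OF _ bounded_linear_inner_left]
    unfolding C_inf_on_def comp_def by blast
qed

text \<open>The duality of coordinate functions and coordinate vectors; it yields the injectivity on
  which the spanning argument rests.\<close>

lemma coordinate_vector_coordinate:
  assumes U: "(U, x) \<in> A" "q \<in> U"
  shows "coordinate_vector A U x c q (\<lambda>r. x r \<bullet> b) = c \<bullet> b"
proof -
  have "((\<lambda>w. w \<bullet> b) has_derivative (\<lambda>w. w \<bullet> b)) (at (x q))"
    by (intro derivative_intros)
  moreover have "w = x (inv_into U x w)" if "w \<in> x ` U" for w
    using chart_inv[OF U(1)] that by auto
  ultimately have "((\<lambda>r. x r \<bullet> b) \<circ> inv_into U x has_derivative (\<lambda>w. w \<bullet> b)) (at (x q))"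
    using has_derivative_cong_open[OF chart(2)[OF U(1)], of "x q" "\<lambda>w. w \<bullet> b" "(\<lambda>r. x r \<bullet> b) \<circ> inv_into U x"] U(2)
    by auto
  then show ?thesis
    using smooth_nearI[OF chart(1)[OF U(1)] U(2) coordinate_smooth[OF U(1)]]
    by (simp add: coordinate_vector_def frechet_derivativeI)
qed

lemma coordinate_vector_linear:
  assumes U: "(U, x) \<in> A" "q \<in> U"
  shows "linear (\<lambda>c. coordinate_vector A U x c q F)"
proof (cases "smooth_near A q F")
  case True
  show ?thesis
    using has_derivative_linear[OF smooth_near_derivative[OF U True]] True
    by (simp add: coordinate_vector_def)
next
  case False
  then show ?thesis by (simp add: coordinate_vector_def linear_iff)
qed

end

context framed begin

text \<open>The coordinate vectors are independent, and an orthonormal basis has as many members as there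
  are coordinates; hence they span, without recourse to Hadamard's lemma.\<close>

lemma coordinate_expand:
  assumes U: "(U, x) \<in> A" "q \<in> U" and q: "q \<in> W" and v: "v \<in> tangent_space A q"
  shows "v = (\<lambda>F. \<Sum>b\<in>Basis. v (\<lambda>r. x r \<bullet> b) * coordinate_vector A U x b q F)"
proof -
  let ?m = "DIM('e)" and ?d = "\<lambda>c. coordinate_vector A U x c q"
  obtain \<beta> :: "nat \<Rightarrow> 'e" where \<beta>: "bij_betw \<beta> {1..?m} Basis"
    using ex_bij_betw_nat_finite_1[of "Basis :: 'e set"] by auto
  have inner_\<beta>: "(\<Sum>k=1..?m. c k *\<^sub>R \<beta> k) \<bullet> \<beta> j = c j" if "j \<in> {1..?m}" for c j
  proof -
    have "\<beta> k \<bullet> \<beta> j = (if j = k then 1 else 0)" if k: "k \<in> {1..?m}" for k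
      using inner_Basis[OF bij_betw_apply[OF \<beta> k] bij_betw_apply[OF \<beta> \<open>j \<in> {1..?m}\<close>]]
        inj_on_eq_iff[OF bij_betw_imp_inj_on[OF \<beta>] k \<open>j \<in> {1..?m}\<close>] by metis
    then have "(\<Sum>k=1..?m. c k *\<^sub>R \<beta> k) \<bullet> \<beta> j = (\<Sum>k=1..?m. if j = k then c k else 0)"
      unfolding inner_sum_left inner_scaleR_left by (intro sum.cong refl) simp
    then show ?thesis using that by (simp only: sum.delta' finite_atLeastAtMost if_True)
  qed
  have tan: "?d c \<in> tangent_space A q" for c by (rule coordinate_vector_tangent[OF U])
  have lin: "?d (a *\<^sub>R c + b *\<^sub>R c') = (\<lambda>f. a * ?d c f + b * ?d c' f)" for a b c c'
    by (rule ext) (simp add: linear_add[OF coordinate_vector_linear[OF U]]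
        linear_scale[OF coordinate_vector_linear[OF U]])
  \<comment> \<open>\<open>K\<close> records the frame coefficients of a coordinate vector as an
    element of the model space itself. Being an endomorphism of a finite-dimensional space, it is
    surjective once it is injective.\<close>
  define K where "K c = (\<Sum>k=1..?m. g q (?d c) (e k q) *\<^sub>R \<beta> k)" for c
  have comp: "g q (?d (a *\<^sub>R c + b *\<^sub>R c')) (e k q) = a * g q (?d c) (e k q) + b * g q (?d c') (e k q)"
    if "k \<in> {1..?m}" for a b c c' k
    using metric_bilinear tan frame_tangent[OF q that] unfolding bilinear_on_def lin by blast
  have "linear K"
  proof (rule linearI)
    show "K (c + c') = K c + K c'" for c c'
      unfolding K_def using comp[of _ 1 c 1 c'] by (simp add: algebra_simps sum.distrib)
    show "K (a *\<^sub>R c) = a *\<^sub>R K c" for a c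
      unfolding K_def using comp[of _ a c 0 c] by (simp add: scaleR_sum_right)
  qed
  moreover have "inj K"
  proof (subst linear_injective_0[OF \<open>linear K\<close>], intro allI impI)
    fix c assume "K c = 0"
    then have "g q (?d c) (e k q) = 0" if "k \<in> {1..?m}" for k
      using inner_\<beta>[OF that, of "\<lambda>k. g q (?d c) (e k q)"] by (simp add: K_def)
    then have "?d c = (\<lambda>f. 0)" using frame_expand[OF q tan, of c] by simp
    then have "c \<bullet> b = 0" for b using coordinate_vector_coordinate[OF U, of c b] by simp
    then show "c = 0" by (metis inner_eq_zero_iff)
  qed
  ultimately have "surj K" using linear_injective_imp_surjective by blast
  then obtain c where "K c = (\<Sum>k=1..?m. g q v (e k q) *\<^sub>R \<beta> k)" by (metis surjD)
  then have "g q (?d c) (e k q) = g q v (e k q)" if "k \<in> {1..?m}" for k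
    using inner_\<beta>[OF that, of "\<lambda>k. g q (?d c) (e k q)"] inner_\<beta>[OF that, of "\<lambda>k. g q v (e k q)"]
    by (simp add: K_def)
  \<comment> \<open>The preimage under \<open>K\<close> of the coefficients of \<open>v\<close>
    gives a coordinate vector with the same frame coefficients as \<open>v\<close>.\<close>
  then have eq: "?d c = v" using tangent_eqI[OF q tan v] by blast
  have "?d c F = (\<Sum>b\<in>Basis. (c \<bullet> b) * ?d b F)" for F
  proof -
    interpret linear "\<lambda>c. ?d c F" by (rule coordinate_vector_linear[OF U])
    have "?d (\<Sum>b\<in>Basis. (c \<bullet> b) *\<^sub>R b) F = (\<Sum>b\<in>Basis. (c \<bullet> b) * ?d b F)" by (simp add: sum scaleR)
    then show ?thesis by (simp add: euclidean_representation)
  qed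
  then show ?thesis unfolding eq[symmetric] coordinate_vector_coordinate[OF U] by blast
qed

end

section \<open>Connections along maps\<close>

locale smooth_mapping = M: manifold A + N: manifold B
  for A :: "('a::{t2_space,second_countable_topology}, 'e::euclidean_space) atlas"
    and B :: "('b::{t2_space,second_countable_topology}, 'f::euclidean_space) atlas" +
  fixes \<phi> :: "'a \<Rightarrow> 'b"
  assumes smooth: "smooth_map A B \<phi>"
begin

lemma vimage_open: "open U \<Longrightarrow> open (\<phi> -` U)"
  using smooth unfolding smooth_map_def by (auto intro: open_vimage)

text \<open>A smooth map is described by its coordinate representations, so the composite is
  factored through a chart of the target; the points are therefore treated one target chart at a
  time.\<close>

lemma smooth_on_compose:
  assumes U: "open U" "smooth_on B U F"
  shows "smooth_on A (\<phi> -` U) (F \<circ> \<phi>)"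
proof (rule M.smooth_on_local)
  fix p assume p: "p \<in> \<phi> -` U"
  obtain V y where V: "(V, y) \<in> B" "\<phi> p \<in> V" by (rule N.chart_cover)
  let ?T = "\<phi> -` (V \<inter> U)"
  have oT: "open ?T" using vimage_open N.chart(1)[OF V(1)] U(1) by blast
  have "smooth_on A ?T (F \<circ> \<phi>)"
  proof (rule M.smooth_onI)
    fix X x assume X: "(X, x) \<in> A"
    let ?S = "x ` (X \<inter> ?T)"
    have oS: "open ?S" by (rule M.chart_open_image[OF X oT])
    have "C_inf_on (x ` (X \<inter> \<phi> -` V)) (y \<circ> \<phi> \<circ> inv_into X x)"
      using smooth X V(1) unfolding smooth_map_def by auto
    then have 1: "C_inf_on ?S (y \<circ> \<phi> \<circ> inv_into X x)" by (rule C_inf_on_subset) auto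
    have "C_inf_on ?S (\<lambda>w. (F \<circ> inv_into V y) ((y \<circ> \<phi> \<circ> inv_into X x) w))"
      by (rule C_inf_on_compose[OF oS N.chart_open_image[OF V(1) U(1)] _ 1 N.smooth_onD[OF U(2) V(1)]])
        (use M.chart_inv[OF X] in auto)
    moreover have "(F \<circ> inv_into V y) ((y \<circ> \<phi> \<circ> inv_into X x) w) = ((F \<circ> \<phi>) \<circ> inv_into X x) w"
      if "w \<in> ?S" for w
      using that M.chart_inv[OF X] N.chart_inv[OF V(1)] by auto
    ultimately show "C_inf_on ?S ((F \<circ> \<phi>) \<circ> inv_into X x)"
      using C_inf_on_cong[OF oS, of "\<lambda>w. (F \<circ> inv_into V y) ((y \<circ> \<phi> \<circ> inv_into X x) w)"] by blast
  qed
  then show "\<exists>T. open T \<and> p \<in> T \<and> T \<subseteq> \<phi> -` U \<and> smooth_on A T (F \<circ> \<phi>)"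
    using oT p V(2) by (intro exI[of _ ?T]) simp
qed

lemma smooth_near_compose: "smooth_near B (\<phi> p) F \<Longrightarrow> smooth_near A p (F \<circ> \<phi>)"
  unfolding smooth_near_def using smooth_on_compose vimage_open by (metis vimage_eq)

lemma differential_apply: "smooth_near B (\<phi> p) F \<Longrightarrow> differential B \<phi> p v F = v (F \<circ> \<phi>)"
  by (simp add: differential_def)

lemma differential_lincomb:
  "differential B \<phi> p (\<lambda>f. a * u f + b * v f)
    = (\<lambda>F. a * differential B \<phi> p u F + b * differential B \<phi> p v F)"
  by (auto simp: differential_def)

lemma differential_sum:
  "differential B \<phi> p (\<lambda>f. \<Sum>i\<in>I. c i * u i f) = (\<lambda>F. \<Sum>i\<in>I. c i * differential B \<phi> p (u i) F)"
  by (auto simp: differential_def)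

lemma differential_tangent:
  assumes v: "v \<in> tangent_space A p"
  shows "differential B \<phi> p v \<in> tangent_space B (\<phi> p)"
proof -
  have ev: "smooth_near B (\<phi> p) F = smooth_near B (\<phi> p) G \<and> v (F \<circ> \<phi>) = v (G \<circ> \<phi>)"
    if FG: "\<forall>\<^sub>F r in nhds (\<phi> p). F r = G r" for F G
  proof -
    obtain T where T: "open T" "\<phi> p \<in> T" "\<And>r. r \<in> T \<Longrightarrow> F r = G r"
      using FG by (auto simp: eventually_nhds)
    have "v (F \<circ> \<phi>) = v (G \<circ> \<phi>)"
      by (rule M.tangent_cong[OF v vimage_open[OF T(1)]]) (use T in auto)
    then show ?thesis using N.smooth_near_cong[OF FG] by simp
  qed
  have comp: "(\<lambda>q. F q + G q) \<circ> \<phi> = (\<lambda>p. (F \<circ> \<phi>) p + (G \<circ> \<phi>) p)"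
    "(\<lambda>q. F q * G q) \<circ> \<phi> = (\<lambda>p. (F \<circ> \<phi>) p * (G \<circ> \<phi>) p)"
    "(\<lambda>q. c * F q) \<circ> \<phi> = (\<lambda>p. c * (F \<circ> \<phi>) p)" for F G c
    by auto
  have scale: "smooth_near B (\<phi> p) F \<Longrightarrow> v ((\<lambda>q. c * F q) \<circ> \<phi>) = c * v (F \<circ> \<phi>)" for F c
    unfolding comp(3) using M.tangent_scale[OF v smooth_near_compose] by blast
  have add: "v ((\<lambda>q. F q + G q) \<circ> \<phi>) = v (F \<circ> \<phi>) + v (G \<circ> \<phi>)"
    if "smooth_near B (\<phi> p) F" "smooth_near B (\<phi> p) G" for F G
    unfolding comp(1) by (rule M.tangent_add[OF v smooth_near_compose smooth_near_compose]) fact+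
  have mult: "v ((\<lambda>q. F q * G q) \<circ> \<phi>) = v (F \<circ> \<phi>) * (G \<circ> \<phi>) p + (F \<circ> \<phi>) p * v (G \<circ> \<phi>)"
    if "smooth_near B (\<phi> p) F" "smooth_near B (\<phi> p) G" for F G
    unfolding comp(2) by (rule M.tangent_mult[OF v smooth_near_compose smooth_near_compose]) fact+
  show ?thesis
    unfolding tangent_space_def differential_def mem_Collect_eq
  proof (intro conjI allI impI, goal_cases)
    case 1 then show ?case
      by (simp add: N.smooth_near_add add)
  next
    case (2 f g c) then show ?case
      using scale[of f c] N.smooth_near_mult[OF N.smooth_near_const, of "\<phi> p" f c] by simp
  next
    case 3 then show ?case
      by (simp add: N.smooth_near_mult mult)
  next
    case (4 f g) then show ?case using ev[of f g] by simp
  qed simp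
qed

lemma sectionD:
  assumes "Y \<in> sections_along A B \<phi> W"
  shows section_tangent: "p \<in> W \<Longrightarrow> Y p \<in> tangent_space B (\<phi> p)"
    and section_smooth: "\<lbrakk>open U; smooth_on B U F\<rbrakk> \<Longrightarrow> smooth_on A (W \<inter> \<phi> -` U) (\<lambda>p. Y p F)"
  using assms by (auto simp: sections_along_def)

lemma sectionI:
  assumes "\<And>p. p \<in> W \<Longrightarrow> Y p \<in> tangent_space B (\<phi> p)"
    "\<And>U F. open U \<Longrightarrow> smooth_on B U F \<Longrightarrow> smooth_on A (W \<inter> \<phi> -` U) (\<lambda>p. Y p F)"
  shows "Y \<in> sections_along A B \<phi> W"
  using assms by (auto simp: sections_along_def)

lemma section_subset:
  assumes "Y \<in> sections_along A B \<phi> W" "W' \<subseteq> W"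
  shows "Y \<in> sections_along A B \<phi> W'"
proof (rule sectionI)
  show "smooth_on A (W' \<inter> \<phi> -` U) (\<lambda>p. Y p F)" if "open U" "smooth_on B U F" for U F
    using M.smooth_on_subset[OF section_smooth[OF assms(1) that], of "W' \<inter> \<phi> -` U"] assms(2) by blast
qed (use assms section_tangent in blast)

lemma section_lincomb:
  assumes W: "open W" and c: "\<And>i. i \<in> I \<Longrightarrow> smooth_on A W (c i)"
    and Y: "\<And>i. i \<in> I \<Longrightarrow> Y i \<in> sections_along A B \<phi> W"
  shows "(\<lambda>q F. \<Sum>i\<in>I. c i q * Y i q F) \<in> sections_along A B \<phi> W"
proof (rule sectionI)
  show "(\<lambda>F. \<Sum>i\<in>I. c i p * Y i p F) \<in> tangent_space B (\<phi> p)" if "p \<in> W" for p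
    by (rule N.tangent_lincomb_sum) (use Y section_tangent that in blast)
  fix U F assume U: "open U" "smooth_on B U F"
  then have o: "open (W \<inter> \<phi> -` U)" using W vimage_open by blast
  have "smooth_on A (W \<inter> \<phi> -` U) (\<lambda>p. c i p * Y i p F)" if "i \<in> I" for i
    by (rule M.smooth_on_mult[OF o M.smooth_on_subset[OF c[OF that]] section_smooth[OF Y[OF that] U]]) auto
  then show "smooth_on A (W \<inter> \<phi> -` U) (\<lambda>p. \<Sum>i\<in>I. c i p * Y i p F)"
    by (rule M.smooth_on_sum[OF o])
qed

lemma section_compose:
  assumes W: "open W" and T: "open T" "Y \<in> vector_fields B T" "\<phi> ` W \<subseteq> T"
  shows "Y \<circ> \<phi> \<in> sections_along A B \<phi> W"
proof (rule sectionI)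
  show "(Y \<circ> \<phi>) p \<in> tangent_space B (\<phi> p)" if "p \<in> W" for p
    using that T(3) N.vector_field_tangent[OF T(2)] by auto
  fix U F assume U: "open U" "smooth_on B U F"
  have "smooth_on A (\<phi> -` (T \<inter> U)) ((\<lambda>q. Y q F) \<circ> \<phi>)"
    using smooth_on_compose N.vector_field_smooth[OF T(2) U] T(1) U(1) by blast
  then show "smooth_on A (W \<inter> \<phi> -` U) (\<lambda>p. (Y \<circ> \<phi>) p F)"
    using M.smooth_on_subset[of "\<phi> -` (T \<inter> U)" "(\<lambda>q. Y q F) \<circ> \<phi>" "W \<inter> \<phi> -` U"] T(3) by (auto simp: comp_def)
qed

lemma differential_section:
  assumes W: "open W" and X: "X \<in> vector_fields A W"
  shows "(\<lambda>p. differential B \<phi> p (X p)) \<in> sections_along A B \<phi> W"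
proof (rule sectionI)
  show "differential B \<phi> p (X p) \<in> tangent_space B (\<phi> p)" if "p \<in> W" for p
    by (rule differential_tangent[OF M.vector_field_tangent[OF X that]])
  fix U F assume U: "open U" "smooth_on B U F"
  have o: "open (W \<inter> \<phi> -` U)" using W vimage_open[OF U(1)] by blast
  have "differential B \<phi> p (X p) F = X p (F \<circ> \<phi>)" if "p \<in> W \<inter> \<phi> -` U" for p
    by (rule differential_apply[OF N.smooth_nearI[OF U(1) _ U(2)]]) (use that in simp)
  then show "smooth_on A (W \<inter> \<phi> -` U) (\<lambda>p. differential B \<phi> p (X p) F)"
    using M.smooth_on_cong[OF o, of "\<lambda>p. differential B \<phi> p (X p) F" "\<lambda>p. X p (F \<circ> \<phi>)"]
      M.vector_field_smooth[OF X vimage_open[OF U(1)] smooth_on_compose[OF U]] by blast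
qed

section \<open>Calculus of an arbitrary connection along a map\<close>

context
  fixes U D assumes conn: "connection_along A B \<phi> U D"
begin

lemma connection_open: "open U"
  using conn unfolding connection_along_def by blast

lemma connection_section:
  "\<lbrakk>open W; W \<subseteq> U; Y \<in> sections_along A B \<phi> W; X \<in> vector_fields A W\<rbrakk> \<Longrightarrow>
    (\<lambda>p. D p (X p) Y) \<in> sections_along A B \<phi> W"
  using conn unfolding connection_along_def by blast

lemma connection_direction:
  "\<lbrakk>open W; W \<subseteq> U; Y \<in> sections_along A B \<phi> W; p \<in> W; v \<in> tangent_space A p; w \<in> tangent_space A p\<rbrakk> \<Longrightarrow>
    D p (\<lambda>f. a * v f + b * w f) Y = (\<lambda>F. a * D p v Y F + b * D p w Y F)"
  by (rule conn[unfolded connection_along_def, THEN conjunct2, rule_format, OF conjI[OF _ conjI], THEN conjunct2, rule_format, THEN conjunct1, rule_format])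

lemma connection_add:
  "\<lbrakk>open W; W \<subseteq> U; Y \<in> sections_along A B \<phi> W; Z \<in> sections_along A B \<phi> W; p \<in> W; v \<in> tangent_space A p\<rbrakk> \<Longrightarrow>
    D p v (\<lambda>q F. Y q F + Z q F) = (\<lambda>F. D p v Y F + D p v Z F)"
  by (rule conn[unfolded connection_along_def, THEN conjunct2, rule_format, OF conjI[OF _ conjI], THEN conjunct2, rule_format, THEN conjunct2, THEN conjunct1, rule_format])

lemma connection_leibniz:
  "\<lbrakk>open W; W \<subseteq> U; Y \<in> sections_along A B \<phi> W; smooth_on A W f; p \<in> W; v \<in> tangent_space A p\<rbrakk> \<Longrightarrow>
    D p v (\<lambda>q F. f q * Y q F) = (\<lambda>F. v f * Y p F + f p * D p v Y F)"
  by (rule conn[unfolded connection_along_def, THEN conjunct2, rule_format, OF conjI[OF _ conjI], THEN conjunct2, rule_format, THEN conjunct2, THEN conjunct2, rule_format])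

text \<open>Since values outside \<open>W\<close> do not matter for smoothness on \<open>W\<close>, the Leibniz rule may be
  applied to the indicator function of \<open>W\<close>.\<close>

lemma connection_local:
  assumes W: "open W" "W \<subseteq> U" "Y \<in> sections_along A B \<phi> W" "Z \<in> sections_along A B \<phi> W"
    and p: "p \<in> W" "v \<in> tangent_space A p" and eq: "\<And>q. q \<in> W \<Longrightarrow> Y q = Z q"
  shows "D p v Y = D p v Z"
proof -
  define f :: "'a \<Rightarrow> real" where "f q = (if q \<in> W then 1 else 0)" for q
  have f: "smooth_on A W f"
    using M.smooth_on_cong[OF W(1), of f "\<lambda>q. 1"] by (simp add: f_def)
  have vf: "v f = 0"
    using M.tangent_cong[OF p(2) W(1) p(1), of f "\<lambda>q. 1"] M.tangent_const[OF p(2)] by (simp add: f_def)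
  have fp: "f p = 1" using p(1) by (simp add: f_def)
  \<comment> \<open>Outside \<open>W\<close> both products vanish, so these are equal as total
    functions although \<open>Y\<close> and \<open>Z\<close> may differ there.\<close>
  have "(\<lambda>q F. f q * Y q F) = (\<lambda>q F. f q * Z q F)" by (auto simp: f_def eq)
  then show ?thesis
    using connection_leibniz[OF W(1,2,3) f p] connection_leibniz[OF W(1,2,4) f p] by (simp add: vf fp)
qed

lemma connection_lincomb:
  assumes W: "open W" "W \<subseteq> U" and p: "p \<in> W" "v \<in> tangent_space A p" and I: "finite I"
    and c: "\<And>i. i \<in> I \<Longrightarrow> smooth_on A W (c i)"
    and Y: "\<And>i. i \<in> I \<Longrightarrow> Y i \<in> sections_along A B \<phi> W"
  shows "D p v (\<lambda>q F. \<Sum>i\<in>I. c i q * Y i q F)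
    = (\<lambda>F. \<Sum>i\<in>I. v (c i) * Y i p F + c i p * D p v (Y i) F)"
  using I c Y
proof (induction I)
  case empty
  have "(\<lambda>q F. 0) \<in> sections_along A B \<phi> W"
    using section_lincomb[OF W(1), of "{}"] by simp
  \<comment> \<open>The zero section is 0 times itself, and the Leibniz rule for the constant factor
    0 makes its derivative vanish.\<close>
  then show ?case
    using connection_leibniz[OF W _ _ p, of "\<lambda>q F. 0" "\<lambda>q. 0"] M.tangent_const[OF p(2)] by simp
next
  case (insert i I)
  have 1: "(\<lambda>q F. c i q * Y i q F) \<in> sections_along A B \<phi> W"
    using section_lincomb[OF W(1), of "{i}" c Y] insert.prems by simp
  have 2: "(\<lambda>q F. \<Sum>i\<in>I. c i q * Y i q F) \<in> sections_along A B \<phi> W"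
    by (rule section_lincomb[OF W(1)]) (use insert.prems in auto)
  have 3: "D p v (\<lambda>q F. c i q * Y i q F) = (\<lambda>F. v (c i) * Y i p F + c i p * D p v (Y i) F)"
    by (rule connection_leibniz[OF W _ _ p]) (use insert.prems in auto)
  show ?case
    using connection_add[OF W 1 2 p] insert.IH insert.prems insert.hyps 3 by simp
qed

lemma connection_direction_sum:
  assumes W: "open W" "W \<subseteq> U" "Y \<in> sections_along A B \<phi> W" and p: "p \<in> W" and I: "finite I"
    and u: "\<And>i. i \<in> I \<Longrightarrow> u i \<in> tangent_space A p"
  shows "D p (\<lambda>f. \<Sum>i\<in>I. c i * u i f) Y = (\<lambda>F. \<Sum>i\<in>I. c i * D p (u i) Y F)"
  using I u
proof (induction I)
  case empty
  then show ?case
    using connection_direction[OF W p M.tangent_zero M.tangent_zero, of 0 0] by simp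
next
  case (insert i I)
  then show ?case
    using connection_direction[OF W p, of "u i" "\<lambda>f. \<Sum>i\<in>I. c i * u i f" "c i" 1]
      M.tangent_lincomb_sum[of I u p c] by simp
qed

end

end

text \<open>Metric and frame are required on the target only, so the identity map of a single framed
  manifold is an instance.\<close>

locale framed_mapping = smooth_mapping A B \<phi> + framed B h V \<epsilon>
  for A :: "('a::{t2_space,second_countable_topology}, 'e::euclidean_space) atlas"
    and B :: "('b::{t2_space,second_countable_topology}, 'f::euclidean_space) atlas"
    and \<phi> :: "'a \<Rightarrow> 'b" and h V \<epsilon> +
  fixes W :: "'a set"
  assumes open_W: "open W" and image_W: "\<phi> ` W \<subseteq> V"
begin

lemma frame_section: "open W' \<Longrightarrow> W' \<subseteq> W \<Longrightarrow> i \<in> {1..DIM('f)} \<Longrightarrow> \<epsilon> i \<circ> \<phi> \<in> sections_along A B \<phi> W'"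
  by (rule section_compose[OF _ open_domain frame_vector_field]) (use image_W in auto)

text \<open>In the coordinate vectors of a chart of the target, the coefficients of \<open>Y\<close>
  are its values on coordinate functions, smooth because \<open>Y\<close> is a section. The
  remaining products pair two vector fields of the target and are composed with
  \<open>\<phi>\<close>, so the smoothness of the metric applies to them.\<close>

lemma section_component_smooth:
  assumes W': "open W'" "W' \<subseteq> W" and Y: "Y \<in> sections_along A B \<phi> W'" and k: "k \<in> {1..DIM('f)}"
  shows "smooth_on A W' (\<lambda>p. h (\<phi> p) (Y p) (\<epsilon> k (\<phi> p)))"
proof (rule M.smooth_on_local)
  fix p assume p: "p \<in> W'"
  obtain U y where U: "(U, y) \<in> B" "\<phi> p \<in> U" by (rule N.chart_cover)
  note oU = N.chart(1)[OF U(1)]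
  let ?T = "W' \<inter> \<phi> -` U" and ?d = "coordinate_vector B U y"
  have oT: "open ?T" using W'(1) vimage_open[OF oU] by blast
  have oUV: "open (U \<inter> V)" by (rule open_Int[OF oU open_domain])
  have 1: "smooth_on A ?T (\<lambda>q. Y q (\<lambda>r. y r \<bullet> b))" for b
    by (rule section_smooth[OF Y oU N.coordinate_smooth[OF U(1)]])
  have "smooth_on B (U \<inter> V) (\<lambda>r. h r (?d b r) (\<epsilon> k r))" for b
    using component_smooth[OF oUV _ N.vector_field_subset[OF N.coordinate_vector_field[OF U(1)]] k]
    by blast
  then have 2: "smooth_on A ?T (\<lambda>q. h (\<phi> q) (?d b (\<phi> q)) (\<epsilon> k (\<phi> q)))" for b
    using M.smooth_on_subset[OF smooth_on_compose[OF oUV], of _ ?T, unfolded comp_def] W'(2) image_W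
    by blast
  have eq: "h (\<phi> q) (Y q) (\<epsilon> k (\<phi> q))
      = (\<Sum>b\<in>Basis. Y q (\<lambda>r. y r \<bullet> b) * h (\<phi> q) (?d b (\<phi> q)) (\<epsilon> k (\<phi> q)))" if q: "q \<in> ?T" for q
  proof -
    have qq: "\<phi> q \<in> U" "\<phi> q \<in> V" using q W'(2) image_W by auto
    have "Y q = (\<lambda>F. \<Sum>b\<in>Basis. Y q (\<lambda>r. y r \<bullet> b) * ?d b (\<phi> q) F)"
      by (rule coordinate_expand[OF U(1) qq section_tangent[OF Y]]) (use q in simp)
    then have "h (\<phi> q) (Y q) (\<epsilon> k (\<phi> q))
      = h (\<phi> q) (\<lambda>F. \<Sum>b\<in>Basis. Y q (\<lambda>r. y r \<bullet> b) * ?d b (\<phi> q) F) (\<epsilon> k (\<phi> q))" by simp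
    also have "\<dots> = (\<Sum>b\<in>Basis. Y q (\<lambda>r. y r \<bullet> b) * h (\<phi> q) (?d b (\<phi> q)) (\<epsilon> k (\<phi> q)))"
      by (rule bilinear_sum[OF metric_bilinear])
        (use N.coordinate_vector_tangent[OF U(1) qq(1)] frame_tangent[OF qq(2) k] in auto)
    finally show ?thesis .
  qed
  have "smooth_on A ?T (\<lambda>q. \<Sum>b\<in>Basis. Y q (\<lambda>r. y r \<bullet> b) * h (\<phi> q) (?d b (\<phi> q)) (\<epsilon> k (\<phi> q)))"
    by (intro M.smooth_on_sum[OF oT] M.smooth_on_mult[OF oT] 1 2)
  then have "smooth_on A ?T (\<lambda>p. h (\<phi> p) (Y p) (\<epsilon> k (\<phi> p)))"
    by (rule M.smooth_on_transform[OF _ oT eq])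
  then show "\<exists>T. open T \<and> p \<in> T \<and> T \<subseteq> W' \<and> smooth_on A T (\<lambda>p. h (\<phi> p) (Y p) (\<epsilon> k (\<phi> p)))"
    using oT p U(2) by (intro exI[of _ ?T]) simp
qed

lemma section_expand:
  assumes "Y \<in> sections_along A B \<phi> W'" "W' \<subseteq> W" "p \<in> W'"
  shows "Y p = (\<lambda>F. \<Sum>i=1..DIM('f). h (\<phi> p) (Y p) (\<epsilon> i (\<phi> p)) * \<epsilon> i (\<phi> p) F)"
  by (rule frame_expand[OF _ section_tangent[OF assms(1,3)]]) (use assms image_W in auto)

lemma frame_section_lincomb:
  assumes "open W'" "W' \<subseteq> W" "\<And>i. i \<in> {1..DIM('f)} \<Longrightarrow> smooth_on A W' (c i)"
  shows "(\<lambda>q F. \<Sum>i=1..DIM('f). c i q * \<epsilon> i (\<phi> q) F) \<in> sections_along A B \<phi> W'"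
  using section_lincomb[OF assms(1), of "{1..DIM('f)}" c "\<lambda>i. \<epsilon> i \<circ> \<phi>"] assms frame_section
  by (simp add: comp_def)

text \<open>Reduces a connection to its values on the frame sections; both uniqueness proofs compare
  only these.\<close>

lemma connection_components:
  assumes conn: "connection_along A B \<phi> U D" and W': "open W'" "W' \<subseteq> W" "W' \<subseteq> U"
    and Y: "Y \<in> sections_along A B \<phi> W'" and p: "p \<in> W'" "v \<in> tangent_space A p"
  shows "D p v Y = (\<lambda>F. \<Sum>i=1..DIM('f). v (\<lambda>q. h (\<phi> q) (Y q) (\<epsilon> i (\<phi> q))) * \<epsilon> i (\<phi> p) F
    + h (\<phi> p) (Y p) (\<epsilon> i (\<phi> p)) * D p v (\<epsilon> i \<circ> \<phi>) F)"
proof -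
  let ?c = "\<lambda>i q. h (\<phi> q) (Y q) (\<epsilon> i (\<phi> q))"
  note c = section_component_smooth[OF W'(1,2) Y]
  have "D p v Y = D p v (\<lambda>q F. \<Sum>i=1..DIM('f). ?c i q * (\<epsilon> i \<circ> \<phi>) q F)"
    by (rule connection_local[OF conn W'(1,3) Y _ p])
      (use frame_section_lincomb[OF W'(1,2) c] section_expand[OF Y W'(2)] in simp_all)
  also have "\<dots> = (\<lambda>F. \<Sum>i=1..DIM('f). v (?c i) * (\<epsilon> i \<circ> \<phi>) p F + ?c i p * D p v (\<epsilon> i \<circ> \<phi>) F)"
    by (rule connection_lincomb[OF conn W'(1,3) p _ c frame_section[OF W'(1,2)]]) simp_all
  finally show ?thesis by simp
qed

end

section \<open>The Levi-Civita and the pull-back connection\<close>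

lemma sum_rotate3:
  "(\<Sum>a\<in>A. \<Sum>b\<in>B. \<Sum>l\<in>C. f a b l) = (\<Sum>l\<in>C. \<Sum>a\<in>A. \<Sum>b\<in>B. f a b l)"
proof -
  have "(\<Sum>a\<in>A. \<Sum>b\<in>B. \<Sum>l\<in>C. f a b l) = (\<Sum>a\<in>A. \<Sum>l\<in>C. \<Sum>b\<in>B. f a b l)"
    by (rule sum.cong[OF refl sum.swap])
  then show ?thesis by (simp only: sum.swap[of _ C A])
qed

lemma (in manifold) smooth_map_id: "smooth_map A A (\<lambda>p. p)"
  unfolding smooth_map_def using chart_transition by (auto simp: comp_def)

section \<open>Structure functions and Koszul coefficients of a frame\<close>

context framed begin

definition structure_coefficient :: "nat \<Rightarrow> nat \<Rightarrow> nat \<Rightarrow> 'a \<Rightarrow> real" where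
  "structure_coefficient k i j p = g p (lie_bracket A (e i) (e j) p) (e k p)"

text \<open>The Koszul formula for \<open>g\<close> of the derivative of \<open>e b\<close> along
  \<open>e a\<close> with \<open>e l\<close>. The products of frame fields are constant, so its
  derivative terms vanish and only brackets remain.\<close>

definition christoffel :: "nat \<Rightarrow> nat \<Rightarrow> nat \<Rightarrow> 'a \<Rightarrow> real" where
  "christoffel l a b p = 1/2 * (structure_coefficient l a b p - structure_coefficient a b l p
     + structure_coefficient b l a p)"

lemma frame_bracket_vector_field:
  "i \<in> {1..DIM('e)} \<Longrightarrow> j \<in> {1..DIM('e)} \<Longrightarrow> lie_bracket A (e i) (e j) \<in> vector_fields A W"
  by (intro lie_bracket_vector_field open_domain frame_vector_field order_refl)

lemma structure_smooth:
  "i \<in> {1..DIM('e)} \<Longrightarrow> j \<in> {1..DIM('e)} \<Longrightarrow> k \<in> {1..DIM('e)} \<Longrightarrow>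
    smooth_on A W (structure_coefficient k i j)"
  unfolding structure_coefficient_def
  by (intro component_smooth open_domain frame_bracket_vector_field order_refl)

lemma christoffel_smooth:
  "i \<in> {1..DIM('e)} \<Longrightarrow> j \<in> {1..DIM('e)} \<Longrightarrow> k \<in> {1..DIM('e)} \<Longrightarrow> smooth_on A W (christoffel k i j)"
  unfolding christoffel_def
  by (intro smooth_on_mult smooth_on_add smooth_on_diff smooth_on_const structure_smooth open_domain)

lemma lie_bracket_swap: "lie_bracket A Y X p = (\<lambda>f. - lie_bracket A X Y p f)"
  by (auto simp: lie_bracket_def)

lemma structure_antisym:
  assumes "p \<in> W" "i \<in> {1..DIM('e)}" "j \<in> {1..DIM('e)}" "k \<in> {1..DIM('e)}"
  shows "structure_coefficient k j i p = - structure_coefficient k i j p"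
proof -
  have "lie_bracket A (e i) (e j) p \<in> tangent_space A p"
    using vector_field_tangent[OF frame_bracket_vector_field assms(1)] assms by blast
  then have "g p (\<lambda>f. (-1) * lie_bracket A (e i) (e j) p f + 0 * lie_bracket A (e i) (e j) p f) (e k p)
      = (-1) * g p (lie_bracket A (e i) (e j) p) (e k p) + 0 * g p (lie_bracket A (e i) (e j) p) (e k p)"
    using metric_bilinear frame_tangent[OF assms(1,4)] unfolding bilinear_on_def by blast
  then show ?thesis
    unfolding structure_coefficient_def lie_bracket_swap[of "e j" "e i"] by simp
qed

text \<open>The last two Koszul terms cancel in the difference by the antisymmetry of brackets, and
  the first one doubles. In coefficients this is the absence of torsion.\<close>

lemma christoffel_torsion:
  assumes "p \<in> W" "a \<in> {1..DIM('e)}" "b \<in> {1..DIM('e)}" "l \<in> {1..DIM('e)}"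
  shows "christoffel l a b p - christoffel l b a p = structure_coefficient l a b p"
  using structure_antisym[OF assms(1), of a b l] structure_antisym[OF assms(1), of b l a]
    structure_antisym[OF assms(1), of l a b] assms(2-) by (simp add: christoffel_def field_simps)

text \<open>Compatibility with the metric in coefficients: for each direction \<open>a\<close> the
  connection matrix in an orthonormal frame is skew.\<close>

lemma christoffel_antisym:
  assumes "p \<in> W" "a \<in> {1..DIM('e)}" "b \<in> {1..DIM('e)}" "l \<in> {1..DIM('e)}"
  shows "christoffel l a b p = - christoffel b a l p"
  using structure_antisym[OF assms(1), of a b l] structure_antisym[OF assms(1), of b l a]
    structure_antisym[OF assms(1), of l a b] assms(2-) by (simp add: christoffel_def field_simps)

lemma frame_bracket_expand:
  assumes "p \<in> W" "i \<in> {1..DIM('e)}" "j \<in> {1..DIM('e)}"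
  shows "lie_bracket A (e i) (e j) p = (\<lambda>f. \<Sum>k=1..DIM('e). structure_coefficient k i j p * e k p f)"
  unfolding structure_coefficient_def
  by (rule frame_expand[OF assms(1) vector_field_tangent[OF frame_bracket_vector_field assms(1)]])
    (use assms in auto)

lemma frame_lincomb_metric:
  assumes "p \<in> W" "u \<in> tangent_space A p"
  shows "g p (\<lambda>f. \<Sum>i=1..DIM('e). c i * e i p f) u = (\<Sum>i=1..DIM('e). c i * g p u (e i p))"
proof -
  have "g p (\<lambda>f. \<Sum>i=1..DIM('e). c i * e i p f) u = (\<Sum>i=1..DIM('e). c i * g p (e i p) u)"
    by (rule bilinear_sum[OF metric_bilinear]) (use frame_tangent assms in auto)
  also have "\<dots> = (\<Sum>i=1..DIM('e). c i * g p u (e i p))"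
    by (intro sum.cong refl arg_cong2[of _ _ _ _ "(*)"] metric_sym frame_tangent assms)
  finally show ?thesis .
qed

lemma derivation_lincomb:
  assumes "open W'" "W' \<subseteq> W" "p \<in> W'" "v \<in> tangent_space A p"
    and "\<And>i. i \<in> {1..DIM('e)} \<Longrightarrow> smooth_on A W' (y i)"
    and "\<And>q. q \<in> W' \<Longrightarrow> Y q = (\<lambda>f. \<Sum>i=1..DIM('e). y i q * e i q f)"
    and f: "smooth_near A p f"
  shows "v (\<lambda>q. Y q f) = (\<Sum>i=1..DIM('e). v (y i) * e i p f + y i p * v (\<lambda>q. e i q f))"
proof -
  obtain T where T: "open T" "p \<in> T" "T \<subseteq> W'" "smooth_on A T f"
    using smooth_near_common[OF f f assms(1,3)] by metis
  have "v (\<lambda>q. Y q f) = v (\<lambda>q. \<Sum>i=1..DIM('e). y i q * e i q f)"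
    by (rule tangent_cong[OF assms(4) T(1,2)]) (use assms(6) T(3) in auto)
  also have "\<dots> = (\<Sum>i=1..DIM('e). v (y i) * e i p f + y i p * v (\<lambda>q. e i q f))"
  proof (rule tangent_sum_mult[OF assms(4)])
    fix i assume i: "i \<in> {1..DIM('e)}"
    show "smooth_near A p (y i)" by (rule smooth_nearI[OF assms(1,3) assms(5)[OF i]])
    show "smooth_near A p (\<lambda>q. e i q f)"
      by (rule smooth_nearI[OF T(1,2) vector_field_smooth_on[OF frame_vector_field[OF i] _ T(1,4)]])
        (use T(3) assms(2) in auto)
  qed
  finally show ?thesis .
qed

text \<open>Separates the derivatives of the coefficients from the second-order frame terms. Both
  the bracket formula and the Hessian start from this splitting.\<close>

lemma derivation_lincomb_frame:
  assumes "open W'" "W' \<subseteq> W" "p \<in> W'" "v = (\<lambda>f. \<Sum>i=1..DIM('e). c i * e i p f)"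
    and "\<And>i. i \<in> {1..DIM('e)} \<Longrightarrow> smooth_on A W' (y i)"
    and "\<And>q. q \<in> W' \<Longrightarrow> Y q = (\<lambda>f. \<Sum>i=1..DIM('e). y i q * e i q f)"
    and f: "smooth_near A p f"
  shows "v (\<lambda>q. Y q f) = (\<Sum>i=1..DIM('e). v (y i) * e i p f)
    + (\<Sum>a=1..DIM('e). \<Sum>b=1..DIM('e). c a * y b p * e a p (\<lambda>q. e b q f))"
proof -
  have v: "v \<in> tangent_space A p"
    using assms(2-4) frame_lincomb_tangent by auto
  have "v k = (\<Sum>a=1..DIM('e). c a * e a p k)" for k
    using assms(4) by simp
  then have "(\<Sum>i=1..DIM('e). y i p * v (\<lambda>q. e i q f))
      = (\<Sum>b=1..DIM('e). \<Sum>a=1..DIM('e). c a * y b p * e a p (\<lambda>q. e b q f))"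
    by (intro sum.cong refl) (simp add: sum_distrib_left mult_ac)
  also have "\<dots> = (\<Sum>a=1..DIM('e). \<Sum>b=1..DIM('e). c a * y b p * e a p (\<lambda>q. e b q f))"
    by (rule sum.swap)
  finally show ?thesis
    using derivation_lincomb[OF assms(1-3) v assms(5-7)] by (simp add: sum.distrib)
qed

lemma lie_bracket_components:
  assumes W': "open W'" "W' \<subseteq> W" "p \<in> W'"
    and x: "\<And>i. i \<in> {1..DIM('e)} \<Longrightarrow> smooth_on A W' (x i)"
      "\<And>q. q \<in> W' \<Longrightarrow> X q = (\<lambda>f. \<Sum>i=1..DIM('e). x i q * e i q f)"
    and y: "\<And>i. i \<in> {1..DIM('e)} \<Longrightarrow> smooth_on A W' (y i)"
      "\<And>q. q \<in> W' \<Longrightarrow> Y q = (\<lambda>f. \<Sum>i=1..DIM('e). y i q * e i q f)"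
  shows "lie_bracket A X Y p = (\<lambda>f. \<Sum>l=1..DIM('e). (X p (y l) - Y p (x l)
    + (\<Sum>a=1..DIM('e). \<Sum>b=1..DIM('e). x a p * y b p * structure_coefficient l a b p)) * e l p f)"
proof
  fix f
  let ?m = "DIM('e)"
  have p: "p \<in> W" using W' by auto
  show "lie_bracket A X Y p f = (\<Sum>l=1..?m. (X p (y l) - Y p (x l)
    + (\<Sum>a=1..?m. \<Sum>b=1..?m. x a p * y b p * structure_coefficient l a b p)) * e l p f)"
  proof (cases "smooth_near A p f")
    case False
    then show ?thesis using tangent_not_smooth[OF frame_tangent[OF p]] by (simp add: lie_bracket_def)
  next
    case True
    have XY: "X p (\<lambda>q. Y q f) = (\<Sum>i=1..?m. X p (y i) * e i p f)
      + (\<Sum>a=1..?m. \<Sum>b=1..?m. x a p * y b p * e a p (\<lambda>q. e b q f))"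
      by (rule derivation_lincomb_frame[OF W' x(2)[OF W'(3)] y True])
    have "Y p (\<lambda>q. X q f) = (\<Sum>i=1..?m. Y p (x i) * e i p f)
      + (\<Sum>b=1..?m. \<Sum>a=1..?m. y b p * x a p * e b p (\<lambda>q. e a q f))"
      by (rule derivation_lincomb_frame[OF W' y(2)[OF W'(3)] x True])
    \<comment> \<open>Renaming the indices aligns the two second-order sums, so that their
      difference consists of brackets of frame fields.\<close>
    also have "(\<Sum>b=1..?m. \<Sum>a=1..?m. y b p * x a p * e b p (\<lambda>q. e a q f))
      = (\<Sum>a=1..?m. \<Sum>b=1..?m. x a p * y b p * e b p (\<lambda>q. e a q f))"
    proof (subst sum.swap, intro sum.cong refl)
      show "y b p * x a p * e b p (\<lambda>q. e a q f) = x a p * y b p * e b p (\<lambda>q. e a q f)" for a b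
        by (rule arg_cong2[OF mult.commute refl])
    qed
    finally have "lie_bracket A X Y p f = (\<Sum>i=1..?m. X p (y i) * e i p f) - (\<Sum>i=1..?m. Y p (x i) * e i p f)
      + (\<Sum>a=1..?m. \<Sum>b=1..?m. x a p * y b p * (e a p (\<lambda>q. e b q f) - e b p (\<lambda>q. e a q f)))"
      using XY True by (simp add: lie_bracket_def right_diff_distrib sum_subtractf)
    also have "(\<Sum>a=1..?m. \<Sum>b=1..?m. x a p * y b p * (e a p (\<lambda>q. e b q f) - e b p (\<lambda>q. e a q f)))
      = (\<Sum>a=1..?m. \<Sum>b=1..?m. \<Sum>l=1..?m. x a p * y b p * structure_coefficient l a b p * e l p f)"
    proof (intro sum.cong refl)
      fix a b assume ab: "a \<in> {1..?m}" "b \<in> {1..?m}"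
      have "e a p (\<lambda>q. e b q f) - e b p (\<lambda>q. e a q f) = lie_bracket A (e a) (e b) p f"
        using True by (simp add: lie_bracket_def)
      then show "x a p * y b p * (e a p (\<lambda>q. e b q f) - e b p (\<lambda>q. e a q f))
        = (\<Sum>l=1..?m. x a p * y b p * structure_coefficient l a b p * e l p f)"
        by (simp add: frame_bracket_expand[OF p ab] sum_distrib_left mult.assoc)
    qed
    also have "\<dots> = (\<Sum>l=1..?m. \<Sum>a=1..?m. \<Sum>b=1..?m. x a p * y b p * structure_coefficient l a b p * e l p f)"
      by (rule sum_rotate3)
    finally show ?thesis
      by (simp add: sum.distrib sum_subtractf sum_distrib_right distrib_right left_diff_distrib)
  qed
qed

end

section \<open>The connection along a map built from frame coefficients\<close>

context framed_mapping begin

abbreviation component :: "('a \<Rightarrow> 'b tvec) \<Rightarrow> nat \<Rightarrow> 'a \<Rightarrow> real" where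
  "component Y l q \<equiv> h (\<phi> q) (Y q) (\<epsilon> l (\<phi> q))"

text \<open>Components are taken with the metric, so the formula applies to every \<open>Y\<close>
  without choosing an expansion. The coefficients are those of the target at
  \<open>\<phi> p\<close>, in the direction of the image of \<open>v\<close>.\<close>

definition frame_connection :: "('a, 'b) conn" where
  "frame_connection p v Y = (\<lambda>F. \<Sum>l=1..DIM('f). (v (component Y l)
    + (\<Sum>a=1..DIM('f). \<Sum>b=1..DIM('f). h (\<phi> p) (differential B \<phi> p v) (\<epsilon> a (\<phi> p))
        * component Y b p * christoffel l a b (\<phi> p))) * \<epsilon> l (\<phi> p) F)"

lemma smooth_on_W_compose:
  assumes "smooth_on B V F" "W' \<subseteq> W"
  shows "smooth_on A W' (\<lambda>q. F (\<phi> q))"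
  using M.smooth_on_subset[OF smooth_on_compose[OF open_domain assms(1)], of W'] assms(2) image_W
  unfolding comp_def by blast

lemma connection_along_frame_connection: "connection_along A B \<phi> W frame_connection"
  unfolding connection_along_def
proof (intro conjI allI impI ballI, rule open_W)
  fix W' Y X assume W: "open W' \<and> W' \<subseteq> W \<and> Y \<in> sections_along A B \<phi> W'" and X: "X \<in> vector_fields A W'"
  then have W': "open W'" "W' \<subseteq> W" and Y: "Y \<in> sections_along A B \<phi> W'" by auto
  show "(\<lambda>p. frame_connection p (X p) Y) \<in> sections_along A B \<phi> W'"
    unfolding frame_connection_def
    by (intro frame_section_lincomb W' M.smooth_on_add M.smooth_on_sum M.smooth_on_mult
        M.vector_field_smooth_on[OF X order_refl W'(1) section_component_smooth[OF W' Y] order_refl]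
        section_component_smooth[OF W' differential_section[OF W'(1) X]]
        section_component_smooth[OF W' Y]
        smooth_on_W_compose[OF christoffel_smooth W'(2)])
next
  fix W' Y p v w a b
  assume W: "open W' \<and> W' \<subseteq> W \<and> Y \<in> sections_along A B \<phi> W'" and p: "p \<in> W'"
    and vw: "v \<in> tangent_space A p" "w \<in> tangent_space A p"
  have pV: "\<phi> p \<in> V" using W p image_W by auto
  have lin: "h (\<phi> p) (differential B \<phi> p (\<lambda>f. a * v f + b * w f)) (\<epsilon> k (\<phi> p))
      = a * h (\<phi> p) (differential B \<phi> p v) (\<epsilon> k (\<phi> p)) + b * h (\<phi> p) (differential B \<phi> p w) (\<epsilon> k (\<phi> p))"
    if "k \<in> {1..DIM('f)}" for k
    using metric_bilinear differential_tangent[OF vw(1)] differential_tangent[OF vw(2)]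
      frame_tangent[OF pV that] unfolding bilinear_on_def differential_lincomb by blast
  show "frame_connection p (\<lambda>f. a * v f + b * w f) Y
      = (\<lambda>F. a * frame_connection p v Y F + b * frame_connection p w Y F)"
    unfolding frame_connection_def
    by (simp add: lin sum_distrib_left sum.distrib[symmetric] algebra_simps
        cong: sum.cong del: atLeastAtMost_iff One_nat_def)
next
  fix W' Y p v Z
  assume W: "open W' \<and> W' \<subseteq> W \<and> Y \<in> sections_along A B \<phi> W'" and p: "p \<in> W'"
    and v: "v \<in> tangent_space A p" and Z: "Z \<in> sections_along A B \<phi> W'"
  then have W': "open W'" "W' \<subseteq> W" and Y: "Y \<in> sections_along A B \<phi> W'" by auto
  \<comment> \<open>The metric is additive on tangent vectors only, hence this holds on
    \<open>W'\<close> and not everywhere; as \<open>v\<close> depends on the germ at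
    \<open>p\<close>, that suffices for the derivatives.\<close>
  have add: "component (\<lambda>q F. Y q F + Z q F) k q = component Y k q + component Z k q"
    if "k \<in> {1..DIM('f)}" "q \<in> W'" for k q
  proof -
    have "\<epsilon> k (\<phi> q) \<in> tangent_space B (\<phi> q)" using frame_tangent that W'(2) image_W by blast
    then have "h (\<phi> q) (\<lambda>F. 1 * Y q F + 1 * Z q F) (\<epsilon> k (\<phi> q)) = 1 * component Y k q + 1 * component Z k q"
      using metric_bilinear section_tangent[OF Y that(2)] section_tangent[OF Z that(2)]
      unfolding bilinear_on_def by blast
    then show ?thesis by simp
  qed
  have deriv: "v (component (\<lambda>q F. Y q F + Z q F) k) = v (component Y k) + v (component Z k)"
    if k: "k \<in> {1..DIM('f)}" for k
    using M.tangent_cong[OF v W'(1) p add[OF k]]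
      M.tangent_add[OF v M.smooth_nearI[OF W'(1) p section_component_smooth[OF W' Y k]]
        M.smooth_nearI[OF W'(1) p section_component_smooth[OF W' Z k]]] by simp
  show "frame_connection p v (\<lambda>q F. Y q F + Z q F)
      = (\<lambda>F. frame_connection p v Y F + frame_connection p v Z F)"
    unfolding frame_connection_def
    by (simp add: deriv add[OF _ p] sum.distrib[symmetric] sum_distrib_left algebra_simps
        cong: sum.cong del: atLeastAtMost_iff One_nat_def)
next
  fix W' Y p v f
  assume W: "open W' \<and> W' \<subseteq> W \<and> Y \<in> sections_along A B \<phi> W'" and p: "p \<in> W'"
    and v: "v \<in> tangent_space A p" and f: "smooth_on A W' f"
  then have W': "open W'" "W' \<subseteq> W" and Y: "Y \<in> sections_along A B \<phi> W'" by auto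
  have mult: "component (\<lambda>q F. f q * Y q F) k q = f q * component Y k q"
    if "k \<in> {1..DIM('f)}" "q \<in> W'" for k q
  proof -
    have "\<epsilon> k (\<phi> q) \<in> tangent_space B (\<phi> q)" using frame_tangent that W'(2) image_W by blast
    \<comment> \<open>Bilinearity is stated for combinations of two vectors; the second summand with
      coefficient 0 extracts homogeneity from it.\<close>
    then have "h (\<phi> q) (\<lambda>F. f q * Y q F + 0 * Y q F) (\<epsilon> k (\<phi> q)) = f q * component Y k q + 0 * component Y k q"
      using metric_bilinear section_tangent[OF Y that(2)] unfolding bilinear_on_def by blast
    then show ?thesis by simp
  qed
  have deriv: "v (component (\<lambda>q F. f q * Y q F) k) = v f * component Y k p + f p * v (component Y k)"
    if k: "k \<in> {1..DIM('f)}" for k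
    using M.tangent_cong[OF v W'(1) p mult[OF k]]
      M.tangent_mult[OF v M.smooth_nearI[OF W'(1) p f]
        M.smooth_nearI[OF W'(1) p section_component_smooth[OF W' Y k]]] by simp
  \<comment> \<open>The terms containing \<open>v f\<close> gather into the frame expansion of
    \<open>Y p\<close>.\<close>
  have "frame_connection p v (\<lambda>q F. f q * Y q F) F
      = v f * (\<Sum>l=1..DIM('f). component Y l p * \<epsilon> l (\<phi> p) F) + f p * frame_connection p v Y F" for F
    unfolding frame_connection_def
    by (simp add: deriv mult[OF _ p] sum.distrib[symmetric] sum_distrib_left algebra_simps
        cong: sum.cong del: atLeastAtMost_iff One_nat_def)
  then show "frame_connection p v (\<lambda>q F. f q * Y q F) = (\<lambda>F. v f * Y p F + f p * frame_connection p v Y F)"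
    using section_expand[OF Y W'(2) p] by metis
qed

end

text \<open>Keeps the coefficients apart from the metric products that compute them, so that
  constants or explicitly known functions can serve as coefficients.\<close>

definition (in framed) expands :: "'a set \<Rightarrow> ('a \<Rightarrow> 'a tvec) \<Rightarrow> (nat \<Rightarrow> 'a \<Rightarrow> real) \<Rightarrow> bool" where
  "expands W' Y y \<longleftrightarrow> open W' \<and> W' \<subseteq> W \<and> (\<forall>i\<in>{1..DIM('e)}. smooth_on A W' (y i)) \<and>
     (\<forall>q\<in>W'. Y q = (\<lambda>f. \<Sum>i=1..DIM('e). y i q * e i q f))"

definition (in framed_mapping) section_expands ::
  "'a set \<Rightarrow> ('a \<Rightarrow> 'b tvec) \<Rightarrow> (nat \<Rightarrow> 'a \<Rightarrow> real) \<Rightarrow> bool" where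
  "section_expands W' Y y \<longleftrightarrow> open W' \<and> W' \<subseteq> W \<and> (\<forall>i\<in>{1..DIM('f)}. smooth_on A W' (y i)) \<and>
     (\<forall>q\<in>W'. Y q = (\<lambda>F. \<Sum>i=1..DIM('f). y i q * \<epsilon> i (\<phi> q) F))"

context framed_mapping begin

lemma component_lincomb:
  assumes "q \<in> W" "Y q = (\<lambda>F. \<Sum>i=1..DIM('f). y i * \<epsilon> i (\<phi> q) F)" "k \<in> {1..DIM('f)}"
  shows "component Y k q = y k"
  unfolding assms(2) by (rule frame_coefficient[OF _ assms(3)]) (use assms(1) image_W in auto)

lemma frame_connection_expands:
  assumes Y: "section_expands W' Y y" and p: "p \<in> W'" "v \<in> tangent_space A p"
  shows "frame_connection p v Y = (\<lambda>F. \<Sum>l=1..DIM('f). (v (y l)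
    + (\<Sum>a=1..DIM('f). \<Sum>b=1..DIM('f). h (\<phi> p) (differential B \<phi> p v) (\<epsilon> a (\<phi> p))
        * y b p * christoffel l a b (\<phi> p))) * \<epsilon> l (\<phi> p) F)"
proof -
  have W': "open W'" "W' \<subseteq> W" using Y by (simp_all add: section_expands_def)
  have c: "component Y k q = y k q" if "k \<in> {1..DIM('f)}" "q \<in> W'" for k q
    by (rule component_lincomb[where q=q and Y=Y and y="\<lambda>i. y i q", OF _ _ that(1)])
      (use that(2) W' Y in \<open>auto simp: section_expands_def\<close>)
  have "v (component Y k) = v (y k)" if "k \<in> {1..DIM('f)}" for k
    by (rule M.tangent_cong[OF p(2) W'(1) p(1) c[OF that]])
  then show ?thesis
    unfolding frame_connection_def
    by (intro ext sum.cong refl arg_cong2[of _ _ _ _ "(*)"] arg_cong2[of _ _ _ _ "(+)"])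
      (simp_all only: c[OF _ p(1)])
qed

lemma section_expands_section:
  assumes "section_expands W' Y y"
  shows "Y \<in> sections_along A B \<phi> W'"
proof (rule sectionI)
  let ?Y = "\<lambda>q F. \<Sum>i=1..DIM('f). y i q * \<epsilon> i (\<phi> q) F"
  note E = assms[unfolded section_expands_def]
  have Y: "?Y \<in> sections_along A B \<phi> W'" by (rule frame_section_lincomb) (use E in auto)
  show "Y p \<in> tangent_space B (\<phi> p)" if "p \<in> W'" for p
    using section_tangent[OF Y that] E that by simp
  show "smooth_on A (W' \<inter> \<phi> -` U) (\<lambda>p. Y p F)" if U: "open U" "smooth_on B U F" for U F
    by (rule M.smooth_on_transform[OF section_smooth[OF Y U]])
      (use E vimage_open[OF U(1)] in auto)
qed

end

section \<open>The Levi-Civita connection as the case of the identity map\<close>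

context framed begin

interpretation id: framed_mapping A A "\<lambda>p. p" g W e W
  by unfold_locales (auto simp: smooth_map_id)

lemma differential_id:
  assumes "v \<in> tangent_space A p"
  shows "differential A (\<lambda>p. p) p v = v"
  using tangent_not_smooth[OF assms] by (auto simp: differential_def comp_def)

lemma expands_section_expands: "expands = id.section_expands"
  unfolding expands_def[abs_def] id.section_expands_def[abs_def] ..

lemma expands_vector_field: "expands W' Y y \<Longrightarrow> Y \<in> vector_fields A W'"
  unfolding vector_fields_def expands_section_expands by (rule id.section_expands_section)

lemma vector_field_expands:
  assumes "open W'" "W' \<subseteq> W" "Y \<in> vector_fields A W'"
  shows "expands W' Y (\<lambda>i q. g q (Y q) (e i q))"
  unfolding expands_def
  using assms component_smooth[OF assms] frame_expand[OF _ vector_field_tangent[OF assms(3)]] by blast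

lemma lie_bracket_expands:
  assumes X: "expands W' X x" and Y: "expands W' Y y" and p: "p \<in> W'"
  shows "lie_bracket A X Y p = (\<lambda>f. \<Sum>l=1..DIM('e). (X p (y l) - Y p (x l)
    + (\<Sum>a=1..DIM('e). \<Sum>b=1..DIM('e). x a p * y b p * structure_coefficient l a b p)) * e l p f)"
  by (rule lie_bracket_components) (use X Y p in \<open>auto simp: expands_def\<close>)

text \<open>As an instance for the identity map it inherits the axioms of a connection; only torsion
  and metric compatibility are left to prove.\<close>

definition levi_civita :: "('a, 'a) conn" where
  "levi_civita = id.frame_connection"

lemma levi_civita_expands:
  assumes "expands W' Y y" "p \<in> W'" "v \<in> tangent_space A p"
  shows "levi_civita p v Y = (\<lambda>f. \<Sum>l=1..DIM('e). (v (y l)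
    + (\<Sum>a=1..DIM('e). \<Sum>b=1..DIM('e). g p v (e a p) * y b p * christoffel l a b p)) * e l p f)"
  using id.frame_connection_expands[OF assms(1)[unfolded expands_section_expands] assms(2,3)]
  unfolding levi_civita_def differential_id[OF assms(3)] .

text \<open>The derivative terms are already those of the bracket. Exchanging the summation indices
  in one of the double sums brings the rest to \<open>christoffel_torsion\<close>.\<close>

lemma levi_civita_torsion_free:
  assumes W': "open W'" "W' \<subseteq> W" and p: "p \<in> W'"
    and X: "X \<in> vector_fields A W'" and Y: "Y \<in> vector_fields A W'"
  shows "(\<lambda>f. levi_civita p (X p) Y f - levi_civita p (Y p) X f) = lie_bracket A X Y p"
proof -
  let ?m = "DIM('e)"
  let ?x = "\<lambda>i q. g q (X q) (e i q)" and ?y = "\<lambda>i q. g q (Y q) (e i q)"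
  have pW: "p \<in> W" using W' p by auto
  note x = vector_field_expands[OF W' X] and y = vector_field_expands[OF W' Y]
  have coeff: "(X p (?y l) + (\<Sum>a=1..?m. \<Sum>b=1..?m. ?x a p * ?y b p * christoffel l a b p))
      - (Y p (?x l) + (\<Sum>a=1..?m. \<Sum>b=1..?m. ?y a p * ?x b p * christoffel l a b p))
      = X p (?y l) - Y p (?x l) + (\<Sum>a=1..?m. \<Sum>b=1..?m. ?x a p * ?y b p * structure_coefficient l a b p)"
    if l: "l \<in> {1..?m}" for l
  proof -
    have "(\<Sum>a=1..?m. \<Sum>b=1..?m. ?y a p * ?x b p * christoffel l a b p)
        = (\<Sum>a=1..?m. \<Sum>b=1..?m. ?y b p * ?x a p * christoffel l b a p)"
      by (rule sum.swap)
    moreover have "(\<Sum>a=1..?m. \<Sum>b=1..?m. ?x a p * ?y b p * structure_coefficient l a b p)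
        = (\<Sum>a=1..?m. \<Sum>b=1..?m. ?x a p * ?y b p * christoffel l a b p - ?y b p * ?x a p * christoffel l b a p)"
      using christoffel_torsion[OF pW _ _ l, symmetric]
      by (intro sum.cong refl) (simp add: right_diff_distrib)
    ultimately show ?thesis by (simp add: sum_subtractf)
  qed
  have Xp: "X p \<in> tangent_space A p" and Yp: "Y p \<in> tangent_space A p"
    using vector_field_tangent[OF X p] vector_field_tangent[OF Y p] by auto
  show ?thesis
    unfolding lie_bracket_expands[OF x y p] levi_civita_expands[OF y p Xp]
      levi_civita_expands[OF x p Yp] sum_subtractf[symmetric] left_diff_distrib[symmetric]
    by (intro ext sum.cong refl arg_cong2[of _ _ _ _ "(*)"] coeff)
qed

text \<open>The Parseval sum, differentiated, gives all derivative terms of the right-hand side; the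
  connection terms cancel because the connection matrices are skew.\<close>

lemma levi_civita_metric:
  assumes W': "open W'" "W' \<subseteq> W" and p: "p \<in> W'" and v: "v \<in> tangent_space A p"
    and X: "X \<in> vector_fields A W'" and Y: "Y \<in> vector_fields A W'"
  shows "v (\<lambda>q. g q (X q) (Y q)) = g p (levi_civita p v X) (Y p) + g p (X p) (levi_civita p v Y)"
proof -
  let ?m = "DIM('e)"
  let ?x = "\<lambda>i q. g q (X q) (e i q)" and ?y = "\<lambda>i q. g q (Y q) (e i q)"
  let ?G = "\<lambda>y l. \<Sum>a=1..?m. \<Sum>b=1..?m. g p v (e a p) * y b p * christoffel l a b p"
  have pW: "p \<in> W" using W' p by auto
  note x = vector_field_expands[OF W' X] and y = vector_field_expands[OF W' Y]
  have Xp: "X p \<in> tangent_space A p" and Yp: "Y p \<in> tangent_space A p"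
    using vector_field_tangent[OF X p] vector_field_tangent[OF Y p] by auto
  have "v (\<lambda>q. g q (X q) (Y q)) = v (\<lambda>q. \<Sum>l=1..?m. ?x l q * ?y l q)"
    by (rule tangent_cong[OF v W'(1) p], rule frame_parseval)
      (use W' in \<open>auto intro: vector_field_tangent[OF X] vector_field_tangent[OF Y]\<close>)
  also have "\<dots> = (\<Sum>l=1..?m. v (?x l) * ?y l p + ?x l p * v (?y l))"
    by (rule tangent_sum_mult[OF v]) (use x y smooth_nearI[OF W'(1) p] in \<open>auto simp: expands_def\<close>)
  finally have 1: "v (\<lambda>q. g q (X q) (Y q)) = (\<Sum>l=1..?m. v (?x l) * ?y l p + ?x l p * v (?y l))" .
  have 2: "g p (levi_civita p v X) (Y p) = (\<Sum>l=1..?m. (v (?x l) + ?G ?x l) * ?y l p)"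
    unfolding levi_civita_expands[OF x p v] by (rule frame_lincomb_metric[OF pW Yp])
  have "g p (X p) (levi_civita p v Y) = g p (levi_civita p v Y) (X p)"
    unfolding levi_civita_expands[OF y p v]
    by (rule metric_sym[OF Xp frame_lincomb_tangent[OF pW]])
  also have "\<dots> = (\<Sum>l=1..?m. (v (?y l) + ?G ?y l) * ?x l p)"
    unfolding levi_civita_expands[OF y p v] by (rule frame_lincomb_metric[OF pW Xp])
  finally have 3: "g p (X p) (levi_civita p v Y) = (\<Sum>l=1..?m. (v (?y l) + ?G ?y l) * ?x l p)" .
  \<comment> \<open>Exchanging the component index \<open>l\<close> with the vector index
    \<open>b\<close> turns the connection terms of \<open>Y\<close> into the negatives of those of
    \<open>X\<close>.\<close>
  have "(\<Sum>l=1..?m. ?G ?y l * ?x l p)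
      = (\<Sum>l=1..?m. \<Sum>b=1..?m. \<Sum>a=1..?m. g p v (e a p) * ?y b p * christoffel l a b p * ?x l p)"
    unfolding sum_distrib_right by (intro sum.cong refl sum.swap)
  also have "\<dots> = (\<Sum>b=1..?m. \<Sum>l=1..?m. \<Sum>a=1..?m. g p v (e a p) * ?y b p * christoffel l a b p * ?x l p)"
    by (rule sum.swap)
  also have "\<dots> = (\<Sum>b=1..?m. \<Sum>l=1..?m. \<Sum>a=1..?m. - (g p v (e a p) * ?x l p * christoffel b a l p * ?y b p))"
  proof (intro sum.cong refl)
    fix b l a assume "b \<in> {1..?m}" "l \<in> {1..?m}" "a \<in> {1..?m}"
    then show "g p v (e a p) * ?y b p * christoffel l a b p * ?x l p
        = - (g p v (e a p) * ?x l p * christoffel b a l p * ?y b p)"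
      using christoffel_antisym[OF pW, of a b l] by simp
  qed
  also have "\<dots> = (\<Sum>b=1..?m. - (?G ?x b * ?y b p))"
    unfolding sum_distrib_right sum_negf[symmetric] by (intro sum.cong refl sum.swap)
  finally have "(\<Sum>l=1..?m. ?G ?y l * ?x l p) = - (\<Sum>l=1..?m. ?G ?x l * ?y l p)"
    by (simp only: sum_negf)
  then show ?thesis
    unfolding 1 2 3 distrib_right sum.distrib by (simp add: mult.commute)
qed

lemma levi_civita_connection_levi_civita: "levi_civita_connection A g W levi_civita"
  unfolding levi_civita_connection_def
proof (intro conjI allI impI ballI)
  show "connection_along A A (\<lambda>p. p) W levi_civita"
    unfolding levi_civita_def by (rule id.connection_along_frame_connection)
qed (blast intro: levi_civita_torsion_free levi_civita_metric)+

text \<open>Koszul's argument: the six equations from torsion-freeness and metricity for the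
  permutations of a triple of indices determine the coefficients.\<close>

lemma levi_civita_connection_frame:
  assumes D: "levi_civita_connection A g U D" and p: "p \<in> U" "p \<in> W"
    and ab: "a \<in> {1..DIM('e)}" "b \<in> {1..DIM('e)}"
  shows "D p (e a p) (e b) = (\<lambda>f. \<Sum>l=1..DIM('e). christoffel l a b p * e l p f)"
proof -
  let ?I = "{1..DIM('e)}"
  have conn: "connection_along A A (\<lambda>p. p) U D" using D by (simp add: levi_civita_connection_def)
  define T where "T = U \<inter> W"
  have T: "open T" "T \<subseteq> U" "p \<in> T" "T \<subseteq> W"
    using id.connection_open[OF conn] p by (auto simp: T_def)
  have ev: "e i \<in> vector_fields A T" if "i \<in> ?I" for i by (rule frame_vector_field[OF that T(4)])
  have tan: "D p (e i p) (e j) \<in> tangent_space A p" if "i \<in> ?I" "j \<in> ?I" for i j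
    using id.section_tangent[OF id.connection_section[OF conn T(1,2), of "e j" "e i"] T(3)] ev that
    by (simp add: vector_fields_def)
  define \<gamma> where "\<gamma> l i j = g p (D p (e i p) (e j)) (e l p)" for l i j
  have torsion: "\<gamma> l i j - \<gamma> l j i = structure_coefficient l i j p"
    if "i \<in> ?I" "j \<in> ?I" "l \<in> ?I" for l i j
  proof -
    have "(\<lambda>f. D p (e i p) (e j) f - D p (e j p) (e i) f) = lie_bracket A (e i) (e j) p"
      using D ev[OF that(1)] ev[OF that(2)] T(1,2,3) unfolding levi_civita_connection_def by blast
    then have "(\<lambda>f. 1 * D p (e i p) (e j) f + (-1) * D p (e j p) (e i) f) = lie_bracket A (e i) (e j) p"
      by simp
    moreover have "g p (\<lambda>f. 1 * D p (e i p) (e j) f + (-1) * D p (e j p) (e i) f) (e l p)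
        = 1 * \<gamma> l i j + (-1) * \<gamma> l j i"
      unfolding \<gamma>_def using metric_bilinear tan that frame_tangent[OF p(2)]
      unfolding bilinear_on_def by blast
    ultimately show ?thesis by (simp add: structure_coefficient_def)
  qed
  have metricity: "\<gamma> l i j + \<gamma> j i l = 0" if "i \<in> ?I" "j \<in> ?I" "l \<in> ?I" for l i j
  proof -
    have t: "e i p \<in> tangent_space A p" using frame_tangent[OF p(2)] that by blast
    have "e i p (\<lambda>q. g q (e j q) (e l q)) = g p (D p (e i p) (e j)) (e l p) + g p (e j p) (D p (e i p) (e l))"
      using D ev[OF that(2)] ev[OF that(3)] T(1,2,3) t unfolding levi_civita_connection_def by blast
    moreover have "e i p (\<lambda>q. g q (e j q) (e l q)) = e i p (\<lambda>q. if j = l then 1 else 0)"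
      by (rule tangent_cong[OF t T(1,3)], rule frame_ortho) (use T that in auto)
    moreover have "g p (e j p) (D p (e i p) (e l)) = \<gamma> j i l"
      unfolding \<gamma>_def by (intro metric_sym frame_tangent[OF p(2)] tan that)
    ultimately show ?thesis using tangent_const[OF t] by (simp add: \<gamma>_def)
  qed
  have "\<gamma> l a b = christoffel l a b p" if l: "l \<in> ?I" for l
    using torsion[OF ab l] torsion[OF ab(2) l ab(1)] torsion[OF l ab(1) ab(2)]
      metricity[OF ab l] metricity[OF ab(2) l ab(1)] metricity[OF l ab(1) ab(2)]
    unfolding christoffel_def by argo
  then show ?thesis
    using frame_expand[OF p(2) tan[OF ab]] unfolding \<gamma>_def by (simp cong: sum.cong del: atLeastAtMost_iff One_nat_def)
qed

text \<open>Linearity in the direction and the expansion of \<open>Y\<close> reduce the claim to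
  derivatives of frame fields along frame fields, which Koszul's argument fixes.\<close>

lemma levi_civita_connection_unique:
  assumes D: "levi_civita_connection A g U D" and p: "p \<in> U" "p \<in> W'" and W': "open W'" "W' \<subseteq> W"
    and v: "v \<in> tangent_space A p" and Y: "Y \<in> vector_fields A W'"
  shows "D p v Y = levi_civita p v Y"
proof -
  let ?m = "DIM('e)"
  have D': "connection_along A A (\<lambda>p. p) U D" using D by (simp add: levi_civita_connection_def)
  define T where "T = U \<inter> W'"
  have T: "open T" "T \<subseteq> U" "p \<in> T" "T \<subseteq> W" "T \<subseteq> W'"
    using id.connection_open[OF D'] p W' by (auto simp: T_def)
  have pW: "p \<in> W" using T by auto
  have sec: "e b \<in> sections_along A A (\<lambda>p. p) T" if "b \<in> {1..?m}" for b
    using frame_vector_field[OF that T(4)] by (simp add: vector_fields_def)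
  have Y': "Y \<in> sections_along A A (\<lambda>p. p) T"
    using vector_field_subset[OF Y T(5)] by (simp add: vector_fields_def)
  \<comment> \<open>Stated for an arbitrary Levi-Civita connection, since it is applied both to
    \<open>D\<close> and to \<open>levi_civita\<close>.\<close>
  have eq: "K p v (e b) = (\<lambda>f. \<Sum>a=1..?m. g p v (e a p) * (\<Sum>l=1..?m. christoffel l a b p * e l p f))"
    if K: "levi_civita_connection A g X K" and X: "T \<subseteq> X" and b: "b \<in> {1..?m}" for K X b
  proof -
    have K': "connection_along A A (\<lambda>p. p) X K" using K by (simp add: levi_civita_connection_def)
    have "K p v (e b) = K p (\<lambda>f. \<Sum>a=1..?m. g p v (e a p) * e a p f) (e b)"
      using frame_expand[OF pW v] by simp
    also have "\<dots> = (\<lambda>f. \<Sum>a=1..?m. g p v (e a p) * K p (e a p) (e b) f)"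
      by (rule id.connection_direction_sum[OF K' T(1) X sec[OF b] T(3)]) (use frame_tangent[OF pW] in auto)
    also have "\<dots> = (\<lambda>f. \<Sum>a=1..?m. g p v (e a p) * (\<Sum>l=1..?m. christoffel l a b p * e l p f))"
      using levi_civita_connection_frame[OF K _ pW _ b] X T(3)
      by (intro ext sum.cong refl arg_cong2[of _ _ _ _ "(*)"]) (auto simp del: atLeastAtMost_iff One_nat_def)
    finally show ?thesis .
  qed
  note L = levi_civita_connection_levi_civita
  have L': "connection_along A A (\<lambda>p. p) W levi_civita" using L by (simp add: levi_civita_connection_def)
  show ?thesis
    unfolding id.connection_components[OF D' T(1,4,2) Y' T(3) v]
      id.connection_components[OF L' T(1,4,4) Y' T(3) v]
    using eq[OF D T(2)] eq[OF L T(4)]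
    by (intro ext sum.cong refl arg_cong2[of _ _ _ _ "(+)"] arg_cong2[of _ _ _ _ "(*)"]) (simp add: comp_def)
qed

text \<open>The description of \<open>nabla\<close> admits connections on any neighbourhood of
  \<open>p\<close>: \<open>levi_civita\<close> on \<open>W\<close> is a witness, and uniqueness
  compares the two connections on the common domain.\<close>

lemma nabla_eq_levi_civita:
  assumes "p \<in> W'" "open W'" "W' \<subseteq> W" "v \<in> tangent_space A p" "Y \<in> vector_fields A W'"
  shows "nabla A g p v Y = levi_civita p v Y"
  unfolding nabla_def
proof (rule the_equality)
  show "\<exists>U D. p \<in> U \<and> levi_civita_connection A g U D \<and> levi_civita p v Y = D p v Y"
    using assms(1,3) levi_civita_connection_levi_civita by blast
  show "w = levi_civita p v Y"
    if "\<exists>U D. p \<in> U \<and> levi_civita_connection A g U D \<and> w = D p v Y" for w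
    using that levi_civita_connection_unique[OF _ _ assms] by blast
qed

lemma nabla_expands:
  assumes Y: "expands W' Y y" and p: "p \<in> W'" "v \<in> tangent_space A p"
  shows "nabla A g p v Y = (\<lambda>f. \<Sum>l=1..DIM('e). (v (y l)
    + (\<Sum>a=1..DIM('e). \<Sum>b=1..DIM('e). g p v (e a p) * y b p * christoffel l a b p)) * e l p f)"
  using nabla_eq_levi_civita[OF p(1) _ _ p(2) expands_vector_field[OF Y]] levi_civita_expands[OF Y p] Y
  by (simp add: expands_def)

end

section \<open>The pull-back connection\<close>

context framed_mapping begin

text \<open>The components of \<open>Y \<circ> \<phi>\<close> are components of \<open>Y\<close>
  composed with \<open>\<phi>\<close>, and \<open>v\<close> of such a composite is the image of
  \<open>v\<close> applied to the component on the target. The two coefficient formulas then agree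
  term by term.\<close>

lemma pullback_connection_frame_connection: "pullback_connection A B h \<phi> W frame_connection"
  unfolding pullback_connection_def
proof (intro conjI ballI allI impI)
  show "connection_along A B \<phi> W frame_connection" by (rule connection_along_frame_connection)
  fix p v U Y
  assume p: "p \<in> W" and v: "v \<in> tangent_space A p" and U: "open U \<and> \<phi> p \<in> U \<and> Y \<in> vector_fields B U"
  let ?n = "DIM('f)" and ?y = "\<lambda>i q. h q (Y q) (\<epsilon> i q)"
  define S where "S = U \<inter> V"
  have S: "open S" "S \<subseteq> V" "\<phi> p \<in> S" using U p image_W by (auto simp: S_def)
  have Y: "Y \<in> vector_fields B S" using U N.vector_field_subset by (auto simp: S_def)
  note y = vector_field_expands[OF S(1,2) Y]
  define T where "T = W \<inter> \<phi> -` S"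
  have T: "open T" "p \<in> T" using open_W vimage_open[OF S(1)] p S(3) by (auto simp: T_def)
  have ysm: "smooth_on B S (?y l)" if "l \<in> {1..?n}" for l using y that by (auto simp: expands_def)
  have "smooth_on A T (\<lambda>q. ?y l (\<phi> q))" if "l \<in> {1..?n}" for l
    using M.smooth_on_subset[OF smooth_on_compose[OF S(1) ysm[OF that]], of T, unfolded comp_def]
    by (simp add: T_def)
  then have Yphi: "section_expands T (Y \<circ> \<phi>) (\<lambda>l q. ?y l (\<phi> q))"
    using T y by (auto simp: section_expands_def expands_def T_def)
  have d: "v (\<lambda>q. ?y l (\<phi> q)) = differential B \<phi> p v (?y l)" if "l \<in> {1..?n}" for l
    using differential_apply[OF N.smooth_nearI[OF S(1,3) ysm[OF that]]] by (simp add: comp_def)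
  show "frame_connection p v (Y \<circ> \<phi>) = nabla B h (\<phi> p) (differential B \<phi> p v) Y"
    unfolding frame_connection_expands[OF Yphi T(2) v] nabla_expands[OF y S(3) differential_tangent[OF v]]
    by (intro ext sum.cong refl arg_cong2[of _ _ _ _ "(*)"] arg_cong2[of _ _ _ _ "(+)"] d)
qed

text \<open>The defining property fixes a pull-back connection on the sections
  \<open>\<epsilon> b \<circ> \<phi>\<close>; additivity and the Leibniz rule determine it on all
  others.\<close>

lemma pullback_nabla_eq_frame_connection:
  assumes p: "p \<in> W'" "open W'" "W' \<subseteq> W" and v: "v \<in> tangent_space A p"
    and Y: "Y \<in> sections_along A B \<phi> W'"
  shows "pullback_nabla A B h \<phi> p v Y = frame_connection p v Y"
  unfolding pullback_nabla_def
proof (rule the_equality)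
  show "\<exists>U D. p \<in> U \<and> pullback_connection A B h \<phi> U D \<and> frame_connection p v Y = D p v Y"
    using p pullback_connection_frame_connection by blast
  fix w assume "\<exists>U D. p \<in> U \<and> pullback_connection A B h \<phi> U D \<and> w = D p v Y"
  then obtain U D where D: "p \<in> U" "pullback_connection A B h \<phi> U D" "w = D p v Y" by blast
  have D': "connection_along A B \<phi> U D" using D(2) by (simp add: pullback_connection_def)
  define T where "T = U \<inter> W'"
  have T: "open T" "T \<subseteq> W" "T \<subseteq> U" "p \<in> T" "T \<subseteq> W'"
    using connection_open[OF D'] p D(1) by (auto simp: T_def)
  have Y': "Y \<in> sections_along A B \<phi> T" by (rule section_subset[OF Y T(5)])
  have eq: "K p v (\<epsilon> b \<circ> \<phi>) = nabla B h (\<phi> p) (differential B \<phi> p v) (\<epsilon> b)"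
    if "pullback_connection A B h \<phi> X K" "p \<in> X" "b \<in> {1..DIM('f)}" for X K b
    using that v open_domain frame_vector_field[OF that(3) order_refl] image_W p
    unfolding pullback_connection_def by blast
  note F = pullback_connection_frame_connection
  have F': "connection_along A B \<phi> W frame_connection" by (rule connection_along_frame_connection)
  show "w = frame_connection p v Y"
    unfolding D(3) connection_components[OF D' T(1,2,3) Y' T(4) v]
      connection_components[OF F' T(1,2,2) Y' T(4) v]
    using eq[OF D(2,1)] eq[OF F] p
    by (intro ext sum.cong refl arg_cong2[of _ _ _ _ "(+)"] arg_cong2[of _ _ _ _ "(*)"]) (auto simp: comp_def)
qed

lemma pullback_nabla_expands:
  assumes Y: "section_expands W' Y y" and p: "p \<in> W'" "v \<in> tangent_space A p"
  shows "pullback_nabla A B h \<phi> p v Y = (\<lambda>F. \<Sum>l=1..DIM('f). (v (y l)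
    + (\<Sum>a=1..DIM('f). \<Sum>b=1..DIM('f). h (\<phi> p) (differential B \<phi> p v) (\<epsilon> a (\<phi> p))
        * y b p * christoffel l a b (\<phi> p))) * \<epsilon> l (\<phi> p) F)"
  using pullback_nabla_eq_frame_connection[OF p(1) _ _ p(2) section_expands_section[OF Y]]
    frame_connection_expands[OF Y p] Y by (simp add: section_expands_def)

end

section \<open>Hessian and curvature in a frame\<close>

text \<open>Passes from grouping by components \<open>l\<close> to grouping by pairs of directions,
  the shape in which a trace can be read off.\<close>

lemma sum_collect:
  fixes E :: "'l \<Rightarrow> 'r::comm_ring_1"
  shows "(\<Sum>l\<in>C. (\<Sum>a\<in>A. \<Sum>b\<in>B. f a b * c l a b) * E l)
    = (\<Sum>a\<in>A. \<Sum>b\<in>B. f a b * (\<Sum>l\<in>C. c l a b * E l))"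
  unfolding sum_distrib_left sum_distrib_right
  by (rule trans[OF sum_rotate3[symmetric]]) (simp only: mult.assoc)

section \<open>Traces, independence of extensions, and the Hessian\<close>

context framed begin

lemma metric_lincomb:
  assumes "p \<in> W" "u \<in> tangent_space A p" "v \<in> tangent_space A p" "k \<in> {1..DIM('e)}"
  shows "g p (\<lambda>f. a * u f + b * v f) (e k p) = a * g p u (e k p) + b * g p v (e k p)"
  using metric_bilinear assms(2,3) frame_tangent[OF assms(1,4)] unfolding bilinear_on_def by blast

text \<open>A formula in frame coefficients yields bilinearity and the diagonal values together, so
  the tensors traced below need no separate proof of bilinearity.\<close>

lemma metric_trace_coefficients:
  assumes p: "p \<in> W"
    and T: "\<And>u v. u \<in> tangent_space A p \<Longrightarrow> v \<in> tangent_space A p \<Longrightarrow>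
      T u v = (\<Sum>a=1..DIM('e). \<Sum>b=1..DIM('e). g p u (e a p) * g p v (e b p) * H a b)"
  shows "metric_trace A g p T = (\<Sum>a=1..DIM('e). H a a)"
proof -
  let ?m = "DIM('e)"
  have "bilinear_on (tangent_space A p) T"
    unfolding bilinear_on_def
  proof (intro ballI allI)
    fix u v w a b
    assume t: "u \<in> tangent_space A p" "v \<in> tangent_space A p" "w \<in> tangent_space A p"
    show "T (\<lambda>f. a * u f + b * v f) w = a * T u w + b * T v w \<and>
      T w (\<lambda>f. a * u f + b * v f) = a * T w u + b * T w v"
      unfolding T[OF t(1,3)] T[OF t(2,3)] T[OF t(3,1)] T[OF t(3,2)]
        T[OF tangent_lincomb[OF t(1,2)] t(3)] T[OF t(3) tangent_lincomb[OF t(1,2)]]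
      by (simp add: metric_lincomb[OF p t(1,2)] sum_distrib_left sum.distrib[symmetric] algebra_simps
          cong: sum.cong del: atLeastAtMost_iff One_nat_def)
  qed
  then have "metric_trace A g p T = (\<Sum>i=1..?m. T (e i p) (e i p))" by (rule frame_metric_trace[OF p])
  also have "\<dots> = (\<Sum>i=1..?m. H i i)"
  proof (intro sum.cong refl)
    fix i assume i: "i \<in> {1..?m}"
    have "T (e i p) (e i p) = (\<Sum>a=1..?m. \<Sum>b=1..?m. g p (e i p) (e a p) * g p (e i p) (e b p) * H a b)"
      by (rule T[OF frame_tangent[OF p i] frame_tangent[OF p i]])
    also have "\<dots> = (\<Sum>a=1..?m. \<Sum>b=1..?m. if i = b then (if i = a then H a b else 0) else 0)"
      by (intro sum.cong refl) (simp add: frame_ortho[OF p i] del: atLeastAtMost_iff One_nat_def)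
    also have "\<dots> = H i i" using i by (simp add: sum.delta')
    finally show "T (e i p) (e i p) = H i i" .
  qed
  finally show ?thesis .
qed

lemma frame_extension:
  assumes "p \<in> W" "w \<in> tangent_space A p"
  obtains Y where "Y \<in> vector_fields A W" "Y p = w"
proof -
  \<comment> \<open>The coefficients are frozen at \<open>p\<close>; only the frame fields
    vary.\<close>
  let ?Y = "\<lambda>q f. \<Sum>i=1..DIM('e). g p w (e i p) * e i q f"
  have "expands W ?Y (\<lambda>i q. g p w (e i p))" by (simp add: expands_def)
  then have "?Y \<in> vector_fields A W" by (rule expands_vector_field)
  then show ?thesis by (rule that) (rule frame_expand[OF assms, symmetric])
qed

text \<open>The common shape of the Hessian, the second fundamental form and the second covariant
  derivative. Restricting to the intersection with \<open>W\<close> leaves only extensions expanded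
  by their own frame components, on which \<open>Z\<close> has to be evaluated.\<close>

lemma the_extension:
  assumes p: "p \<in> W" and w: "w \<in> tangent_space A p"
    and Z: "\<And>W' Y. expands W' Y (\<lambda>i q. g q (Y q) (e i q)) \<Longrightarrow> p \<in> W' \<Longrightarrow> Y p = w \<Longrightarrow> Z Y = R"
  shows "(THE c. \<exists>W Y. open W \<and> p \<in> W \<and> Y \<in> vector_fields A W \<and> Y p = w \<and> c = Z Y) = R"
proof (rule the_equality)
  have *: "Z Y = R" if "open W'" "p \<in> W'" "Y \<in> vector_fields A W'" "Y p = w" for W' Y
    using that p by (intro Z[of "W' \<inter> W"] vector_field_expands) (auto intro: vector_field_subset)
  obtain Y where Y: "Y \<in> vector_fields A W" "Y p = w" using frame_extension[OF p w] .
  then show "\<exists>W Y. open W \<and> p \<in> W \<and> Y \<in> vector_fields A W \<and> Y p = w \<and> R = Z Y"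
    by (intro exI[of _ W] exI[of _ Y] conjI open_domain p *[OF open_domain p, symmetric])
  fix c assume "\<exists>W Y. open W \<and> p \<in> W \<and> Y \<in> vector_fields A W \<and> Y p = w \<and> c = Z Y"
  then show "c = R" by (elim exE conjE) (simp only: *)
qed

lemma derivation_expands:
  assumes Y: "expands W' Y y" and p: "p \<in> W'" and v: "v \<in> tangent_space A p" and f: "smooth_near A p f"
  shows "v (\<lambda>q. Y q f) = (\<Sum>i=1..DIM('e). v (y i) * e i p f)
    + (\<Sum>a=1..DIM('e). \<Sum>b=1..DIM('e). g p v (e a p) * y b p * e a p (\<lambda>q. e b q f))"
  by (rule derivation_lincomb_frame[OF _ _ p frame_expand[OF _ v] _ _ f])
    (use Y p in \<open>auto simp: expands_def\<close>)

text \<open>The derivatives of the coefficients of the extension occur in both terms and cancel, so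
  only its value at \<open>p\<close> survives.\<close>

lemma hessian_frame:
  assumes p: "p \<in> W" and u: "smooth_near A p u" and v: "v \<in> tangent_space A p" "w \<in> tangent_space A p"
  shows "hessian A g u p v w = (\<Sum>a=1..DIM('e). \<Sum>b=1..DIM('e). g p v (e a p) * g p w (e b p) *
    (e a p (\<lambda>q. e b q u) - (\<Sum>l=1..DIM('e). christoffel l a b p * e l p u)))"
  unfolding hessian_def
proof (rule the_extension[OF p v(2)])
  fix W' Y
  let ?m = "DIM('e)" and ?v = "\<lambda>a. g p v (e a p)" and ?w = "\<lambda>b. g p w (e b p)"
  let ?y = "\<lambda>i q. g q (Y q) (e i q)"
  assume Y: "expands W' Y ?y" and p': "p \<in> W'" and w: "Y p = w"
  have "(\<Sum>l=1..?m. (\<Sum>a=1..?m. \<Sum>b=1..?m. ?v a * ?w b * christoffel l a b p) * e l p u)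
      = (\<Sum>a=1..?m. \<Sum>b=1..?m. ?v a * ?w b * (\<Sum>l=1..?m. christoffel l a b p * e l p u))"
    by (rule sum_collect)
  then show "v (\<lambda>q. Y q u) - nabla A g p v Y u = (\<Sum>a=1..?m. \<Sum>b=1..?m. ?v a * ?w b *
    (e a p (\<lambda>q. e b q u) - (\<Sum>l=1..?m. christoffel l a b p * e l p u)))"
    unfolding derivation_expands[OF Y p' v(1) u] nabla_expands[OF Y p' v(1)] w
    by (simp add: distrib_right sum.distrib right_diff_distrib sum_subtractf)
qed

lemma laplacian_frame:
  assumes p: "p \<in> W" and u: "smooth_near A p u"
  shows "laplacian A g u p = (\<Sum>a=1..DIM('e). e a p (\<lambda>q. e a q u)
    - (\<Sum>l=1..DIM('e). christoffel l a a p * e l p u))"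
  unfolding laplacian_def by (rule metric_trace_coefficients[OF p hessian_frame[OF p u]])

text \<open>The coefficient of \<open>e l\<close> in the curvature of \<open>e i\<close>,
  \<open>e j\<close> applied to \<open>e k\<close>; the last sum accounts for frame fields that do
  not commute.\<close>

definition curvature_coefficient :: "nat \<Rightarrow> nat \<Rightarrow> nat \<Rightarrow> nat \<Rightarrow> 'a \<Rightarrow> real" where
  "curvature_coefficient l i j k p = e i p (christoffel l j k) - e j p (christoffel l i k)
    + (\<Sum>m=1..DIM('e). christoffel l i m p * christoffel m j k p - christoffel l j m p * christoffel m i k p)
    - (\<Sum>m=1..DIM('e). structure_coefficient m i j p * christoffel l m k p)"

lemma smooth_near_frame:
  assumes "expands W' Y y" "p \<in> W'" "l \<in> {1..DIM('e)}"
  shows "smooth_near A p (y l)"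
  using assms by (intro smooth_nearI[of W']) (auto simp: expands_def)

lemma christoffel_smooth_near:
  "p \<in> W \<Longrightarrow> i \<in> {1..DIM('e)} \<Longrightarrow> j \<in> {1..DIM('e)} \<Longrightarrow> k \<in> {1..DIM('e)} \<Longrightarrow>
    smooth_near A p (christoffel k i j)"
  by (rule smooth_nearI[OF open_domain _ christoffel_smooth])

text \<open>The connection matrices are skew on all of \<open>W\<close>. Their derivatives and the
  bracket term are linear in them, and the quadratic term is a commutator of skew matrices; so every
  part is skew.\<close>

lemma curvature_coefficient_antisym:
  assumes p: "p \<in> W" and I: "i \<in> {1..DIM('e)}" "j \<in> {1..DIM('e)}" "k \<in> {1..DIM('e)}" "l \<in> {1..DIM('e)}"
  shows "curvature_coefficient l i j k p = - curvature_coefficient k i j l p"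
proof -
  have d: "e a p (christoffel l b k) = - e a p (christoffel k b l)"
    if a: "a \<in> {1..DIM('e)}" and b: "b \<in> {1..DIM('e)}" for a b
  proof -
    have "e a p (christoffel l b k) = e a p (\<lambda>q. - christoffel k b l q)"
      by (rule tangent_cong[OF frame_tangent[OF p a] open_domain p christoffel_antisym[OF _ b I(3,4)]])
    also have "\<dots> = - e a p (christoffel k b l)"
      by (rule tangent_minus[OF frame_tangent[OF p a] christoffel_smooth_near[OF p b I(4,3)]])
    finally show ?thesis .
  qed
  have 1: "(\<Sum>m=1..DIM('e). christoffel l i m p * christoffel m j k p - christoffel l j m p * christoffel m i k p)
      = - (\<Sum>m=1..DIM('e). christoffel k i m p * christoffel m j l p - christoffel k j m p * christoffel m i l p)"
    unfolding sum_negf[symmetric]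
  proof (intro sum.cong refl)
    fix m assume m: "m \<in> {1..DIM('e)}"
    show "christoffel l i m p * christoffel m j k p - christoffel l j m p * christoffel m i k p
      = - (christoffel k i m p * christoffel m j l p - christoffel k j m p * christoffel m i l p)"
      using christoffel_antisym[OF p I(1) m I(4)] christoffel_antisym[OF p I(2) I(3) m]
        christoffel_antisym[OF p I(2) m I(4)] christoffel_antisym[OF p I(1) I(3) m]
      by simp
  qed
  have 2: "(\<Sum>m=1..DIM('e). structure_coefficient m i j p * christoffel l m k p)
      = - (\<Sum>m=1..DIM('e). structure_coefficient m i j p * christoffel k m l p)"
    unfolding sum_negf[symmetric]
    by (intro sum.cong refl) (simp add: christoffel_antisym[OF p _ I(3,4)] del: atLeastAtMost_iff One_nat_def)
  show ?thesis
    unfolding curvature_coefficient_def d[OF I(1,2)] d[OF I(2,1)] 1 2 by simp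
qed

text \<open>Exhibits the covariant derivative as a field with smooth coefficients, ready to be
  differentiated again. The inner sum over \<open>j\<close> is the connection matrix in the
  direction \<open>Y\<close>.\<close>

lemma nabla_expands_along:
  assumes Y: "expands W' Y y" and Z: "expands W' Z z"
  shows "expands W' (\<lambda>q. nabla A g q (Y q) Z)
    (\<lambda>l q. Y q (z l) + (\<Sum>k=1..DIM('e). (\<Sum>j=1..DIM('e). y j q * christoffel l j k q) * z k q))"
  unfolding expands_def
proof (intro conjI ballI)
  let ?m = "DIM('e)"
  show W': "open W'" "W' \<subseteq> W" using Y by (simp_all add: expands_def)
  have sm: "\<forall>i\<in>{1..?m}. smooth_on A W' (y i)" "\<forall>i\<in>{1..?m}. smooth_on A W' (z i)"
    using Y Z by (simp_all add: expands_def)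
  show "smooth_on A W' (\<lambda>q. Y q (z l) + (\<Sum>k=1..?m. (\<Sum>j=1..?m. y j q * christoffel l j k q) * z k q))"
    if l: "l \<in> {1..?m}" for l
    by (intro smooth_on_add smooth_on_sum smooth_on_mult W'(1)
        vector_field_smooth_on[OF expands_vector_field[OF Y] order_refl W'(1) _ order_refl]
        smooth_on_subset[OF christoffel_smooth W'(2)] l sm[rule_format])
  fix q assume q: "q \<in> W'"
  have qW: "q \<in> W" using q W' by auto
  have yq: "g q (Y q) (e j q) = y j q" if "j \<in> {1..?m}" for j
  proof -
    have "Y q = (\<lambda>f. \<Sum>i=1..?m. y i q * e i q f)" using Y q by (simp add: expands_def)
    then show ?thesis using frame_coefficient[OF qW that, of "\<lambda>i. y i q"] by simp
  qed
  have swap: "(\<Sum>a=1..?m. \<Sum>b=1..?m. g q (Y q) (e a q) * z b q * christoffel l a b q)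
      = (\<Sum>k=1..?m. (\<Sum>j=1..?m. y j q * christoffel l j k q) * z k q)" for l
    unfolding sum_distrib_right
    by (rule trans[OF sum.swap], intro sum.cong refl)
      (simp add: yq mult_ac del: atLeastAtMost_iff One_nat_def)
  show "nabla A g q (Y q) Z = (\<lambda>f. \<Sum>l=1..?m.
      (Y q (z l) + (\<Sum>k=1..?m. (\<Sum>j=1..?m. y j q * christoffel l j k q) * z k q)) * e l q f)"
    unfolding nabla_expands[OF Z q vector_field_tangent[OF expands_vector_field[OF Y] q]] swap ..
qed

lemma nabla_vector_field_expands:
  assumes Y: "expands W' Y y" and Z: "expands W' Z z" and p: "p \<in> W'"
  shows "nabla A g p (Y p) Z = (\<lambda>f. \<Sum>l=1..DIM('e). (Y p (z l)
    + (\<Sum>k=1..DIM('e). (\<Sum>j=1..DIM('e). y j p * christoffel l j k p) * z k p)) * e l p f)"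
  using nabla_expands_along[OF Y Z] p by (simp add: expands_def)

lemma tangent_expand_apply:
  "p \<in> W \<Longrightarrow> v \<in> tangent_space A p \<Longrightarrow> v f = (\<Sum>i=1..DIM('e). g p v (e i p) * e i p f)"
  using frame_expand by metis

end

text \<open>The index bookkeeping for \<open>curvature_coefficient\<close> contracted with two
  directions: \<open>E\<close> and \<open>E'\<close> stand for derivatives of connection
  coefficients, \<open>L\<close> and \<open>M\<close> for their products, \<open>c\<close> and
  \<open>N\<close> for the bracket term.\<close>

lemma curvature_sum:
  fixes x y :: "nat \<Rightarrow> real"
  shows "(\<Sum>i\<in>I. \<Sum>j\<in>I. x i * y j * (E i j - E' j i
      + (\<Sum>m\<in>I. L i m * M m j - L j m * M m i) - (\<Sum>m\<in>I. c m i j * N m)))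
    = (\<Sum>j\<in>I. y j * (\<Sum>i\<in>I. x i * E i j)) - (\<Sum>i\<in>I. x i * (\<Sum>j\<in>I. y j * E' j i))
      + (\<Sum>m\<in>I. (\<Sum>i\<in>I. x i * L i m) * (\<Sum>j\<in>I. y j * M m j)
          - (\<Sum>j\<in>I. y j * L j m) * (\<Sum>i\<in>I. x i * M m i))
      - (\<Sum>m\<in>I. (\<Sum>i\<in>I. \<Sum>j\<in>I. x i * y j * c m i j) * N m)"
proof -
  have 1: "(\<Sum>j\<in>I. y j * (\<Sum>i\<in>I. x i * E i j)) = (\<Sum>i\<in>I. \<Sum>j\<in>I. x i * y j * E i j)"
    unfolding sum_distrib_left by (rule trans[OF sum.swap], intro sum.cong refl) (simp add: mult_ac)
  have 2: "(\<Sum>i\<in>I. x i * (\<Sum>j\<in>I. y j * E' j i)) = (\<Sum>i\<in>I. \<Sum>j\<in>I. x i * y j * E' j i)"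
    unfolding sum_distrib_left by (intro sum.cong refl) (simp add: mult_ac)
  have 3: "(\<Sum>m\<in>I. (\<Sum>i\<in>I. x i * L i m) * (\<Sum>j\<in>I. y j * M m j))
      = (\<Sum>i\<in>I. \<Sum>j\<in>I. \<Sum>m\<in>I. x i * y j * (L i m * M m j))"
    unfolding sum_product
    by (rule trans[OF sum_rotate3[symmetric]], intro sum.cong refl) (simp add: mult_ac)
  have 4: "(\<Sum>m\<in>I. (\<Sum>j\<in>I. y j * L j m) * (\<Sum>i\<in>I. x i * M m i))
      = (\<Sum>i\<in>I. \<Sum>j\<in>I. \<Sum>m\<in>I. x i * y j * (L j m * M m i))"
    unfolding sum_product
    by (rule trans[OF sum_rotate3[symmetric]], rule trans[OF sum.swap], intro sum.cong refl) (simp add: mult_ac)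
  have 5: "(\<Sum>m\<in>I. (\<Sum>i\<in>I. \<Sum>j\<in>I. x i * y j * c m i j) * N m)
      = (\<Sum>i\<in>I. \<Sum>j\<in>I. \<Sum>m\<in>I. x i * y j * (c m i j * N m))"
    unfolding sum_distrib_right
    by (rule trans[OF sum_rotate3[symmetric]], intro sum.cong refl) (simp add: mult_ac)
  show ?thesis
    unfolding sum_subtractf 1 2 3 4 5
    by (simp add: sum_subtractf sum.distrib right_diff_distrib distrib_left sum_distrib_left)
qed

context framed begin

text \<open>All derivatives of the coefficients must disappear. Second derivatives of
  \<open>z\<close> cancel against the bracket, first derivatives of \<open>z\<close> are symmetric
  in \<open>X\<close> and \<open>Y\<close>, and derivatives of \<open>x\<close> and \<open>y\<close>
  cancel against the coefficients of the bracket.\<close>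

lemma curvature_expands:
  assumes X: "expands W' X x" and Y: "expands W' Y y" and Z: "expands W' Z z" and p: "p \<in> W'"
  shows "nabla A g p (X p) (\<lambda>q. nabla A g q (Y q) Z) f - nabla A g p (Y p) (\<lambda>q. nabla A g q (X q) Z) f
      - nabla A g p (lie_bracket A X Y p) Z f
    = (\<Sum>l=1..DIM('e). (\<Sum>k=1..DIM('e). (\<Sum>i=1..DIM('e). \<Sum>j=1..DIM('e).
        x i p * y j p * curvature_coefficient l i j k p) * z k p) * e l p f)"
proof -
  let ?m = "DIM('e)" and ?I = "{1..DIM('e)}"
  have W': "open W'" "W' \<subseteq> W" using X by (simp_all add: expands_def)
  have pW: "p \<in> W" using p W' by auto
  \<comment> \<open>\<open>\<Lambda>\<close> is the connection matrix in the direction with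
    coefficients \<open>y\<close>, and \<open>d\<close> below is its derivative along
    \<open>v\<close>.\<close>
  define \<Lambda> where "\<Lambda> y l k q = (\<Sum>j=1..?m. y j q * christoffel l j k q)" for y :: "nat \<Rightarrow> 'a \<Rightarrow> real" and l k q
  define d where "d y v l k = (\<Sum>j=1..?m. v (y j) * christoffel l j k p + y j p * v (christoffel l j k))"
    for y and v :: "'a tvec" and l k
  have sm: "smooth_near A p (\<lambda>q. Y q (z l))"
    "smooth_near A p (\<Lambda> y l k)"
    "v \<in> tangent_space A p \<Longrightarrow> v (\<Lambda> y l k) = d y v l k"
    if "expands W' Y y" "l \<in> ?I" "k \<in> ?I" for Y y l k v
  proof -
    show "smooth_near A p (\<lambda>q. Y q (z l))"
      by (rule smooth_nearI[OF W'(1) p vector_field_smooth_on[OF expands_vector_field[OF that(1)]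
              order_refl W'(1) _ order_refl]])
        (use Z that in \<open>simp add: expands_def\<close>)
    note s = smooth_near_frame[OF that(1) p] christoffel_smooth_near[OF pW _ that(3,2)]
    show "smooth_near A p (\<Lambda> y l k)"
      unfolding \<Lambda>_def by (intro smooth_near_sum smooth_near_mult s)
    show "v (\<Lambda> y l k) = d y v l k" if "v \<in> tangent_space A p"
      unfolding \<Lambda>_def d_def by (rule tangent_sum_mult[OF that s])
  qed
  note zs = smooth_near_frame[OF Z p]
  have second: "nabla A g p (X p) (\<lambda>q. nabla A g q (Y q) Z) f
      = (\<Sum>l=1..?m. (X p (\<lambda>q. Y q (z l)) + (\<Sum>k=1..?m. d y (X p) l k * z k p + \<Lambda> y l k p * X p (z k))
        + (\<Sum>k=1..?m. \<Lambda> x l k p * (Y p (z k) + (\<Sum>j=1..?m. \<Lambda> y k j p * z j p)))) * e l p f)"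
    if X: "expands W' X x" and Y: "expands W' Y y" for X x Y y
  proof -
    have Xp: "X p \<in> tangent_space A p" by (rule vector_field_tangent[OF expands_vector_field[OF X] p])
    have "X p (\<lambda>q. Y q (z l) + (\<Sum>k=1..?m. \<Lambda> y l k q * z k q))
        = X p (\<lambda>q. Y q (z l)) + (\<Sum>k=1..?m. d y (X p) l k * z k p + \<Lambda> y l k p * X p (z k))"
      if l: "l \<in> ?I" for l
    proof -
      have "X p (\<lambda>q. Y q (z l) + (\<Sum>k=1..?m. \<Lambda> y l k q * z k q))
          = X p (\<lambda>q. Y q (z l)) + X p (\<lambda>q. \<Sum>k=1..?m. \<Lambda> y l k q * z k q)"
        by (rule tangent_add[OF Xp sm(1)[OF Y l l]])
          (intro smooth_near_sum smooth_near_mult sm(2)[OF Y l] zs)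
      also have "X p (\<lambda>q. \<Sum>k=1..?m. \<Lambda> y l k q * z k q)
          = (\<Sum>k=1..?m. X p (\<Lambda> y l k) * z k p + \<Lambda> y l k p * X p (z k))"
        by (rule tangent_sum_mult[OF Xp sm(2)[OF Y l] zs])
      also have "\<dots> = (\<Sum>k=1..?m. d y (X p) l k * z k p + \<Lambda> y l k p * X p (z k))"
        by (intro sum.cong refl) (simp add: sm(3)[OF Y l _ Xp] del: atLeastAtMost_iff One_nat_def)
      finally show ?thesis .
    qed
    then show ?thesis
      unfolding nabla_vector_field_expands[OF X nabla_expands_along[OF Y Z] p] \<Lambda>_def[symmetric]
      by (intro sum.cong refl arg_cong2[of _ _ _ _ "(*)"] arg_cong2[of _ _ _ _ "(+)"])
  qed
  have Xp: "X p \<in> tangent_space A p" and Yp: "Y p \<in> tangent_space A p"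
    using vector_field_tangent[OF expands_vector_field[OF X] p]
      vector_field_tangent[OF expands_vector_field[OF Y] p] by auto
  define b where "b a = X p (y a) - Y p (x a)
      + (\<Sum>i=1..?m. \<Sum>j=1..?m. x i p * y j p * structure_coefficient a i j p)" for a
  have br: "lie_bracket A X Y p = (\<lambda>f. \<Sum>a=1..?m. b a * e a p f)"
    unfolding b_def by (rule lie_bracket_expands[OF X Y p])
  have brT: "lie_bracket A X Y p \<in> tangent_space A p"
    unfolding br by (rule frame_lincomb_tangent[OF pW])
  have gb: "g p (lie_bracket A X Y p) (e a p) = b a" if "a \<in> ?I" for a
    unfolding br by (rule frame_coefficient[OF pW that])
  have swap: "(\<Sum>a=1..?m. \<Sum>k=1..?m. g p (lie_bracket A X Y p) (e a p) * z k p * christoffel l a k p)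
      = (\<Sum>k=1..?m. (\<Sum>a=1..?m. b a * christoffel l a k p) * z k p)" for l
    unfolding sum_distrib_right
    by (rule trans[OF sum.swap], intro sum.cong refl) (simp add: gb mult_ac del: atLeastAtMost_iff One_nat_def)
  \<comment> \<open>The bracket acting on \<open>z l\<close> is left as a commutator of iterated
    derivatives so that it cancels against those in \<open>second\<close>; elsewhere its frame
    coefficients \<open>b\<close> are used.\<close>
  have third: "nabla A g p (lie_bracket A X Y p) Z f
      = (\<Sum>l=1..?m. (X p (\<lambda>q. Y q (z l)) - Y p (\<lambda>q. X q (z l))
        + (\<Sum>k=1..?m. (\<Sum>a=1..?m. b a * christoffel l a k p) * z k p)) * e l p f)"
    unfolding nabla_expands[OF Z p brT] swap
    by (intro sum.cong refl arg_cong2[of _ _ _ _ "(*)"] arg_cong2[of _ _ _ _ "(+)"])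
      (simp add: lie_bracket_def zs del: atLeastAtMost_iff One_nat_def)
  \<comment> \<open>The derivatives of \<open>x\<close> and \<open>y\<close> in the two matrices
    \<open>d\<close> are exactly those in \<open>b\<close>; what is left is the contraction of the
    curvature coefficients.\<close>
  have coeff: "(\<Sum>i=1..?m. \<Sum>j=1..?m. x i p * y j p * curvature_coefficient l i j k p)
      = d y (X p) l k - d x (Y p) l k + (\<Sum>m=1..?m. \<Lambda> x l m p * \<Lambda> y m k p - \<Lambda> y l m p * \<Lambda> x m k p)
        - (\<Sum>a=1..?m. b a * christoffel l a k p)" for l k
  proof -
    have Xc: "X p c = (\<Sum>i=1..?m. x i p * e i p c)" and Yc: "Y p c = (\<Sum>i=1..?m. y i p * e i p c)" for c
      using X Y p by (simp_all add: expands_def)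
    have dd: "d y (X p) l k - d x (Y p) l k = (\<Sum>a=1..?m. (X p (y a) - Y p (x a)) * christoffel l a k p)
        + ((\<Sum>j=1..?m. y j p * X p (christoffel l j k)) - (\<Sum>j=1..?m. x j p * Y p (christoffel l j k)))"
      unfolding d_def by (simp add: sum.distrib sum_subtractf left_diff_distrib)
    have bb: "(\<Sum>a=1..?m. b a * christoffel l a k p) = (\<Sum>a=1..?m. (X p (y a) - Y p (x a)) * christoffel l a k p)
        + (\<Sum>a=1..?m. (\<Sum>i=1..?m. \<Sum>j=1..?m. x i p * y j p * structure_coefficient a i j p) * christoffel l a k p)"
      unfolding b_def distrib_right sum.distrib ..
    show ?thesis
      unfolding dd bb curvature_coefficient_def \<Lambda>_def Xc[of "christoffel _ _ _"] Yc[of "christoffel _ _ _"]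
        curvature_sum[where I="?I" and E="\<lambda>i j. e i p (christoffel l j k)" and E'="\<lambda>j i. e j p (christoffel l i k)"
          and L="\<lambda>i m. christoffel l i m p" and M="\<lambda>m j. christoffel m j k p" and c="\<lambda>m i j. structure_coefficient m i j p"]
      by simp
  qed
  show ?thesis
    unfolding second[OF X Y] second[OF Y X] third sum_subtractf[symmetric] left_diff_distrib[symmetric]
  proof (intro sum.cong refl arg_cong2[of _ _ _ _ "(*)"])
    fix l assume l: "l \<in> ?I"
    have LL: "(\<Sum>k=1..?m. \<Lambda> x l k p * (\<Sum>j=1..?m. \<Lambda> y k j p * z j p))
        = (\<Sum>k=1..?m. (\<Sum>m=1..?m. \<Lambda> x l m p * \<Lambda> y m k p) * z k p)" for x y
      unfolding sum_distrib_left sum_distrib_right by (rule trans[OF sum.swap]) (simp only: mult.assoc)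
    show "X p (\<lambda>q. Y q (z l)) + (\<Sum>k=1..?m. d y (X p) l k * z k p + \<Lambda> y l k p * X p (z k))
        + (\<Sum>k=1..?m. \<Lambda> x l k p * (Y p (z k) + (\<Sum>j=1..?m. \<Lambda> y k j p * z j p)))
        - (Y p (\<lambda>q. X q (z l)) + (\<Sum>k=1..?m. d x (Y p) l k * z k p + \<Lambda> x l k p * Y p (z k))
        + (\<Sum>k=1..?m. \<Lambda> y l k p * (X p (z k) + (\<Sum>j=1..?m. \<Lambda> x k j p * z j p))))
        - (X p (\<lambda>q. Y q (z l)) - Y p (\<lambda>q. X q (z l)) + (\<Sum>k=1..?m. (\<Sum>a=1..?m. b a * christoffel l a k p) * z k p))
      = (\<Sum>k=1..?m. (\<Sum>i=1..?m. \<Sum>j=1..?m. x i p * y j p * curvature_coefficient l i j k p) * z k p)"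
      unfolding coeff distrib_left sum.distrib LL left_diff_distrib distrib_right sum_subtractf by simp
  qed
qed

text \<open>Three extensions vary at once here. By \<open>curvature_expands\<close> the expression
  depends only on their coefficients at \<open>p\<close>, which settles the description.\<close>

lemma curvature_frame:
  assumes p: "p \<in> W" and t: "u \<in> tangent_space A p" "v \<in> tangent_space A p" "w \<in> tangent_space A p"
  shows "curvature A g p u v w = (\<lambda>f. \<Sum>l=1..DIM('e). (\<Sum>k=1..DIM('e). (\<Sum>i=1..DIM('e). \<Sum>j=1..DIM('e).
      g p u (e i p) * g p v (e j p) * curvature_coefficient l i j k p) * g p w (e k p)) * e l p f)" (is "_ = ?R")
  unfolding curvature_def
proof (rule the_equality)
  have val: "(\<lambda>f. nabla A g p (X p) (\<lambda>q. nabla A g q (Y q) Z) f - nabla A g p (Y p) (\<lambda>q. nabla A g q (X q) Z) f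
      - nabla A g p (lie_bracket A X Y p) Z f) = ?R"
    if "open W'" "p \<in> W'" "X \<in> vector_fields A W'" "Y \<in> vector_fields A W'" "Z \<in> vector_fields A W'"
      "X p = u" "Y p = v" "Z p = w" for W' X Y Z
  proof -
    have o: "open (W' \<inter> W)" "W' \<inter> W \<subseteq> W" "W' \<inter> W \<subseteq> W'" "p \<in> W' \<inter> W" using that p by auto
    have ex: "expands (W' \<inter> W) Y (\<lambda>i q. g q (Y q) (e i q))" if "Y \<in> vector_fields A W'" for Y
      by (rule vector_field_expands[OF o(1,2) vector_field_subset[OF that o(3)]])
    show ?thesis
      unfolding that(6-8)[symmetric]
      by (rule ext, rule curvature_expands[OF ex[OF that(3)] ex[OF that(4)] ex[OF that(5)] o(4)])
  qed
  obtain X Y Z where XYZ: "X \<in> vector_fields A W" "X p = u" "Y \<in> vector_fields A W" "Y p = v"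
    "Z \<in> vector_fields A W" "Z p = w"
    by (rule frame_extension[OF p t(1)], rule frame_extension[OF p t(2)], rule frame_extension[OF p t(3)])
  show "\<exists>W X Y Z. open W \<and> p \<in> W \<and> X \<in> vector_fields A W \<and> Y \<in> vector_fields A W \<and> Z \<in> vector_fields A W \<and>
      X p = u \<and> Y p = v \<and> Z p = w \<and> ?R = (\<lambda>f. nabla A g p (X p) (\<lambda>q. nabla A g q (Y q) Z) f
        - nabla A g p (Y p) (\<lambda>q. nabla A g q (X q) Z) f - nabla A g p (lie_bracket A X Y p) Z f)"
    by (intro exI[of _ W] exI[of _ X] exI[of _ Y] exI[of _ Z] conjI open_domain p XYZ
        val[OF open_domain p XYZ(1,3,5,2,4,6), symmetric])
  fix r assume "\<exists>W X Y Z. open W \<and> p \<in> W \<and> X \<in> vector_fields A W \<and> Y \<in> vector_fields A W \<and> Z \<in> vector_fields A W \<and>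
      X p = u \<and> Y p = v \<and> Z p = w \<and> r = (\<lambda>f. nabla A g p (X p) (\<lambda>q. nabla A g q (Y q) Z) f
        - nabla A g p (Y p) (\<lambda>q. nabla A g q (X q) Z) f - nabla A g p (lie_bracket A X Y p) Z f)"
  then show "r = ?R"
  proof (elim exE conjE)
    fix W' X Y Z
    assume "r = (\<lambda>f. nabla A g p (X p) (\<lambda>q. nabla A g q (Y q) Z) f
        - nabla A g p (Y p) (\<lambda>q. nabla A g q (X q) Z) f - nabla A g p (lie_bracket A X Y p) Z f)"
      and "open W'" "p \<in> W'" "X \<in> vector_fields A W'" "Y \<in> vector_fields A W'" "Z \<in> vector_fields A W'"
        "X p = u" "Y p = v" "Z p = w"
    from this(1) val[OF this(2-9)] show "r = ?R" by (rule trans)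
  qed
qed

lemma ricci_frame:
  assumes p: "p \<in> W" and t: "u \<in> tangent_space A p" "v \<in> tangent_space A p"
  shows "ricci A g p u v = (\<Sum>i=1..DIM('e). \<Sum>k=1..DIM('e). \<Sum>j=1..DIM('e).
      g p u (e j p) * g p v (e k p) * curvature_coefficient i i j k p)"
  unfolding ricci_def
proof (rule metric_trace_coefficients[OF p, where H="\<lambda>i l. \<Sum>k=1..DIM('e). \<Sum>j=1..DIM('e).
      g p u (e j p) * g p v (e k p) * curvature_coefficient l i j k p"])
  let ?m = "DIM('e)"
  fix a b assume ab: "a \<in> tangent_space A p" "b \<in> tangent_space A p"
  have "g p (curvature A g p a u v) b = (\<Sum>l=1..?m. (\<Sum>k=1..?m. (\<Sum>i=1..?m. \<Sum>j=1..?m.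
      g p a (e i p) * g p u (e j p) * curvature_coefficient l i j k p) * g p v (e k p)) * g p b (e l p))"
    unfolding curvature_frame[OF p ab(1) t] by (rule frame_lincomb_metric[OF p ab(2)])
  also have "\<dots> = (\<Sum>l=1..?m. \<Sum>i=1..?m. g p a (e i p) * g p b (e l p) * (\<Sum>k=1..?m. \<Sum>j=1..?m.
      g p u (e j p) * g p v (e k p) * curvature_coefficient l i j k p))"
    unfolding sum_distrib_right sum_distrib_left
    by (rule sum.cong[OF refl], rule trans[OF sum.swap], intro sum.cong refl) (simp only: mult_ac)
  also have "\<dots> = (\<Sum>i=1..?m. \<Sum>l=1..?m. g p a (e i p) * g p b (e l p) * (\<Sum>k=1..?m. \<Sum>j=1..?m.
      g p u (e j p) * g p v (e k p) * curvature_coefficient l i j k p))"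
    by (rule sum.swap)
  finally show "g p (curvature A g p a u v) b = (\<Sum>i=1..?m. \<Sum>l=1..?m. g p a (e i p) * g p b (e l p) * (\<Sum>k=1..?m. \<Sum>j=1..?m.
      g p u (e j p) * g p v (e k p) * curvature_coefficient l i j k p))" .
qed

end

section \<open>The bitension field in adapted frames\<close>

locale adapted_frames = framed_mapping A B \<phi> h V \<epsilon> W + src: framed A g W e
  for A :: "('a::{t2_space,second_countable_topology}, 'e::euclidean_space) atlas"
    and B :: "('b::{t2_space,second_countable_topology}, 'f::euclidean_space) atlas"
    and \<phi> :: "'a \<Rightarrow> 'b" and h V \<epsilon> W g e +
  assumes dims: "DIM('e) = DIM('f) + 1"
    and differential_vertical: "p \<in> W \<Longrightarrow> differential B \<phi> p (e (DIM('f) + 1) p) = (\<lambda>F. 0)"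
    and differential_horizontal:
      "p \<in> W \<Longrightarrow> i \<in> {1..DIM('f)} \<Longrightarrow> differential B \<phi> p (e i p) = \<epsilon> i (\<phi> p)"
begin

lemma index_le: "i \<in> {1..DIM('f)} \<Longrightarrow> i \<in> {1..DIM('e)}"
  by (simp add: dims)

lemma sum_top: "(\<Sum>i=1..DIM('e). k i) = (\<Sum>i=1..DIM('f). k i) + k (DIM('f) + 1)"
  unfolding dims by simp

text \<open>Allows sums over the frame of the target to be merged with sums over the frame of the
  source, the vertical index contributing 0.\<close>

lemma sum_extend: "(\<Sum>i=1..DIM('f). k i) = (\<Sum>i=1..DIM('e). if i \<le> DIM('f) then k i else 0)"
  unfolding sum_top by simp

lemma sum_extend2:
  "(\<Sum>a=1..DIM('f). \<Sum>b=1..DIM('f). k a b)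
    = (\<Sum>a=1..DIM('e). \<Sum>b=1..DIM('e). if a \<le> DIM('f) \<and> b \<le> DIM('f) then k a b else 0)"
  unfolding sum_top by simp

lemma differential_frame:
  assumes "p \<in> W"
  shows "differential B \<phi> p (\<lambda>f. \<Sum>i=1..DIM('e). c i * e i p f) = (\<lambda>F. \<Sum>i=1..DIM('f). c i * \<epsilon> i (\<phi> p) F)"
  unfolding differential_sum unfolding sum_top differential_vertical[OF assms]
  by (simp add: differential_horizontal[OF assms] cong: sum.cong del: atLeastAtMost_iff One_nat_def)

lemma image_in_V: "p \<in> W \<Longrightarrow> \<phi> p \<in> V"
  using image_W by auto

text \<open>Both frames are orthonormal and related by \<open>\<phi>\<close>, so the differential
  merely drops the vertical component.\<close>

lemma differential_component:
  assumes p: "p \<in> W" and v: "v \<in> tangent_space A p" and b: "b \<in> {1..DIM('f)}"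
  shows "h (\<phi> p) (differential B \<phi> p v) (\<epsilon> b (\<phi> p)) = g p v (e b p)"
proof -
  have "differential B \<phi> p v = (\<lambda>F. \<Sum>i=1..DIM('f). g p v (e i p) * \<epsilon> i (\<phi> p) F)"
    using differential_frame[OF p, of "\<lambda>i. g p v (e i p)"] src.frame_expand[OF p v] by simp
  then show ?thesis
    using frame_coefficient[OF image_in_V[OF p] b, of "\<lambda>i. g p v (e i p)"] by simp
qed

lemma differential_expands:
  assumes "src.expands W' Y y"
  shows "section_expands W' (\<lambda>q. differential B \<phi> q (Y q)) y"
  unfolding section_expands_def
proof (intro conjI ballI)
  show "open W'" "W' \<subseteq> W" using assms by (simp_all add: src.expands_def)
  show "smooth_on A W' (y i)" if "i \<in> {1..DIM('f)}" for i
    using assms index_le[OF that] by (simp add: src.expands_def)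
  fix q assume "q \<in> W'"
  then have "q \<in> W" "Y q = (\<lambda>f. \<Sum>i=1..DIM('e). y i q * e i q f)"
    using assms by (auto simp: src.expands_def)
  then show "differential B \<phi> q (Y q) = (\<lambda>F. \<Sum>i=1..DIM('f). y i q * \<epsilon> i (\<phi> q) F)"
    using differential_frame[of q "\<lambda>i. y i q"] by simp
qed

text \<open>Both derivatives contain \<open>v\<close> applied to the same coefficients, which
  cancels. The difference of the two families of connection coefficients remains, that of the target
  being extended by 0 to the vertical index.\<close>

lemma second_fundamental_form_frame:
  assumes p: "p \<in> W" and t: "v \<in> tangent_space A p" "w \<in> tangent_space A p"
  shows "second_fundamental_form A g B h \<phi> p v w = (\<lambda>F. \<Sum>a=1..DIM('e). \<Sum>b=1..DIM('e).
    g p v (e a p) * g p w (e b p) * (\<Sum>l=1..DIM('f).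
      ((if a \<le> DIM('f) \<and> b \<le> DIM('f) then christoffel l a b (\<phi> p) else 0) - src.christoffel l a b p)
        * \<epsilon> l (\<phi> p) F))"
  unfolding second_fundamental_form_def
proof (rule src.the_extension[OF p t(2)])
  fix W' Y
  let ?m = "DIM('e)" and ?n = "DIM('f)" and ?y = "\<lambda>i q. g q (Y q) (e i q)"
  let ?v = "\<lambda>a. g p v (e a p)" and ?w = "\<lambda>a. g p w (e a p)"
  assume Y: "src.expands W' Y ?y" and p': "p \<in> W'" and w: "Y p = w"
  have 1: "pullback_nabla A B h \<phi> p v (\<lambda>q. differential B \<phi> q (Y q)) = (\<lambda>F. \<Sum>l=1..?n. (v (?y l)
      + (\<Sum>a=1..?n. \<Sum>b=1..?n. ?v a * ?w b * christoffel l a b (\<phi> p))) * \<epsilon> l (\<phi> p) F)"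
    unfolding pullback_nabla_expands[OF differential_expands[OF Y] p' t(1)] w
    by (simp add: differential_component[OF p t(1)] cong: sum.cong del: atLeastAtMost_iff One_nat_def)
  have 2: "differential B \<phi> p (nabla A g p v Y) = (\<lambda>F. \<Sum>l=1..?n. (v (?y l)
      + (\<Sum>a=1..?m. \<Sum>b=1..?m. ?v a * ?w b * src.christoffel l a b p)) * \<epsilon> l (\<phi> p) F)"
    unfolding src.nabla_expands[OF Y p' t(1)] w differential_frame[OF p] ..
  have 3: "(\<Sum>a=1..?n. \<Sum>b=1..?n. ?v a * ?w b * christoffel l a b (\<phi> p))
      - (\<Sum>a=1..?m. \<Sum>b=1..?m. ?v a * ?w b * src.christoffel l a b p)
    = (\<Sum>a=1..?m. \<Sum>b=1..?m. ?v a * ?w b * ((if a \<le> ?n \<and> b \<le> ?n then christoffel l a b (\<phi> p) else 0)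
        - src.christoffel l a b p))" for l
    unfolding sum_extend2 sum_subtractf[symmetric] right_diff_distrib by (intro sum.cong refl) simp
  show "(\<lambda>F. pullback_nabla A B h \<phi> p v (\<lambda>q. differential B \<phi> q (Y q)) F
      - differential B \<phi> p (nabla A g p v Y) F)
    = (\<lambda>F. \<Sum>a=1..?m. \<Sum>b=1..?m. ?v a * ?w b * (\<Sum>l=1..?n.
      ((if a \<le> ?n \<and> b \<le> ?n then christoffel l a b (\<phi> p) else 0) - src.christoffel l a b p)
        * \<epsilon> l (\<phi> p) F))"
    unfolding 1 2 sum_collect[symmetric] 3[symmetric] sum_subtractf[symmetric] left_diff_distrib[symmetric]
    by simp
qed

lemma tension_field_frame:
  assumes p: "p \<in> W"
  shows "tension_field A g B h \<phi> p = (\<lambda>F. \<Sum>l=1..DIM('f).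
    ((\<Sum>i=1..DIM('f). christoffel l i i (\<phi> p)) - (\<Sum>a=1..DIM('e). src.christoffel l a a p)) * \<epsilon> l (\<phi> p) F)"
proof
  fix F
  let ?m = "DIM('e)" and ?n = "DIM('f)"
  have "tension_field A g B h \<phi> p F = (\<Sum>a=1..?m. \<Sum>l=1..?n.
      ((if a \<le> ?n \<and> a \<le> ?n then christoffel l a a (\<phi> p) else 0) - src.christoffel l a a p) * \<epsilon> l (\<phi> p) F)"
    unfolding tension_field_def metric_trace_vec_def
    by (rule src.metric_trace_coefficients[OF p, where H="\<lambda>a b. \<Sum>l=1..?n.
      ((if a \<le> ?n \<and> b \<le> ?n then christoffel l a b (\<phi> p) else 0) - src.christoffel l a b p) * \<epsilon> l (\<phi> p) F"])
      (simp only: second_fundamental_form_frame[OF p])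
  also have "\<dots> = (\<Sum>l=1..?n. \<Sum>a=1..?m.
      ((if a \<le> ?n then christoffel l a a (\<phi> p) else 0) - src.christoffel l a a p) * \<epsilon> l (\<phi> p) F)"
    by (rule trans[OF sum.swap]) simp
  also have "\<dots> = (\<Sum>l=1..?n.
      ((\<Sum>i=1..?n. christoffel l i i (\<phi> p)) - (\<Sum>a=1..?m. src.christoffel l a a p)) * \<epsilon> l (\<phi> p) F)"
    unfolding sum_distrib_right[symmetric] sum_subtractf sum_extend[of "\<lambda>i. christoffel _ i i (\<phi> p)"] ..
  finally show "tension_field A g B h \<phi> p F = (\<Sum>l=1..?n.
      ((\<Sum>i=1..?n. christoffel l i i (\<phi> p)) - (\<Sum>a=1..?m. src.christoffel l a a p)) * \<epsilon> l (\<phi> p) F)" .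
qed

text \<open>The \<open>l\<close>-th coefficient of the covariant derivative along \<open>e a\<close> of the section
  \<open>\<Sum>l. t l * (\<epsilon> l \<circ> \<phi>)\<close>.\<close>

definition cov :: "(nat \<Rightarrow> 'a \<Rightarrow> real) \<Rightarrow> nat \<Rightarrow> nat \<Rightarrow> 'a \<Rightarrow> real" where
  "cov t a l q = e a q (t l)
    + (if a \<le> DIM('f) then \<Sum>c=1..DIM('f). t c q * christoffel l a c (\<phi> q) else 0)"

lemma christoffel_compose_smooth:
  "i \<in> {1..DIM('f)} \<Longrightarrow> j \<in> {1..DIM('f)} \<Longrightarrow> k \<in> {1..DIM('f)} \<Longrightarrow> W' \<subseteq> W \<Longrightarrow>
    smooth_on A W' (\<lambda>q. christoffel k i j (\<phi> q))"
  by (rule smooth_on_W_compose[OF christoffel_smooth])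

lemma cov_smooth:
  assumes W': "open W'" "W' \<subseteq> W" and t: "\<And>l. l \<in> {1..DIM('f)} \<Longrightarrow> smooth_on A W' (t l)"
    and "a \<in> {1..DIM('e)}" and l: "l \<in> {1..DIM('f)}"
  shows "smooth_on A W' (cov t a l)"
proof -
  have 1: "smooth_on A W' (\<lambda>q. e a q (t l))"
    by (rule M.vector_field_smooth_on[OF src.frame_vector_field[OF assms(4) W'(2)] order_refl W'(1) t[OF l] order_refl])
  show ?thesis
  proof (cases "a \<le> DIM('f)")
    case True
    then have a: "a \<in> {1..DIM('f)}" using assms(4) by simp
    have "smooth_on A W' (\<lambda>q. e a q (t l) + (\<Sum>c=1..DIM('f). t c q * christoffel l a c (\<phi> q)))"
      by (intro M.smooth_on_add M.smooth_on_sum M.smooth_on_mult W'(1) 1 t christoffel_compose_smooth a l W'(2))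
    then show ?thesis using True by (simp add: cov_def[abs_def])
  next
    case False
    then show ?thesis using 1 by (simp add: cov_def[abs_def])
  qed
qed

text \<open>The vertical frame field has image 0, hence only differentiates the coefficients; this
  is the case distinction in \<open>cov\<close>.\<close>

lemma pullback_nabla_cov:
  assumes S: "section_expands W' S t" and p: "p \<in> W'" and u: "u \<in> tangent_space A p"
  shows "pullback_nabla A B h \<phi> p u S
    = (\<lambda>F. \<Sum>l=1..DIM('f). (\<Sum>d=1..DIM('e). g p u (e d p) * cov t d l p) * \<epsilon> l (\<phi> p) F)"
proof -
  let ?m = "DIM('e)" and ?n = "DIM('f)"
  have pW: "p \<in> W" using S p by (auto simp: section_expands_def)
  have "u (t l) + (\<Sum>a=1..?n. \<Sum>b=1..?n. h (\<phi> p) (differential B \<phi> p u) (\<epsilon> a (\<phi> p)) * t b p * christoffel l a b (\<phi> p))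
      = (\<Sum>d=1..?m. g p u (e d p) * cov t d l p)" for l
  proof -
    have "(\<Sum>a=1..?n. \<Sum>b=1..?n. h (\<phi> p) (differential B \<phi> p u) (\<epsilon> a (\<phi> p)) * t b p * christoffel l a b (\<phi> p))
      = (\<Sum>a=1..?n. g p u (e a p) * (\<Sum>b=1..?n. t b p * christoffel l a b (\<phi> p)))"
      unfolding sum_distrib_left
      by (intro sum.cong refl) (simp add: differential_component[OF pW u] del: atLeastAtMost_iff One_nat_def)
    also have "\<dots> = (\<Sum>d=1..?m. g p u (e d p) * (if d \<le> ?n then \<Sum>b=1..?n. t b p * christoffel l d b (\<phi> p) else 0))"
      unfolding sum_extend[of "\<lambda>a. g p u (e a p) * _ a"] by (intro sum.cong refl) simp
    finally show ?thesis
      using src.tangent_expand_apply[OF pW u, of "t l"] by (simp add: cov_def distrib_left sum.distrib)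
  qed
  then show ?thesis unfolding pullback_nabla_expands[OF S p u] by simp
qed

text \<open>The Leibniz rule for \<open>cov\<close>, needed because the coefficients of a derivative
  along a field \<open>Y\<close> are combinations with the components of \<open>Y\<close>.\<close>

lemma cov_lincomb:
  assumes p: "p \<in> W" and y: "\<And>b. b \<in> {1..DIM('e)} \<Longrightarrow> smooth_near A p (y b)"
    and z: "\<And>b. b \<in> {1..DIM('e)} \<Longrightarrow> smooth_near A p (z b l)"
    and d: "d \<in> {1..DIM('e)}"
  shows "cov (\<lambda>l q. \<Sum>b=1..DIM('e). y b q * z b l q) d l p
    = (\<Sum>b=1..DIM('e). e d p (y b) * z b l p + y b p * cov (z b) d l p)"
proof -
  let ?m = "DIM('e)" and ?n = "DIM('f)"
  have 1: "e d p (\<lambda>q. \<Sum>b=1..?m. y b q * z b l q) = (\<Sum>b=1..?m. e d p (y b) * z b l p + y b p * e d p (z b l))"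
    by (rule M.tangent_sum_mult[OF src.frame_tangent[OF p d] y z])
  have "(\<Sum>c=1..?n. (\<Sum>b=1..?m. y b p * z b c p) * christoffel l d c (\<phi> p))
      = (\<Sum>b=1..?m. y b p * (\<Sum>c=1..?n. z b c p * christoffel l d c (\<phi> p)))"
    unfolding sum_distrib_left sum_distrib_right
    by (rule trans[OF sum.swap]) (simp only: mult.assoc)
  then show ?thesis
    unfolding cov_def 1 by (simp add: sum.distrib distrib_left)
qed

lemma pullback_nabla_section:
  assumes S: "section_expands W' S t" and Y: "src.expands W' Y (\<lambda>i q. g q (Y q) (e i q))"
  shows "section_expands W' (\<lambda>q. pullback_nabla A B h \<phi> q (Y q) S)
    (\<lambda>l q. \<Sum>b=1..DIM('e). g q (Y q) (e b q) * cov t b l q)"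
  unfolding section_expands_def
proof (intro conjI ballI)
  show W': "open W'" "W' \<subseteq> W" using S by (simp_all add: section_expands_def)
  have "smooth_on A W' (t l)" if "l \<in> {1..DIM('f)}" for l
    using S that by (simp add: section_expands_def)
  moreover have "smooth_on A W' (\<lambda>q. g q (Y q) (e b q))" if "b \<in> {1..DIM('e)}" for b
    using Y that by (simp add: src.expands_def)
  ultimately show "smooth_on A W' (\<lambda>q. \<Sum>b=1..DIM('e). g q (Y q) (e b q) * cov t b l q)"
    if "l \<in> {1..DIM('f)}" for l
    by (intro M.smooth_on_sum M.smooth_on_mult cov_smooth W' that)
  show "pullback_nabla A B h \<phi> q (Y q) S = (\<lambda>F. \<Sum>l=1..DIM('f).
      (\<Sum>b=1..DIM('e). g q (Y q) (e b q) * cov t b l q) * \<epsilon> l (\<phi> q) F)" if "q \<in> W'" for q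
    by (rule pullback_nabla_cov[OF S that M.vector_field_tangent[OF src.expands_vector_field[OF Y] that]])
qed

text \<open>The terms with derivatives of the components of the extension come once from the
  iterated derivative and once from the derivative along \<open>nabla A g p v Y\<close>; their
  cancellation is what makes the expression a tensor.\<close>

lemma second_covariant_derivative_frame:
  assumes S: "section_expands W\<^sub>0 S t" and p: "p \<in> W\<^sub>0"
    and tan: "v \<in> tangent_space A p" "w \<in> tangent_space A p"
  shows "second_covariant_derivative A g B h \<phi> S p v w = (\<lambda>F. \<Sum>a=1..DIM('e). \<Sum>b=1..DIM('e).
    g p v (e a p) * g p w (e b p) * (\<Sum>l=1..DIM('f).
      (cov (cov t b) a l p - (\<Sum>d=1..DIM('e). src.christoffel d a b p * cov t d l p)) * \<epsilon> l (\<phi> p) F))"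
proof -
  let ?m = "DIM('e)" and ?n = "DIM('f)"
  let ?v = "\<lambda>a. g p v (e a p)" and ?w = "\<lambda>a. g p w (e a p)"
  have pW: "p \<in> W" using S p by (auto simp: section_expands_def)
  show ?thesis
    unfolding second_covariant_derivative_def
  proof (rule src.the_extension[OF pW tan(2)])
    fix W' Y
    let ?y = "\<lambda>i q. g q (Y q) (e i q)"
    assume Y': "src.expands W' Y ?y" and p': "p \<in> W'" and w: "Y p = w"
    \<comment> \<open>The section and the extension are expanded on different neighbourhoods of
      \<open>p\<close>.\<close>
    define T where "T = W' \<inter> W\<^sub>0"
    have S: "section_expands T S t" and Y: "src.expands T Y ?y" and T: "open T" "T \<subseteq> W" "p \<in> T"
      using S Y' p p' M.smooth_on_subset[of _ _ T] by (auto simp: section_expands_def src.expands_def T_def)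
    have tsm: "smooth_on A T (t l)" if "l \<in> {1..?n}" for l
      using S that by (simp add: section_expands_def)
    define u where "u = nabla A g p v Y"
    have u: "u = (\<lambda>f. \<Sum>l=1..?m. (v (?y l) + (\<Sum>a=1..?m. \<Sum>b=1..?m. ?v a * ?w b * src.christoffel l a b p)) * e l p f)"
      unfolding u_def src.nabla_expands[OF Y T(3) tan(1)] w ..
    have uT: "u \<in> tangent_space A p" unfolding u by (rule src.frame_lincomb_tangent[OF pW])
    have gu: "g p u (e d p) = v (?y d) + (\<Sum>a=1..?m. \<Sum>b=1..?m. ?v a * ?w b * src.christoffel d a b p)"
      if "d \<in> {1..?m}" for d
      unfolding u by (rule src.frame_coefficient[OF pW that])
    \<comment> \<open>For fixed \<open>b\<close>, \<open>cov t b\<close> is again a family of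
      coefficients indexed by the component, so \<open>cov\<close> can be applied to it a second
      time.\<close>
    have c1: "(\<Sum>d=1..?m. ?v d * cov (\<lambda>l q. \<Sum>b=1..?m. ?y b q * cov t b l q) d l p)
        = (\<Sum>b=1..?m. v (?y b) * cov t b l p) + (\<Sum>a=1..?m. \<Sum>b=1..?m. ?v a * ?w b * cov (cov t b) a l p)"
      if l: "l \<in> {1..?n}" for l
    proof -
      have "cov (\<lambda>l q. \<Sum>b=1..?m. ?y b q * cov t b l q) d l p
          = (\<Sum>b=1..?m. e d p (?y b) * cov t b l p + ?y b p * cov (cov t b) d l p)" if d: "d \<in> {1..?m}" for d
      proof (rule cov_lincomb[OF pW _ _ d])
        show "smooth_near A p (?y b)" if "b \<in> {1..?m}" for b by (rule src.smooth_near_frame[OF Y T(3) that])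
        show "smooth_near A p (cov t b l)" if "b \<in> {1..?m}" for b
          using M.smooth_nearI[OF T(1,3)] cov_smooth[where t=t, OF T(1,2) tsm that l] by blast
      qed
      then have "(\<Sum>d=1..?m. ?v d * cov (\<lambda>l q. \<Sum>b=1..?m. ?y b q * cov t b l q) d l p)
          = (\<Sum>d=1..?m. \<Sum>b=1..?m. ?v d * e d p (?y b) * cov t b l p + ?v d * ?w b * cov (cov t b) d l p)"
        unfolding w by (intro sum.cong refl) (simp add: sum_distrib_left distrib_left mult.assoc del: atLeastAtMost_iff One_nat_def)
      also have "\<dots> = (\<Sum>b=1..?m. (\<Sum>d=1..?m. ?v d * e d p (?y b)) * cov t b l p)
          + (\<Sum>a=1..?m. \<Sum>b=1..?m. ?v a * ?w b * cov (cov t b) a l p)"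
        unfolding sum.distrib sum_distrib_right by (intro arg_cong2[of _ _ _ _ "(+)"] sum.swap refl)
      finally show ?thesis unfolding src.tangent_expand_apply[OF pW tan(1), symmetric] .
    qed
    have c2: "(\<Sum>d=1..?m. g p u (e d p) * cov t d l p) = (\<Sum>b=1..?m. v (?y b) * cov t b l p)
        + (\<Sum>a=1..?m. \<Sum>b=1..?m. ?v a * ?w b * (\<Sum>d=1..?m. src.christoffel d a b p * cov t d l p))" for l
      unfolding sum_collect[symmetric] sum.distrib[symmetric] distrib_right[symmetric]
      by (intro sum.cong refl) (simp only: gu)
    have c: "(\<Sum>d=1..?m. ?v d * cov (\<lambda>l q. \<Sum>b=1..?m. ?y b q * cov t b l q) d l p)
        - (\<Sum>d=1..?m. g p u (e d p) * cov t d l p)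
      = (\<Sum>a=1..?m. \<Sum>b=1..?m. ?v a * ?w b * (cov (cov t b) a l p - (\<Sum>d=1..?m. src.christoffel d a b p * cov t d l p)))"
      if l: "l \<in> {1..?n}" for l
      unfolding c1[OF l] c2 right_diff_distrib sum_subtractf by simp
    show "(\<lambda>F. pullback_nabla A B h \<phi> p v (\<lambda>q. pullback_nabla A B h \<phi> q (Y q) S) F
        - pullback_nabla A B h \<phi> p (nabla A g p v Y) S F)
      = (\<lambda>F. \<Sum>a=1..?m. \<Sum>b=1..?m. ?v a * ?w b * (\<Sum>l=1..?n.
        (cov (cov t b) a l p - (\<Sum>d=1..?m. src.christoffel d a b p * cov t d l p)) * \<epsilon> l (\<phi> p) F))"
      unfolding u_def[symmetric] pullback_nabla_cov[OF S T(3) uT]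
        pullback_nabla_cov[OF pullback_nabla_section[OF S Y] T(3) tan(1)] sum_collect[symmetric]
        sum_subtractf[symmetric] left_diff_distrib[symmetric]
      by (rule ext, rule sum.cong[OF refl], rule arg_cong2[of _ _ _ _ "(*)", OF c[unfolded sum_subtractf[symmetric]] refl])
  qed
qed

text \<open>Arguments in the vertical direction vanish under the differential, so the trace over the
  source reduces to a sum over the frame of the target.\<close>

lemma curvature_trace_frame:
  assumes S: "section_expands W\<^sub>0 S t" and p: "p \<in> W\<^sub>0"
  shows "metric_trace_vec A g p (\<lambda>u v. curvature B h (\<phi> p) (differential B \<phi> p u) (S p) (differential B \<phi> p v))
    = (\<lambda>F. \<Sum>l=1..DIM('f). (\<Sum>i=1..DIM('f). \<Sum>j=1..DIM('f). t j p * curvature_coefficient l i j i (\<phi> p))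
        * \<epsilon> l (\<phi> p) F)"
proof
  fix F
  let ?m = "DIM('e)" and ?n = "DIM('f)"
  let ?R = "\<lambda>a b. \<Sum>l=1..?n. (\<Sum>j=1..?n. t j p * curvature_coefficient l a j b (\<phi> p)) * \<epsilon> l (\<phi> p) F"
  have pW: "p \<in> W" using S p by (auto simp: section_expands_def)
  have Sp: "S p \<in> tangent_space B (\<phi> p)" by (rule section_tangent[OF section_expands_section[OF S] p])
  have gS: "h (\<phi> p) (S p) (\<epsilon> j (\<phi> p)) = t j p" if "j \<in> {1..?n}" for j
    by (rule component_lincomb[where q=p and Y=S and y="\<lambda>i. t i p", OF pW _ that])
      (use S p in \<open>simp add: section_expands_def\<close>)
  have "metric_trace_vec A g p (\<lambda>u v. curvature B h (\<phi> p) (differential B \<phi> p u) (S p) (differential B \<phi> p v)) F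
      = (\<Sum>a=1..?m. if a \<le> ?n \<and> a \<le> ?n then ?R a a else 0)"
    unfolding metric_trace_vec_def
  proof (rule src.metric_trace_coefficients[OF pW, where H="\<lambda>a b. if a \<le> ?n \<and> b \<le> ?n then ?R a b else 0"])
    fix u v assume t: "u \<in> tangent_space A p" "v \<in> tangent_space A p"
    let ?u = "\<lambda>a. g p u (e a p)" and ?v = "\<lambda>a. g p v (e a p)"
    have "curvature B h (\<phi> p) (differential B \<phi> p u) (S p) (differential B \<phi> p v) F
        = (\<Sum>l=1..?n. (\<Sum>k=1..?n. (\<Sum>i=1..?n. \<Sum>j=1..?n.
            ?u i * t j p * curvature_coefficient l i j k (\<phi> p)) * ?v k) * \<epsilon> l (\<phi> p) F)"
      unfolding curvature_frame[OF image_in_V[OF pW] differential_tangent[OF t(1)] Sp differential_tangent[OF t(2)]]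
      by (simp add: differential_component[OF pW t(1)] differential_component[OF pW t(2)] gS
          cong: sum.cong del: atLeastAtMost_iff One_nat_def)
    also have "\<dots> = (\<Sum>l=1..?n. (\<Sum>a=1..?n. \<Sum>b=1..?n. ?u a * ?v b *
            (\<Sum>j=1..?n. t j p * curvature_coefficient l a j b (\<phi> p))) * \<epsilon> l (\<phi> p) F)"
    proof (rule sum.cong[OF refl], rule arg_cong2[of _ _ _ _ "(*)", OF _ refl])
      fix l
      show "(\<Sum>k=1..?n. (\<Sum>i=1..?n. \<Sum>j=1..?n. ?u i * t j p * curvature_coefficient l i j k (\<phi> p)) * ?v k)
        = (\<Sum>a=1..?n. \<Sum>b=1..?n. ?u a * ?v b * (\<Sum>j=1..?n. t j p * curvature_coefficient l a j b (\<phi> p)))"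
        unfolding sum_distrib_left sum_distrib_right
        by (rule trans[OF sum.swap], intro sum.cong refl) (simp only: mult_ac)
    qed
    also have "\<dots> = (\<Sum>a=1..?n. \<Sum>b=1..?n. ?u a * ?v b * ?R a b)" by (rule sum_collect)
    also have "\<dots> = (\<Sum>a=1..?m. \<Sum>b=1..?m. ?u a * ?v b * (if a \<le> ?n \<and> b \<le> ?n then ?R a b else 0))"
      unfolding sum_extend2[of "\<lambda>a b. ?u a * ?v b * ?R a b"] by (intro sum.cong refl) simp
    finally show "curvature B h (\<phi> p) (differential B \<phi> p u) (S p) (differential B \<phi> p v) F
      = (\<Sum>a=1..?m. \<Sum>b=1..?m. ?u a * ?v b * (if a \<le> ?n \<and> b \<le> ?n then ?R a b else 0))" .
  qed
  also have "\<dots> = (\<Sum>i=1..?n. ?R i i)" unfolding sum_extend[of "\<lambda>i. ?R i i"] by simp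
  also have "\<dots> = (\<Sum>l=1..?n. (\<Sum>i=1..?n. \<Sum>j=1..?n. t j p * curvature_coefficient l i j i (\<phi> p)) * \<epsilon> l (\<phi> p) F)"
    unfolding sum_distrib_right[of _ "{1..?n}" "\<epsilon> _ (\<phi> p) F"] by (rule sum.swap)
  finally show "metric_trace_vec A g p (\<lambda>u v. curvature B h (\<phi> p) (differential B \<phi> p u) (S p) (differential B \<phi> p v)) F
    = (\<Sum>l=1..?n. (\<Sum>i=1..?n. \<Sum>j=1..?n. t j p * curvature_coefficient l i j i (\<phi> p)) * \<epsilon> l (\<phi> p) F)" .
qed

lemma bitension_field_frame:
  assumes \<tau>: "section_expands W (tension_field A g B h \<phi>) t" and p: "p \<in> W"
  shows "bitension_field A g B h \<phi> p = (\<lambda>F. \<Sum>l=1..DIM('f). ((\<Sum>a=1..DIM('e). cov (cov t a) a l p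
      - (\<Sum>d=1..DIM('e). src.christoffel d a a p * cov t d l p))
    - (\<Sum>i=1..DIM('f). \<Sum>j=1..DIM('f). t j p * curvature_coefficient l i j i (\<phi> p))) * \<epsilon> l (\<phi> p) F)"
proof -
  let ?m = "DIM('e)" and ?n = "DIM('f)" and ?\<tau> = "tension_field A g B h \<phi>"
  let ?H = "\<lambda>F a b. \<Sum>l=1..?n. (cov (cov t b) a l p - (\<Sum>d=1..?m. src.christoffel d a b p * cov t d l p)) * \<epsilon> l (\<phi> p) F"
  have "metric_trace_vec A g p (second_covariant_derivative A g B h \<phi> ?\<tau> p) F = (\<Sum>a=1..?m. ?H F a a)" for F
    unfolding metric_trace_vec_def
    by (rule src.metric_trace_coefficients[OF p, where H="?H F"])
      (simp only: second_covariant_derivative_frame[OF \<tau> p])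
  also have "(\<Sum>a=1..?m. ?H F a a) = (\<Sum>l=1..?n. (\<Sum>a=1..?m. cov (cov t a) a l p
      - (\<Sum>d=1..?m. src.christoffel d a a p * cov t d l p)) * \<epsilon> l (\<phi> p) F)" for F
    unfolding sum_distrib_right[of _ "{1..?m}" "\<epsilon> _ (\<phi> p) F"] by (rule sum.swap)
  finally show ?thesis
    unfolding bitension_field_def Let_def curvature_trace_frame[OF \<tau> p] left_diff_distrib sum_subtractf
    by simp
qed

end

section \<open>The rough Laplacian of a section and the horizontal projection\<close>

context adapted_frames begin

text \<open>The parts in which only frame fields act on \<open>t l\<close> form the Laplacian of
  \<open>t l\<close>. In the remaining first-order correction the horizontal directions contribute
  the traces of \<open>P\<close>, and the vertical one contributes \<open>K\<close>.\<close>

lemma rough_laplacian_coefficient: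
  assumes p: "p \<in> W" and t: "\<And>l. l \<in> {1..DIM('f)} \<Longrightarrow> smooth_on A W (t l)"
    and K: "\<And>d. d \<in> {1..DIM('f)} \<Longrightarrow> src.christoffel d (DIM('f) + 1) (DIM('f) + 1) p = K d"
    and H: "\<And>d i. d \<in> {1..DIM('f)} \<Longrightarrow> i \<in> {1..DIM('f)} \<Longrightarrow> src.christoffel d i i p = christoffel d i i (\<phi> p)"
    and Z: "\<And>a. a \<in> {1..DIM('e)} \<Longrightarrow> src.christoffel (DIM('f) + 1) a a p = 0"
    and l: "l \<in> {1..DIM('f)}"
  defines "P \<equiv> \<lambda>k i j q. christoffel k i j (\<phi> q)"
  shows "(\<Sum>a=1..DIM('e). cov (cov t a) a l p - (\<Sum>d=1..DIM('e). src.christoffel d a a p * cov t d l p))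
    = laplacian A g (t l) p + (\<Sum>i=1..DIM('f). \<Sum>j=1..DIM('f). 2 * e i p (t j) * P l i j p
        + t j p * (e i p (P l i j) + (\<Sum>c=1..DIM('f). P c i j p * P l i c p) - K i * P l i j p
          - (\<Sum>c=1..DIM('f). P c i i p * P l c j p)))"
proof -
  let ?m = "DIM('e)" and ?n = "DIM('f)"
  let ?EE = "\<lambda>a. e a p (\<lambda>q. e a q (t l))"
  have tnear: "smooth_near A p (t c)" if "c \<in> {1..?n}" for c
    by (rule M.smooth_nearI[OF open_W p t[OF that]])
  have Pnear: "smooth_near A p (P k i j)" if "i \<in> {1..?n}" "j \<in> {1..?n}" "k \<in> {1..?n}" for k i j
    unfolding P_def by (rule M.smooth_nearI[OF open_W p christoffel_compose_smooth[OF that order_refl]])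
  \<comment> \<open>The factor 2 has two sources: the outer derivative acting on \<open>t j\<close>
    in the connection term of the inner \<open>cov\<close>, and the outer connection term acting on
    the derivative of \<open>t j\<close>.\<close>
  have hor: "cov (cov t a) a l p = ?EE a + (\<Sum>j=1..?n. 2 * e a p (t j) * P l a j p
      + t j p * (e a p (P l a j) + (\<Sum>c=1..?n. P c a j p * P l a c p)))" if a: "a \<in> {1..?n}" for a
  proof -
    have tan: "e a p \<in> tangent_space A p" by (rule src.frame_tangent[OF p index_le[OF a]])
    have cov: "cov t a c = (\<lambda>q. e a q (t c) + (\<Sum>j=1..?n. t j q * P c a j q))" for c
      using a by (simp add: cov_def[abs_def] P_def)
    have near: "smooth_near A p (\<lambda>q. e a q (t l))"
      by (rule M.smooth_nearI[OF open_W p M.vector_field_smooth_on[OF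
            src.frame_vector_field[OF index_le[OF a] order_refl] order_refl open_W t[OF l] order_refl]])
    have "e a p (cov t a l) = ?EE a + e a p (\<lambda>q. \<Sum>j=1..?n. t j q * P l a j q)"
      unfolding cov
      by (intro M.tangent_add[OF tan near] M.smooth_near_sum M.smooth_near_mult tnear Pnear a l)
    also have "e a p (\<lambda>q. \<Sum>j=1..?n. t j q * P l a j q) = (\<Sum>j=1..?n. e a p (t j) * P l a j p + t j p * e a p (P l a j))"
      by (rule M.tangent_sum_mult[OF tan tnear Pnear[OF a _ l]])
    finally have 1: "e a p (cov t a l) = ?EE a + (\<Sum>j=1..?n. e a p (t j) * P l a j p + t j p * e a p (P l a j))" .
    have "(\<Sum>c=1..?n. (\<Sum>j=1..?n. t j p * P c a j p) * P l a c p)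
        = (\<Sum>j=1..?n. t j p * (\<Sum>c=1..?n. P c a j p * P l a c p))"
      unfolding sum_distrib_left sum_distrib_right
      by (rule trans[OF sum.swap]) (simp only: mult.assoc)
    then have 2: "(\<Sum>c=1..?n. cov t a c p * P l a c p) = (\<Sum>j=1..?n. e a p (t j) * P l a j p)
        + (\<Sum>j=1..?n. t j p * (\<Sum>c=1..?n. P c a j p * P l a c p))"
      unfolding cov by (simp add: distrib_right sum.distrib)
    have "cov (cov t a) a l p = e a p (cov t a l) + (\<Sum>c=1..?n. cov t a c p * P l a c p)"
      using a unfolding cov_def[of "cov t a"] P_def by simp
    then show ?thesis
      unfolding 1 2 by (simp add: distrib_left sum.distrib sum_distrib_left mult.assoc)
  qed
  have ver: "cov (cov t (?n + 1)) (?n + 1) l p = ?EE (?n + 1)"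
  proof -
    have "cov t (?n + 1) l = (\<lambda>q. e (?n + 1) q (t l))" by (simp add: cov_def[abs_def])
    then show ?thesis unfolding cov_def[of "cov t (?n + 1)"] by simp
  qed
  have 1: "(\<Sum>a=1..?m. cov (cov t a) a l p) = (\<Sum>a=1..?m. ?EE a) + (\<Sum>i=1..?n. \<Sum>j=1..?n. 2 * e i p (t j) * P l i j p
        + t j p * (e i p (P l i j) + (\<Sum>c=1..?n. P c i j p * P l i c p)))"
    unfolding sum_top ver using hor by (simp add: sum.distrib cong: sum.cong del: atLeastAtMost_iff One_nat_def)
  \<comment> \<open>This isolates the connection part of the correction term; its derivative part
    belongs to the Laplacian. The outer sum is split into horizontal indices, evaluated by
    \<open>H\<close>, and the vertical one, evaluated by \<open>K\<close>.\<close>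
  have "(\<Sum>a=1..?m. \<Sum>d=1..?m. src.christoffel d a a p * (if d \<le> ?n then \<Sum>j=1..?n. t j p * P l d j p else 0))
      = (\<Sum>a=1..?m. \<Sum>d=1..?n. src.christoffel d a a p * (\<Sum>j=1..?n. t j p * P l d j p))"
    unfolding sum_extend[of "\<lambda>d. src.christoffel d _ _ p * _ d"] by (intro sum.cong refl) simp
  also have "\<dots> = (\<Sum>i=1..?n. \<Sum>c=1..?n. P c i i p * (\<Sum>j=1..?n. t j p * P l c j p))
      + (\<Sum>i=1..?n. K i * (\<Sum>j=1..?n. t j p * P l i j p))"
    unfolding sum_top[of "\<lambda>a. \<Sum>d=1..?n. src.christoffel d a a p * _ d"] P_def
    by (simp add: H K cong: sum.cong del: atLeastAtMost_iff One_nat_def)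
  also have "(\<Sum>i=1..?n. \<Sum>c=1..?n. P c i i p * (\<Sum>j=1..?n. t j p * P l c j p))
      = (\<Sum>i=1..?n. \<Sum>j=1..?n. t j p * (\<Sum>c=1..?n. P c i i p * P l c j p))"
    unfolding sum_distrib_left
    by (rule sum.cong[OF refl], rule trans[OF sum.swap], intro sum.cong refl) (simp only: mult_ac)
  also have "(\<Sum>i=1..?n. K i * (\<Sum>j=1..?n. t j p * P l i j p)) = (\<Sum>i=1..?n. \<Sum>j=1..?n. t j p * (K i * P l i j p))"
    unfolding sum_distrib_left by (intro sum.cong refl) (simp only: mult_ac)
  finally have 2: "(\<Sum>a=1..?m. \<Sum>d=1..?m. src.christoffel d a a p * cov t d l p)
      = (\<Sum>a=1..?m. \<Sum>d=1..?m. src.christoffel d a a p * e d p (t l))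
        + ((\<Sum>i=1..?n. \<Sum>j=1..?n. t j p * (\<Sum>c=1..?n. P c i i p * P l c j p))
        + (\<Sum>i=1..?n. \<Sum>j=1..?n. t j p * (K i * P l i j p)))"
    unfolding cov_def distrib_left sum.distrib P_def by simp
  show ?thesis
    unfolding src.laplacian_frame[OF p tnear[OF l]] sum_subtractf 1 2
    by (simp add: distrib_left right_diff_distrib sum.distrib sum_subtractf)
qed

lemma vertical_component:
  assumes p: "p \<in> W" and w: "w \<in> vertical_space A B \<phi> p" and b: "b \<in> {1..DIM('f)}"
  shows "g p w (e b p) = 0"
proof -
  have "w \<in> tangent_space A p" "differential B \<phi> p w = (\<lambda>F. 0)"
    using w by (auto simp: vertical_space_def)
  then show ?thesis
    using differential_component[OF p _ b, of w] frame_coefficient[OF image_in_V[OF p] b, of "\<lambda>i. 0"]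
    by simp
qed

text \<open>A vector without vertical component is horizontal, and another candidate would differ
  from it by a vector both horizontal and vertical, hence of length 0.\<close>

lemma horizontal_part_eq:
  assumes p: "p \<in> W" and v: "v \<in> tangent_space A p" and 0: "g p v (e (DIM('f) + 1) p) = 0"
  shows "horizontal_part A g B \<phi> p v = v"
  unfolding horizontal_part_def
proof (rule the_equality, intro conjI)
  have orth: "g p v w = 0" if w: "w \<in> vertical_space A B \<phi> p" for w
  proof -
    have "g p v w = (\<Sum>i=1..DIM('e). g p v (e i p) * g p w (e i p))"
      by (rule src.frame_parseval[OF p v]) (use w in \<open>simp add: vertical_space_def\<close>)
    then show ?thesis
      unfolding sum_top 0 using vertical_component[OF p w]
      by (simp del: atLeastAtMost_iff One_nat_def)
  qed
  show hv: "v \<in> horizontal_space A g B \<phi> p" using v orth by (simp add: horizontal_space_def)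
  show "(\<lambda>f. v f - v f) \<in> vertical_space A B \<phi> p" by (auto simp: vertical_space_def differential_def)
  fix w assume w: "w \<in> horizontal_space A g B \<phi> p \<and> (\<lambda>f. v f - w f) \<in> vertical_space A B \<phi> p"
  let ?d = "\<lambda>f. 1 * v f + (-1) * w f"
  have wT: "w \<in> tangent_space A p" and d: "?d \<in> vertical_space A B \<phi> p"
    using w by (simp_all add: horizontal_space_def)
  then have dT: "?d \<in> tangent_space A p" by (simp only: vertical_space_def mem_Collect_eq)
  have "g p ?d ?d = 1 * g p v ?d + (-1) * g p w ?d"
    using src.metric_bilinear v wT dT unfolding bilinear_on_def by blast
  moreover have "g p w ?d = 0" using w d unfolding horizontal_space_def by blast
  ultimately have "g p ?d ?d = 0" using orth[OF d] by simp
  then have "?d = (\<lambda>f. 0)" using src.metric_pos[OF dT] by fastforce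
  then have "v f - w f = 0" for f using fun_cong[of ?d "\<lambda>f. 0" f] by simp
  then show "w = v" by auto
qed

end

section \<open>From the integrability data to the coefficients of the bitension field\<close>

theorem theorem3p1:
  fixes A :: "('a::{t2_space,second_countable_topology}, 'e::euclidean_space) atlas"
    and B :: "('b::{t2_space,second_countable_topology}, 'f::euclidean_space) atlas"
    and g :: "'a metric" and h :: "'b metric"
    and \<phi> :: "'a \<Rightarrow> 'b" and n :: nat
    and W :: "'a set" and V :: "'b set"
    and e :: "nat \<Rightarrow> 'a \<Rightarrow> 'a tvec" and \<epsilon> :: "nat \<Rightarrow> 'b \<Rightarrow> 'b tvec"
    and f P :: "nat \<Rightarrow> nat \<Rightarrow> nat \<Rightarrow> 'a \<Rightarrow> real"
    and \<kappa> :: "nat \<Rightarrow> 'a \<Rightarrow> real" and \<sigma> :: "nat \<Rightarrow> nat \<Rightarrow> 'a \<Rightarrow> real"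
    and \<mu> :: "'a \<Rightarrow> 'a tvec"
  assumes dims: "DIM('e) = n + 1" "DIM('f) = n"
    and M: "smooth_atlas A" "riemannian_metric A g"
    and N: "smooth_atlas B" "riemannian_metric B h"
    and submersion: "riemannian_submersion A g B h \<phi>"
    and frame: "adapted_frame A g B h \<phi> W V e \<epsilon>"
    and data: "integrability_data A B \<phi> W V e \<epsilon> f \<kappa> \<sigma>"
    and P: "\<And>i j k. P k i j = (\<lambda>p. 1/2 * (- f j i k p - f i j k p + f k i j p))"
    and \<mu>: "\<mu> = fiber_mean_curvature A g B \<phi> e"
  shows "biharmonic_on A g B h W \<phi> \<longleftrightarrow>
    (\<forall>p\<in>W. \<forall>k\<in>{1..n}.
       laplacian A g (\<kappa> k) p
       + (\<Sum>i=1..n. \<Sum>j=1..n.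
            2 * e i p (\<kappa> j) * P k i j p
            + \<kappa> j p * (e i p (P k i j)
                + (\<Sum>l=1..n. P l i j p * P k i l p)
                - \<kappa> i p * P k i j p
                - (\<Sum>l=1..n. P l i i p * P k l j p)))
       + ricci B h (\<phi> p) (differential B \<phi> p (\<mu> p)) (differential B \<phi> p (e k p)) = 0)"
proof -
  note nf = dims(2) and ne = dims(1)
  note data' = data[unfolded integrability_data_def Let_def nf]
  interpret adapted_frames A B \<phi> h V \<epsilon> W g e
    using M N submersion frame dims
    by unfold_locales (auto simp: adapted_frame_def riemannian_submersion_def orthonormal_frame_def
        vertical_space_def)
  let ?I = "{1..n}" and ?m = "n + 1"
  obtain F where F': "\<forall>i\<in>?I. \<forall>j\<in>?I.
      (\<forall>k\<in>?I. smooth_on B V (F k i j) \<and> (\<forall>p\<in>W. f k i j p = F k i j (\<phi> p))) \<and>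
      (\<forall>q\<in>V. lie_bracket B (\<epsilon> i) (\<epsilon> j) q = (\<lambda>u. \<Sum>k=1..n. F k i j q * \<epsilon> k q u))"
    using data'[THEN conjunct1] ..
  have F: "f k i j p = F k i j (\<phi> p)" if "i \<in> ?I" "j \<in> ?I" "k \<in> ?I" "p \<in> W" for i j k p
    using F'[rule_format, OF that(1,2)] that(3,4) by simp
  have brN: "lie_bracket B (\<epsilon> i) (\<epsilon> j) q = (\<lambda>u. \<Sum>k=1..n. F k i j q * \<epsilon> k q u)"
    if "i \<in> ?I" "j \<in> ?I" "q \<in> V" for i j q
    using F'[rule_format, OF that(1,2)] that(3) by simp
  note vert = data'[THEN conjunct2, THEN conjunct1, rule_format]
  have \<kappa>: "smooth_on A W (\<kappa> i)" if "i \<in> ?I" for i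
    using vert[OF that] ..
  have \<kappa>br: "lie_bracket A (e i) (e ?m) p = (\<lambda>u. \<kappa> i p * e ?m p u)" if "i \<in> ?I" "p \<in> W" for i p
    using vert[OF that(1), THEN conjunct2, rule_format, OF that(2)] .
  have br: "lie_bracket A (e i) (e j) p = (\<lambda>u. (\<Sum>k=1..n. f k i j p * e k p u) - 2 * \<sigma> i j p * e ?m p u)"
    if "i \<in> ?I" "j \<in> ?I" "p \<in> W" for i j p
    using data'[THEN conjunct2, THEN conjunct2, rule_format, OF that(1,2), THEN conjunct2, rule_format, OF that(3)] .
  have Im: "i \<in> {1..DIM('e)}" if "i \<in> ?I" for i using that ne by simp
  have mm: "?m \<in> {1..DIM('e)}" using ne by simp
  have cN: "structure_coefficient k i j q = F k i j q" if "i \<in> ?I" "j \<in> ?I" "k \<in> ?I" "q \<in> V" for i j k q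
    using frame_coefficient[OF that(4), of k "\<lambda>k. F k i j q"] brN[OF that(1,2,4)] that(3)
    by (simp add: structure_coefficient_def nf)
  have c: "src.structure_coefficient k i j p = f k i j p" if "i \<in> ?I" "j \<in> ?I" "k \<in> ?I" "p \<in> W" for i j k p
  proof -
    \<comment> \<open>The bracket rewritten as a single sum over the full frame, with the
      coefficient of the vertical field in the last place.\<close>
    let ?c = "\<lambda>k. if k \<le> n then f k i j p else - 2 * \<sigma> i j p"
    have "lie_bracket A (e i) (e j) p = (\<lambda>u. \<Sum>k=1..DIM('e). ?c k * e k p u)"
      unfolding br[OF that(1,2,4)] ne by simp
    then show ?thesis
      using src.frame_coefficient[OF that(4) Im[OF that(3)], of ?c] that(3)
      by (simp add: src.structure_coefficient_def)
  qed
  have cv: "src.structure_coefficient k i ?m p = (if k = ?m then \<kappa> i p else 0)"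
    if "i \<in> ?I" "k \<in> {1..DIM('e)}" "p \<in> W" for i k p
  proof -
    let ?c = "\<lambda>k. if k = ?m then \<kappa> i p else 0"
    have "lie_bracket A (e i) (e ?m) p = (\<lambda>u. \<Sum>k=1..DIM('e). ?c k * e k p u)"
      unfolding \<kappa>br[OF that(1,3)] ne by simp
    then show ?thesis
      using src.frame_coefficient[OF that(3,2), of ?c] by (simp only: src.structure_coefficient_def)
  qed
  \<comment> \<open>\<open>P\<close> is the Koszul coefficient of the target, with the lower indices
    of one bracket coefficient exchanged; antisymmetry supplies the sign.\<close>
  have P\<Gamma>: "P k i j p = christoffel k i j (\<phi> p)" if "i \<in> ?I" "j \<in> ?I" "k \<in> ?I" "p \<in> W" for i j k p
    using structure_antisym[OF image_in_V[OF that(4)], of i k j] that cN image_in_V[OF that(4)]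
    by (simp add: P christoffel_def F nf)
  \<comment> \<open>Only horizontal indices occur, where the structure functions of the two frames
    agree.\<close>
  have H: "src.christoffel d i i p = christoffel d i i (\<phi> p)" if "d \<in> ?I" "i \<in> ?I" "p \<in> W" for d i p
    unfolding christoffel_def src.christoffel_def
    using that cN[OF _ _ _ image_in_V[OF that(3)]] c F by simp
  \<comment> \<open>The vertical coefficient of the bracket of \<open>e d\<close> with
    \<open>e ?m\<close> enters the Koszul formula twice and absorbs the factor 1/2; the remaining
    bracket is that of \<open>e ?m\<close> with itself.\<close>
  have K: "src.christoffel d ?m ?m p = \<kappa> d p" if "d \<in> ?I" "p \<in> W" for d p
    using src.structure_antisym[OF that(2) mm mm Im[OF that(1)]] cv[OF that(1) mm that(2)]
      src.structure_antisym[OF that(2) Im[OF that(1)] mm mm]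
    by (simp add: src.christoffel_def)
  \<comment> \<open>For vertical \<open>a\<close> skewness makes the coefficient its own negative.
    For horizontal \<open>a\<close> the bracket of \<open>e a\<close> with \<open>e ?m\<close> has
    no component along \<open>e a\<close>.\<close>
  have Z: "src.christoffel ?m a a p = 0" if a: "a \<in> {1..DIM('e)}" and p: "p \<in> W" for a p
    using src.christoffel_antisym[OF p a a mm]
  proof (cases "a = ?m")
    case False
    then have aI: "a \<in> ?I" using a ne by auto
    then show ?thesis
      using src.structure_antisym[OF p a a mm] cv[OF aI a p] src.structure_antisym[OF p a mm a] False
      by (simp add: src.christoffel_def)
  qed simp
  have tension: "section_expands W (tension_field A g B h \<phi>) (\<lambda>l q. - \<kappa> l q)"
    unfolding section_expands_def
  proof (intro conjI ballI open_W order_refl)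
    show "smooth_on A W (\<lambda>q. - \<kappa> i q)" if "i \<in> {1..DIM('f)}" for i
      by (rule M.smooth_on_minus[OF open_W \<kappa>]) (use that nf in simp)
    fix q assume q: "q \<in> W"
    \<comment> \<open>The horizontal contributions cancel by \<open>H\<close>; the vertical index
      alone contributes, by \<open>K\<close>.\<close>
    have "(\<Sum>i=1..DIM('f). christoffel l i i (\<phi> q)) - (\<Sum>a=1..DIM('e). src.christoffel l a a q) = - \<kappa> l q"
      if l: "l \<in> ?I" for l
      unfolding sum_top nf by (simp add: H[OF l _ q] K[OF l q] cong: sum.cong del: atLeastAtMost_iff One_nat_def)
    then show "tension_field A g B h \<phi> q = (\<lambda>F. \<Sum>i=1..DIM('f). - \<kappa> i q * \<epsilon> i (\<phi> q) F)"
      unfolding tension_field_frame[OF q] nf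
      by (simp cong: sum.cong del: atLeastAtMost_iff One_nat_def)
  qed
  have bitension: "bitension_field A g B h \<phi> p = (\<lambda>F. \<Sum>k=1..n. - (laplacian A g (\<kappa> k) p
       + (\<Sum>i=1..n. \<Sum>j=1..n.
            2 * e i p (\<kappa> j) * P k i j p
            + \<kappa> j p * (e i p (P k i j)
                + (\<Sum>l=1..n. P l i j p * P k i l p)
                - \<kappa> i p * P k i j p
                - (\<Sum>l=1..n. P l i i p * P k l j p)))
       + ricci B h (\<phi> p) (differential B \<phi> p (\<mu> p)) (differential B \<phi> p (e k p))) * \<epsilon> k (\<phi> p) F)"
    if p: "p \<in> W" for p
  proof -
    have tan: "e i p \<in> tangent_space A p" if "i \<in> {1..DIM('e)}" for i by (rule src.frame_tangent[OF p that])
    have near: "smooth_near A q (\<kappa> k)" if "k \<in> ?I" "q \<in> W" for k q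
      by (rule M.smooth_nearI[OF open_W that(2) \<kappa>[OF that(1)]])
    have neg: "e i q (\<lambda>q. - \<kappa> k q) = - e i q (\<kappa> k)" if "i \<in> {1..DIM('e)}" "k \<in> ?I" "q \<in> W" for i k q
      by (rule M.tangent_minus[OF src.frame_tangent[OF that(3,1)] near[OF that(2,3)]])
    have neg2: "e i p (\<lambda>q. e i q (\<lambda>q. - \<kappa> k q)) = - e i p (\<lambda>q. e i q (\<kappa> k))"
      if "i \<in> {1..DIM('e)}" "k \<in> ?I" for i k
    proof -
      have "e i p (\<lambda>q. e i q (\<lambda>q. - \<kappa> k q)) = e i p (\<lambda>q. - e i q (\<kappa> k))"
        by (rule M.tangent_cong[OF tan[OF that(1)] open_W p neg[OF that]])
      also have "\<dots> = - e i p (\<lambda>q. e i q (\<kappa> k))"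
        by (rule M.tangent_minus[OF tan[OF that(1)] M.smooth_nearI[OF open_W p M.vector_field_smooth_on[OF
            src.frame_vector_field[OF that(1) order_refl] order_refl open_W \<kappa>[OF that(2)] order_refl]]])
      finally show ?thesis .
    qed
    have lap: "laplacian A g (\<lambda>q. - \<kappa> k q) p = - laplacian A g (\<kappa> k) p" if k: "k \<in> ?I" for k
      unfolding src.laplacian_frame[OF p near[OF k p]]
        src.laplacian_frame[OF p M.smooth_nearI[OF open_W p M.smooth_on_minus[OF open_W \<kappa>[OF k]]]]
      by (simp add: neg[OF _ k p] neg2[OF _ k] sum_negf sum_subtractf cong: sum.cong
          del: atLeastAtMost_iff One_nat_def)
    have dP: "e i p (\<lambda>q. christoffel k i j (\<phi> q)) = e i p (P k i j)"
      if "i \<in> ?I" "j \<in> ?I" "k \<in> ?I" for i j k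
      by (rule M.tangent_cong[OF tan[OF Im[OF that(1)]] open_W p P\<Gamma>[OF that, symmetric]])
    \<comment> \<open>The derivative before projection. As \<open>e ?m\<close> has constant frame
      coefficients, only one connection coefficient remains in each component.\<close>
    define v where "v = nabla A g p (e ?m p) (e ?m)"
    have "src.expands W (e ?m) (\<lambda>i q. if i = ?m then 1 else 0)"
      unfolding src.expands_def ne by (simp add: open_W)
    then have "v = (\<lambda>f. \<Sum>l=1..DIM('e). (e ?m p (\<lambda>q. if l = ?m then 1 else 0)
        + (\<Sum>a=1..DIM('e). \<Sum>b=1..DIM('e). g p (e ?m p) (e a p) * (if b = ?m then 1 else 0) * src.christoffel l a b p))
          * e l p f)"
      unfolding v_def by (rule src.nabla_expands[OF _ p tan[OF mm]])
    moreover have "(\<Sum>a=1..DIM('e). \<Sum>b=1..DIM('e). g p (e ?m p) (e a p) * (if b = ?m then 1 else 0) * src.christoffel l a b p)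
        = src.christoffel l ?m ?m p" for l
    proof -
      have "(\<Sum>a=1..DIM('e). \<Sum>b=1..DIM('e). g p (e ?m p) (e a p) * (if b = ?m then 1 else 0) * src.christoffel l a b p)
        = (\<Sum>a=1..DIM('e). \<Sum>b=1..DIM('e). if b = ?m then (if a = ?m then src.christoffel l a b p else 0) else 0)"
        by (intro sum.cong refl) (simp add: src.frame_ortho[OF p mm] del: atLeastAtMost_iff One_nat_def)
      then show ?thesis using mm by (simp add: sum.delta)
    qed
    ultimately have v: "v = (\<lambda>f. \<Sum>l=1..DIM('e). src.christoffel l ?m ?m p * e l p f)"
      using M.tangent_const[OF tan[OF mm]] by simp
    have vT: "v \<in> tangent_space A p" unfolding v by (rule src.frame_lincomb_tangent[OF p])
    have gv: "g p v (e l p) = src.christoffel l ?m ?m p" if "l \<in> {1..DIM('e)}" for l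
      unfolding v by (rule src.frame_coefficient[OF p that])
    \<comment> \<open>By \<open>Z\<close> the vector \<open>v\<close> has no vertical component, so
      the projection leaves it unchanged.\<close>
    have "\<mu> p = v"
      unfolding \<mu> fiber_mean_curvature_def Let_def nf v_def[symmetric]
      by (rule horizontal_part_eq[OF p vT]) (simp only: nf gv[OF mm] Z[OF mm p])
    then have h\<mu>: "h (\<phi> p) (differential B \<phi> p (\<mu> p)) (\<epsilon> j (\<phi> p)) = \<kappa> j p" if "j \<in> ?I" for j
      using differential_component[OF p vT, of j] gv[OF Im[OF that]] K[OF that p] that nf by simp
    have \<mu>T: "differential B \<phi> p (\<mu> p) \<in> tangent_space B (\<phi> p)"
      using \<open>\<mu> p = v\<close> differential_tangent[OF vT] by simp
    have ric: "ricci B h (\<phi> p) (differential B \<phi> p (\<mu> p)) (differential B \<phi> p (e k p))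
        = (\<Sum>i=1..n. \<Sum>j=1..n. \<kappa> j p * curvature_coefficient i i j k (\<phi> p))" if k: "k \<in> ?I" for k
    proof -
      have hk: "h (\<phi> p) (differential B \<phi> p (e k p)) (\<epsilon> b (\<phi> p)) = (if b = k then 1 else 0)" if "b \<in> ?I" for b
        using differential_component[OF p tan[OF Im[OF k]], of b] src.frame_ortho[OF p Im[OF k] Im[OF that]] that nf
        by auto
      have "ricci B h (\<phi> p) (differential B \<phi> p (\<mu> p)) (differential B \<phi> p (e k p))
          = (\<Sum>i=1..n. \<Sum>b=1..n. \<Sum>j=1..n. \<kappa> j p * (if b = k then 1 else 0) * curvature_coefficient i i j b (\<phi> p))"
        unfolding ricci_frame[OF image_in_V[OF p] \<mu>T differential_tangent[OF tan[OF Im[OF k]]]] nf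
        by (simp add: h\<mu> hk cong: sum.cong del: atLeastAtMost_iff One_nat_def)
      also have "\<dots> = (\<Sum>i=1..n. \<Sum>b=1..n. if b = k then \<Sum>j=1..n. \<kappa> j p * curvature_coefficient i i j b (\<phi> p) else 0)"
        by (intro sum.cong refl) simp
      finally show ?thesis using k by (simp add: sum.delta)
    qed
    \<comment> \<open>Exchanging the component index with the last argument changes the sign. This
      compensates the sign of the tension field and produces the contraction that defines the Ricci
      tensor.\<close>
    have cur: "(\<Sum>i=1..n. \<Sum>j=1..n. - \<kappa> j p * curvature_coefficient k i j i (\<phi> p))
        = (\<Sum>i=1..n. \<Sum>j=1..n. \<kappa> j p * curvature_coefficient i i j k (\<phi> p))" if k: "k \<in> ?I" for k
      using curvature_coefficient_antisym[OF image_in_V[OF p], unfolded nf, OF _ _ _ k]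
      by (intro sum.cong refl) (simp del: atLeastAtMost_iff One_nat_def)
    show ?thesis
      unfolding bitension_field_frame[OF tension p] nf
    proof (rule ext, rule sum.cong[OF refl], rule arg_cong2[of _ _ _ _ "(*)", OF _ refl])
      fix k assume k: "k \<in> ?I"
      let ?t = "\<lambda>l q. - \<kappa> l q"
      have "(\<Sum>a=1..DIM('e). cov (cov ?t a) a k p - (\<Sum>d=1..DIM('e). src.christoffel d a a p * cov ?t d k p))
        = laplacian A g (?t k) p + (\<Sum>i=1..n. \<Sum>j=1..n. 2 * e i p (?t j) * christoffel k i j (\<phi> p)
          + ?t j p * (e i p (\<lambda>q. christoffel k i j (\<phi> q))
            + (\<Sum>c=1..n. christoffel c i j (\<phi> p) * christoffel k i c (\<phi> p)) - \<kappa> i p * christoffel k i j (\<phi> p)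
          - (\<Sum>c=1..n. christoffel c i i (\<phi> p) * christoffel k c j (\<phi> p))))"
        \<comment> \<open>Here \<open>t\<close> becomes minus \<open>\<kappa>\<close> while
          \<open>K\<close> remains \<open>\<kappa>\<close>, since it stems from the connection of
          the source. The expression is linear in \<open>t\<close>, so one common sign factors out,
          also from the terms quadratic in \<open>\<kappa>\<close>.\<close>
        by (rule rough_laplacian_coefficient[where t="?t" and K="\<lambda>d. \<kappa> d p", unfolded nf, OF p
              M.smooth_on_minus[OF open_W \<kappa>] K[OF _ p] H[OF _ _ p] Z[OF _ p] k])
      also have "\<dots> = - laplacian A g (\<kappa> k) p - (\<Sum>i=1..n. \<Sum>j=1..n. 2 * e i p (\<kappa> j) * P k i j p
          + \<kappa> j p * (e i p (P k i j) + (\<Sum>l=1..n. P l i j p * P k i l p) - \<kappa> i p * P k i j p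
          - (\<Sum>l=1..n. P l i i p * P k l j p)))"
        unfolding lap[OF k] diff_conv_add_uminus[of "- laplacian A g (\<kappa> k) p"] sum_negf[symmetric]
        by (intro arg_cong2[of _ _ _ _ "(+)"] sum.cong refl)
          (simp add: P\<Gamma>[OF _ _ _ p] dP neg[OF Im _ p] k algebra_simps cong: sum.cong del: atLeastAtMost_iff One_nat_def)
      finally show "(\<Sum>a=1..DIM('e). cov (cov ?t a) a k p - (\<Sum>d=1..DIM('e). src.christoffel d a a p * cov ?t d k p))
          - (\<Sum>i=1..n. \<Sum>j=1..n. ?t j p * curvature_coefficient k i j i (\<phi> p))
        = - (laplacian A g (\<kappa> k) p
         + (\<Sum>i=1..n. \<Sum>j=1..n.
              2 * e i p (\<kappa> j) * P k i j p
              + \<kappa> j p * (e i p (P k i j)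
                  + (\<Sum>l=1..n. P l i j p * P k i l p)
                  - \<kappa> i p * P k i j p
                  - (\<Sum>l=1..n. P l i i p * P k l j p)))
         + ricci B h (\<phi> p) (differential B \<phi> p (\<mu> p)) (differential B \<phi> p (e k p)))"
        unfolding cur[OF k] ric[OF k] by simp
    qed
  qed
  show ?thesis
    unfolding biharmonic_on_def
  proof (intro ball_cong refl)
    fix p assume p: "p \<in> W"
    let ?\<beta> = "\<lambda>k. laplacian A g (\<kappa> k) p
       + (\<Sum>i=1..n. \<Sum>j=1..n.
            2 * e i p (\<kappa> j) * P k i j p
            + \<kappa> j p * (e i p (P k i j)
                + (\<Sum>l=1..n. P l i j p * P k i l p)
                - \<kappa> i p * P k i j p
                - (\<Sum>l=1..n. P l i i p * P k l j p)))
       + ricci B h (\<phi> p) (differential B \<phi> p (\<mu> p)) (differential B \<phi> p (e k p))"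
    show "bitension_field A g B h \<phi> p = (\<lambda>F. 0) \<longleftrightarrow> (\<forall>k\<in>?I. ?\<beta> k = 0)"
    proof
      assume "bitension_field A g B h \<phi> p = (\<lambda>F. 0)"
      then have "(\<Sum>k=1..n. - ?\<beta> k * \<epsilon> k (\<phi> p) F) = 0" for F
        unfolding bitension[OF p] by (rule fun_cong)
      \<comment> \<open>The frame vectors at \<open>\<phi> p\<close> are independent, so a vanishing
        combination has vanishing coefficients.\<close>
      then have neg0: "- ?\<beta> k = 0" if "k \<in> ?I" for k
        using frame_coefficients_unique[OF image_in_V[OF p], of "\<lambda>k. - ?\<beta> k" "\<lambda>k. 0" k] that
        unfolding nf by simp
      show "\<forall>k\<in>?I. ?\<beta> k = 0"
        by (rule ballI, rule iffD1[OF neg_equal_0_iff_equal neg0])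
    next
      assume "\<forall>k\<in>?I. ?\<beta> k = 0"
      then show "bitension_field A g B h \<phi> p = (\<lambda>F. 0)"
        unfolding bitension[OF p] by (intro ext sum.neutral ballI) simp
    qed
  qed
qed

end
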